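(* Let $C$ be a maximal chord separated collection in $2^{[n]}$. The set $\mathbf S^\ast(C)$ of maximal by size strongly separated collections contained in $C$ is a distributive lattice with the minimal element $\mathcal I_n$ and the maximal element $\mathrm{co}\text{-}\mathcal I_n$, in which $S\in\mathbf S^\ast(C)$ immediately precedes $S'\in\mathbf S^\ast(C)$ if and only if $S'$ is obtained from $S$ by one raising flip.
   Context: Notation: $[n]=\{1,\ldots,n\}$; $A-B=\{a\in A: a\notin B\}$; for $X\subseteq[n]$ and elements $a,\ldots,b\notin X$, $Xa\ldots b$ denotes $X\cup\{a,\ldots,b\}$. For $A,B\subseteq[n]$ write $A<B$ if $\max(A)<\min(B)$ (with $\max(\emptyset)=\min(\emptyset)=0$). $A,B$ are strongly separated if $A=B$ or $(A-B)<(B-A)$ or $(B-A)<(A-B)$. $A,B$ are chord separated if there are no elements $i<j<k<l$ of $[n]$ such that $i,k$ belong to one, and $j,l$ to the other, of the sets $A-B$ and $B-A$. A collection $\mathcal F\subseteq2^{[n]}$ is strongly (chord) separated if any two of its members are. "Maximal chord separated collection in $2^{[n]}$" means inclusion-wise maximal. $\mathbf S^\ast(C)$ is the set of strongly separated collections contained in $C$ having the maximal size, which equals $\frac12n(n+1)+1$ (the maximum size of a strongly separated collection in $2^{[n]}$). $\mathcal I_n$ is the set of all intervals $\{i,i+1,\ldots,j\}$, $1\le i\le j\le n$, together with $\emptyset$; $\mathrm{co}\text{-}\mathcal I_n$ is the set of co-intervals, i.e. the complements $[n]-I$ of the members $I\in\mathcal I_n$. $S'$ is obtained from $S$ by one raising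 flip ("in the presence of six witnesses") if there exist $i<j<k$ and $X\subseteq[n]-\{i,j,k\}$ such that $X,Xi,Xj,Xk,Xij,Xjk,Xijk\in S$ and $S'=(S-\{Xj\})\cup\{Xik\}$. *)

theory Defs
  imports "HOL-Algebra.Lattice"
begin

text \<open>Subsets of \<open>[n] = {1..n}\<close> have type \<^typ>\<open>nat set\<close>; collections have type
  \<^typ>\<open>nat set set\<close>. All sets compared below are finite.\<close>

definition max0 :: "nat set \<Rightarrow> nat" where
  "max0 A = (if A = {} then 0 else Max A)"

definition min0 :: "nat set \<Rightarrow> nat" where
  "min0 A = (if A = {} then 0 else Min A)"

definition set_before :: "nat set \<Rightarrow> nat set \<Rightarrow> bool" where
  "set_before A B \<longleftrightarrow> max0 A < min0 B"

definition strongly_separated :: "nat set \<Rightarrow> nat set \<Rightarrow> bool" where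
  "strongly_separated A B \<longleftrightarrow>
     A = B \<or> set_before (A - B) (B - A) \<or> set_before (B - A) (A - B)"

definition chord_separated :: "nat set \<Rightarrow> nat set \<Rightarrow> bool" where
  "chord_separated A B \<longleftrightarrow>
     \<not> (\<exists>i j k l. i < j \<and> j < k \<and> k < l \<and>
          ({i, k} \<subseteq> A - B \<and> {j, l} \<subseteq> B - A \<or>
           {i, k} \<subseteq> B - A \<and> {j, l} \<subseteq> A - B))"

definition strongly_separated_collection :: "nat \<Rightarrow> nat set set \<Rightarrow> bool" where
  "strongly_separated_collection n F \<longleftrightarrow>
     F \<subseteq> Pow {1..n} \<and> (\<forall>A\<in>F. \<forall>B\<in>F. strongly_separated A B)"

definition chord_separated_collection :: "nat \<Rightarrow> nat set set \<Rightarrow> bool" where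
  "chord_separated_collection n F \<longleftrightarrow>
     F \<subseteq> Pow {1..n} \<and> (\<forall>A\<in>F. \<forall>B\<in>F. chord_separated A B)"

definition maximal_chord_separated_collection :: "nat \<Rightarrow> nat set set \<Rightarrow> bool" where
  "maximal_chord_separated_collection n C \<longleftrightarrow>
     chord_separated_collection n C \<and>
     (\<forall>D. chord_separated_collection n D \<and> C \<subseteq> D \<longrightarrow> D = C)"

text \<open>The maximum is taken over all strongly separated collections in \<open>2\<^bsup>[n]\<^esup>\<close>, not only those
  inside \<open>C\<close>; its value is \<open>n(n+1)/2 + 1\<close>.\<close>

definition max_strongly_separated_in :: "nat \<Rightarrow> nat set set \<Rightarrow> nat set set set" where
  "max_strongly_separated_in n C =
     {S. S \<subseteq> C \<and> strongly_separated_collection n S \<and>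
         (\<forall>T. strongly_separated_collection n T \<longrightarrow> card T \<le> card S)}"

definition intervals :: "nat \<Rightarrow> nat set set" where
  "intervals n = {{i..j} | i j. 1 \<le> i \<and> i \<le> j \<and> j \<le> n} \<union> {{}}"

definition co_intervals :: "nat \<Rightarrow> nat set set" where
  "co_intervals n = {{1..n} - I | I. I \<in> intervals n}"

definition raising_flip :: "nat \<Rightarrow> nat set set \<Rightarrow> nat set set \<Rightarrow> bool" where
  "raising_flip n S S' \<longleftrightarrow>
     (\<exists>i j k X. i \<in> {1..n} \<and> j \<in> {1..n} \<and> k \<in> {1..n} \<and> i < j \<and> j < k \<and>
        X \<subseteq> {1..n} - {i, j, k} \<and>
        {X, X \<union> {i}, X \<union> {j}, X \<union> {k}, X \<union> {i, j}, X \<union> {j, k}, X \<union> {i, j, k}} \<subseteq> S \<and>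
        S' = (S - {X \<union> {j}}) \<union> {X \<union> {i, k}})"

definition immediately_precedes :: "('a, 'b) gorder_scheme \<Rightarrow> 'a \<Rightarrow> 'a \<Rightarrow> bool" where
  "immediately_precedes L x y \<longleftrightarrow>
     x \<in> carrier L \<and> y \<in> carrier L \<and> x \<sqsubset>\<^bsub>L\<^esub> y \<and>
     \<not> (\<exists>z\<in>carrier L. x \<sqsubset>\<^bsub>L\<^esub> z \<and> z \<sqsubset>\<^bsub>L\<^esub> y)"

locale distributive_lattice = lattice L for L (structure) +
  assumes meet_join_distrib:
    "\<lbrakk>x \<in> carrier L; y \<in> carrier L; z \<in> carrier L\<rbrakk> \<Longrightarrow>
       x \<sqinter> (y \<squnion> z) = (x \<sqinter> y) \<squnion> (x \<sqinter> z)"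

end

theory Submission
  imports Defs
begin

text \<open>
  A set \<open>A\<close> surrounds \<open>B\<close> if \<open>i, k \<in> A - B\<close> and \<open>j \<in> B - A\<close> for some \<open>i < j < k\<close>. Strong separation means
  that neither set surrounds the other, chord separation that at most one does. A strongly separated
  collection of maximal size is the collection of all sets compatible with an orientation \<open>e\<close> of the
  triples that is monotone on every packet of four elements (a pseudoline arrangement); a raising flip
  reverses one triple, and the order is inclusion of the sets of reversed triples.

  The engine is a separation theorem. If \<open>W\<close> and \<open>U\<close> are chord separated collections and no member of
  \<open>W\<close> surrounds a member of \<open>U\<close>, then some orientation lies above \<open>W\<close> and below \<open>U\<close>. It is proved by
  deleting the last element \<open>n\<close>: one first finds the linear order in which the pseudoline \<open>n\<close> crosses the
  others, and then adds its initial segments to both collections. Taking \<open>W = U\<close> strongly separated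
  gives the maximal size.

  A set that is chord separated from all sets of an orientation lies above it or below it. So the
  members of two maximal collections \<open>S, T \<subseteq> C\<close> split into a lower and an upper part, which are
  strongly separated, and counting shows that both have maximal size; they are the meet and the join,
  with sets of reversed triples the intersection and the union.

  Surrounding is acyclic on a chord separated collection. Hence if \<open>S'\<close> covers \<open>S\<close>, no member of \<open>C\<close> lies
  strictly between them: an innermost such member would, by the separation theorem, lie in a collection
  strictly between \<open>S\<close> and \<open>S'\<close>. Every flip of \<open>S\<close> towards \<open>S'\<close> then stays in the maximal collection \<open>C\<close>,
  and such a flip exists.
\<close>

subsection \<open>Linear orders separating two families\<close>

text \<open>The obstacle is that demands on single triples do not combine freely. A set with pattern
  in-out-in on \<open>a < b < c\<close> demands a reversed triple, one with pattern out-in-out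
  forbids it, and the packets of four propagate both. Deleting the last element turns the triples
  through it into pairs, and these must form a linear order. Sets that become \<open>F\<close> or
  \<open>G\<close> prescribe the order of single pairs, sets that become \<open>D\<close> or
  \<open>V\<close> only exclude a first or a last element among three. The order is therefore the
  result of a closure: natural wherever no inversion is forced. The closure generates sets, not
  pairs, because a set that contains \<open>j\<close> and omits \<open>i\<close> also decides about
  every element in between, and this gives the transitivity of the pairs that are not inverted.

  The orientations are the elements of the higher Bruhat order B(n,2). That a flip towards a larger
  orientation always exists means that the inclusion of the sets of reversed triples is generated
  there by steps of one triple.\<close>

definition left_of :: "nat set \<Rightarrow> nat set \<Rightarrow> bool" where
  "left_of A B \<longleftrightarrow> (\<exists>i j. i < j \<and> i \<in> A - B \<and> j \<in> B - A)"

definition surrounds :: "nat set \<Rightarrow> nat set \<Rightarrow> bool" where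
  "surrounds A B \<longleftrightarrow> (\<exists>i j k. i < j \<and> j < k \<and> i \<in> A - B \<and> j \<in> B - A \<and> k \<in> A - B)"

lemma left_ofI: "i < j \<Longrightarrow> i \<in> A \<Longrightarrow> i \<notin> B \<Longrightarrow> j \<in> B \<Longrightarrow> j \<notin> A \<Longrightarrow> left_of A B"
  unfolding left_of_def by blast

lemma surroundsI:
  "i < j \<Longrightarrow> j < k \<Longrightarrow> i \<in> A \<Longrightarrow> i \<notin> B \<Longrightarrow> j \<in> B \<Longrightarrow> j \<notin> A \<Longrightarrow> k \<in> A \<Longrightarrow> k \<notin> B \<Longrightarrow> surrounds A B"
  unfolding surrounds_def by blast

text \<open>In the induction on \<open>n\<close>, \<open>F\<close> and \<open>D\<close> come from the lower sets with and without \<open>n\<close> (with \<open>n\<close>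
  removed), \<open>V\<close> and \<open>G\<close> from the upper sets with and without \<open>n\<close>.\<close>

locale separation_data =
  fixes F D G V :: "nat set set"
  assumes FG: "f \<in> F \<Longrightarrow> g \<in> G \<Longrightarrow> \<not> left_of f g"
    and FV: "f \<in> F \<Longrightarrow> v \<in> V \<Longrightarrow> \<not> surrounds f v"
    and DF: "d \<in> D \<Longrightarrow> f \<in> F \<Longrightarrow> \<not> surrounds d f"
    and DG: "d \<in> D \<Longrightarrow> g \<in> G \<Longrightarrow> \<not> surrounds d g"
    and DV: "d \<in> D \<Longrightarrow> v \<in> V \<Longrightarrow> \<not> surrounds d v"
    and GV: "g \<in> G \<Longrightarrow> v \<in> V \<Longrightarrow> \<not> surrounds g v"
    and DD: "d \<in> D \<Longrightarrow> d' \<in> D \<Longrightarrow> surrounds d d' \<Longrightarrow> \<not> surrounds d' d"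
    and VV: "v \<in> V \<Longrightarrow> v' \<in> V \<Longrightarrow> surrounds v v' \<Longrightarrow> \<not> surrounds v' v"
begin

text \<open>Each \<open>B \<in> forced\<close> forces the line \<open>n\<close> to cross \<open>j\<close> before \<open>i\<close> whenever \<open>i < j\<close>, \<open>j \<in> B\<close>, \<open>i \<notin> B\<close>. A set
  \<open>v \<in> V\<close> with \<open>j \<in> v\<close> and \<open>i, k \<notin> v\<close> forbids \<open>j\<close> to be crossed last among \<open>i < j < k\<close>, a set \<open>d \<in> D\<close> with
  \<open>i, k \<in> d\<close> and \<open>j \<notin> d\<close> forbids it to be crossed first; the two closure rules record the
  consequences.\<close>

inductive_set forced :: "nat set set" where
  base: "B \<in> G \<Longrightarrow> B \<in> forced"
| up: "B \<in> forced \<Longrightarrow> v \<in> V \<Longrightarrow> u \<in> B \<Longrightarrow> u \<notin> v \<Longrightarrow> B \<union> (v \<inter> {..<u}) \<in> forced"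
| down: "B \<in> forced \<Longrightarrow> d \<in> D \<Longrightarrow> u \<in> d \<Longrightarrow> u \<notin> B \<Longrightarrow> B \<inter> (d \<union> {..u}) \<in> forced"

text \<open>The sets of \<open>F\<close> require the natural order wherever \<open>i < j\<close>,
  \<open>i\<close> is inside and \<open>j\<close> outside, so a violation would be a contradictory
  demand. In a closure step the pivot \<open>u\<close> lies in \<open>f\<close> or not: one case
  gives a surrounding pattern that the hypotheses exclude, the other a violation already present for
  the previous \<open>B\<close>.\<close>

lemma not_left_of_forced: "B \<in> forced \<Longrightarrow> f \<in> F \<Longrightarrow> \<not> left_of f B"
proof (induction rule: forced.induct)
  case (base B) then show ?case by (simp add: FG)
next
  case (up B v u)
  have nl: "\<not> left_of f B" using up by blast
  show ?case
  proof
    assume "left_of f (B \<union> (v \<inter> {..<u}))"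
    then obtain i j where ij: "i < j" "i \<in> f" "i \<notin> B" "\<not> (i \<in> v \<and> i < u)" "j \<notin> f" "j \<in> B \<or> (j \<in> v \<and> j < u)"
      unfolding left_of_def by auto
    have "j \<notin> B" using nl ij left_ofI[of i j f B] by blast
    hence j: "j \<in> v" "j < u" using ij by auto
    hence i: "i \<notin> v" using ij by auto
    show False
    proof (cases "u \<in> f")
      case True
      thus False using FV[OF \<open>f \<in> F\<close> \<open>v \<in> V\<close>] surroundsI[of i j u f v] i j ij up by blast
    next
      case False
      thus False using nl left_ofI[of i u f B] i j ij up by fastforce
    qed
  qed
next
  case (down B d u)
  have nl: "\<not> left_of f B" using down by blast
  show ?case
  proof
    assume "left_of f (B \<inter> (d \<union> {..u}))"
    then obtain i j where ij: "i < j" "i \<in> f" "\<not> (i \<in> B \<and> (i \<in> d \<or> i \<le> u))" "j \<notin> f" "j \<in> B" "j \<in> d \<or> j \<le> u"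
      unfolding left_of_def by auto
    have iB: "i \<in> B" using nl ij left_ofI[of i j f B] by blast
    hence i: "i \<notin> d" "u < i" using ij by auto
    hence j: "j \<in> d" using ij by auto
    show False
    proof (cases "u \<in> f")
      case True
      thus False using nl left_ofI[of u j f B] i j ij down by fastforce
    next
      case False
      thus False using DF[OF \<open>d \<in> D\<close> \<open>f \<in> F\<close>] surroundsI[of u i j d f] i j ij down by blast
    qed
  qed
qed

text \<open>This serves \<open>inv_V\<close>: the resulting set puts the elements of
  \<open>v\<close> between \<open>i\<close> and \<open>c\<close> before \<open>i\<close>. If
  \<open>B\<close> omits \<open>i\<close>, the rule \<open>up\<close> with pivot \<open>c\<close>
  suffices. If \<open>B\<close> contains \<open>i\<close>, the element \<open>e\<close> makes it
  possible to trace the derivation of \<open>B\<close> back to a usable forced set; a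
  \<open>B\<close> from \<open>G\<close> would surround \<open>v\<close>.\<close>

lemma forced_fill:
  assumes "B \<in> forced" "v \<in> V" "c \<in> B" "c \<notin> v" "i \<notin> v" "i < c"
    and "i \<in> B \<Longrightarrow> \<exists>e. e \<in> v \<and> e \<notin> B \<and> i < e \<and> e < c"
  shows "\<exists>B'\<in>forced. i \<notin> B' \<and> v \<inter> {i<..<c} \<subseteq> B'"
proof (cases "i \<in> B")
  case False
  then show ?thesis using forced.up[OF assms(1-4)] assms(5) by (intro bexI[of _ "B \<union> (v \<inter> {..<c})"]) auto
next
  case True
  then obtain e where "e \<in> v" "e \<notin> B" "i < e" "e < c" using assms(7) by blast
  with assms(1-5) True show ?thesis
  proof (induction arbitrary: v c i e rule: forced.induct)
    case (base g)
    then show ?case using GV[of g v] surroundsI[of i e c g v] by blast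
  next
    case (up B v' u)
    have fillB: ?case if "i \<notin> B" "x \<in> B" "x \<notin> v" "c \<le> x" for x
      using forced.up[OF up.hyps(1) \<open>v \<in> V\<close> that(2,3)] that(1,4) \<open>i \<notin> v\<close>
      by (intro bexI[of _ "B \<union> (v \<inter> {..<x})"]) auto
    \<comment> \<open>Here \<open>i, c\<close> lie in \<open>v' - v\<close> and \<open>e, u\<close>
      in \<open>v - v'\<close>, an alternation of four elements.\<close>
    have alt: False if "e < u" "c < u" "c \<in> v'" "i \<in> v'" "u \<in> v"
    proof -
      have "e \<notin> v'" using up.prems that by auto
      hence "surrounds v' v" using surroundsI[of i e c v' v] that up.prems by blast
      moreover have "surrounds v v'" using surroundsI[of e c u v v'] that up.prems up.hyps \<open>e \<notin> v'\<close> by blast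
      ultimately show False using VV[of v v'] up.hyps up.prems by blast
    qed
    show ?case
    proof (cases "c \<in> B")
      case True
      show ?thesis
      proof (cases "i \<in> B")
        case iB: True
        show ?thesis using up.IH[OF \<open>v \<in> V\<close> True \<open>c \<notin> v\<close> \<open>i \<notin> v\<close> iB \<open>e \<in> v\<close> _ \<open>i < e\<close> \<open>e < c\<close>] up.prems by blast
      next
        case False
        then show ?thesis using fillB[OF _ True \<open>c \<notin> v\<close>] by blast
      qed
    next
      case False
      hence c: "c \<in> v'" "c < u" using up.prems by auto
      hence e: "e \<notin> v'" "e < u" "e \<notin> B" using up.prems by auto
      show ?thesis
      proof (cases "u \<in> v")
        case uv: False
        show ?thesis
        proof (cases "i \<in> B")
          case iB: True
          obtain B' where "B' \<in> forced" "i \<notin> B'" "v \<inter> {i<..<u} \<subseteq> B'"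
            using up.IH[OF \<open>v \<in> V\<close> \<open>u \<in> B\<close> uv \<open>i \<notin> v\<close> iB \<open>e \<in> v\<close> e(3) \<open>i < e\<close> e(2)] by blast
          then show ?thesis using c by (intro bexI[of _ B']) auto
        next
          case iB: False
          then show ?thesis using fillB[OF iB \<open>u \<in> B\<close> uv] c by simp
        qed
      next
        case uv: True
        hence iv': "i \<notin> v'" using alt e c by blast
        hence iB: "i \<in> B" using up.prems by blast
        have "i < c" using up.prems by simp
        \<comment> \<open>The induction hypothesis is used for \<open>v'\<close> instead of
          \<open>v\<close>, with \<open>c\<close> as the missing element and \<open>u\<close> as the
          right end. It yields a set with \<open>c\<close> and without \<open>i\<close>, to which
          \<open>up\<close> with \<open>v\<close> applies.\<close>
        obtain B' where B': "B' \<in> forced" "i \<notin> B'" "v' \<inter> {i<..<u} \<subseteq> B'"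
          using up.IH[OF \<open>v' \<in> V\<close> \<open>u \<in> B\<close> \<open>u \<notin> v'\<close> iv' iB c(1) False \<open>i < c\<close> c(2)] by blast
        have "c \<in> B'" using B' c \<open>i < c\<close> by auto
        from forced.up[OF B'(1) \<open>v \<in> V\<close> this \<open>c \<notin> v\<close>] show ?thesis
          using B' \<open>i \<notin> v\<close> by (intro bexI[of _ "B' \<union> (v \<inter> {..<c})"]) auto
      qed
    qed
  next
    case (down B d u)
    have cB: "c \<in> B" and iB: "i \<in> B" using down.prems by auto
    show ?case
    proof (cases "e \<in> B")
      case False
      then show ?thesis using down.IH[OF \<open>v \<in> V\<close> cB \<open>c \<notin> v\<close> \<open>i \<notin> v\<close> iB \<open>e \<in> v\<close> _ \<open>i < e\<close> \<open>e < c\<close>] by blast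
    next
      case True
      hence e: "e \<notin> d" "u < e" using down.prems by auto
      hence c: "c \<in> d" using down.prems by auto
      have i: "i \<notin> d" using DV[of d v] surroundsI[of i e c d v] c e down by blast
      hence "i < u" using down.prems down.hyps iB by (cases "i = u") auto
      \<comment> \<open>From here the pivot \<open>u\<close> replaces \<open>e\<close>: it lies in
        \<open>v\<close>, between \<open>i\<close> and \<open>c\<close>, and already outside
        \<open>B\<close>.\<close>
      have uv: "u \<in> v" using DV[of d v] surroundsI[of u e c d v] c e down by blast
      have "u < c" using e down.prems by simp
      show ?thesis
        using down.IH[OF \<open>v \<in> V\<close> cB \<open>c \<notin> v\<close> \<open>i \<notin> v\<close> iB uv \<open>u \<notin> B\<close> \<open>i < u\<close> \<open>u < c\<close>] by blast
    qed
  qed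
qed

text \<open>The dual of \<open>forced_fill\<close> under complementation of the sets combined with
  reversal of the order of the elements. This keeps the roles of \<open>F\<close> and
  \<open>G\<close> and exchanges \<open>V\<close> with \<open>D\<close> and \<open>up\<close> with
  \<open>down\<close>.\<close>

lemma forced_cut:
  assumes "B \<in> forced" "d \<in> D" "u \<in> d" "u \<notin> B" "k \<in> d" "u < k"
    and "k \<notin> B \<Longrightarrow> \<exists>e. e \<in> B \<and> e \<notin> d \<and> u < e \<and> e < k"
  shows "\<exists>B'\<in>forced. k \<in> B' \<and> B' \<inter> {u<..<k} \<subseteq> d"
proof (cases "k \<in> B")
  case True
  then show ?thesis using forced.down[OF assms(1-4)] assms(5) by (intro bexI[of _ "B \<inter> (d \<union> {..u})"]) auto
next
  case False
  then obtain e where "e \<in> B" "e \<notin> d" "u < e" "e < k" using assms(7) by blast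
  with assms(1-5) False show ?thesis
  proof (induction arbitrary: d u k e rule: forced.induct)
    case (base g)
    then show ?case using DG[of d g] surroundsI[of u e k d g] by blast
  next
    case (down B d' u')
    have cutB: ?case if "k \<in> B" "x \<notin> B" "x \<in> d" "x \<le> u" for x
      using forced.down[OF down.hyps(1) \<open>d \<in> D\<close> that(3,2)] that(1,4) \<open>k \<in> d\<close>
      by (intro bexI[of _ "B \<inter> (d \<union> {..x})"]) auto
    have alt: False if "u' < u" "k \<notin> d'" "u \<notin> d'" "u' \<notin> d"
    proof -
      have "e \<in> d'" using down.prems that by auto
      hence "surrounds d' d" using surroundsI[of u' u e d' d] that down.prems down.hyps by blast
      moreover have "surrounds d d'" using surroundsI[of u e k d d'] that down.prems \<open>e \<in> d'\<close> by blast
      ultimately show False using DD[of d d'] down.hyps down.prems by blast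
    qed
    show ?case
    proof (cases "u \<in> B")
      case False
      show ?thesis
      proof (cases "k \<in> B")
        case kB: False
        have "e \<in> B" using down.prems by simp
        then show ?thesis using down.IH[OF \<open>d \<in> D\<close> \<open>u \<in> d\<close> False \<open>k \<in> d\<close> kB _ \<open>e \<notin> d\<close> \<open>u < e\<close> \<open>e < k\<close>] by blast
      next
        case True
        then show ?thesis using cutB[OF True False \<open>u \<in> d\<close>] by blast
      qed
    next
      case True
      hence u: "u \<notin> d'" "u' < u" using down.prems by auto
      have eB: "e \<in> B" "u' < e" "u' < k" using down.prems u by auto
      show ?thesis
      proof (cases "u' \<in> d")
        case ud: True
        show ?thesis
        proof (cases "k \<in> B")
          case kB: False
          obtain B' where "B' \<in> forced" "k \<in> B'" "B' \<inter> {u'<..<k} \<subseteq> d"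
            using down.IH[OF \<open>d \<in> D\<close> ud \<open>u' \<notin> B\<close> \<open>k \<in> d\<close> kB eB(1) \<open>e \<notin> d\<close> eB(2) \<open>e < k\<close>] by blast
          then show ?thesis using u by (intro bexI[of _ B']) auto
        next
          case kB: True
          then show ?thesis using cutB[OF kB \<open>u' \<notin> B\<close> ud] u by simp
        qed
      next
        case ud: False
        hence kd': "k \<in> d'" using alt u by blast
        hence kB: "k \<notin> B" using down.prems by blast
        have "u < k" using down.prems by simp
        obtain B' where B': "B' \<in> forced" "k \<in> B'" "B' \<inter> {u'<..<k} \<subseteq> d'"
          using down.IH[OF \<open>d' \<in> D\<close> \<open>u' \<in> d'\<close> \<open>u' \<notin> B\<close> kd' kB True u(1) u(2) \<open>u < k\<close>] by blast
        have "u \<notin> B'" using B' u \<open>u < k\<close> by auto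
        from forced.down[OF B'(1) \<open>d \<in> D\<close> \<open>u \<in> d\<close> this] show ?thesis
          using B' \<open>k \<in> d\<close> by (intro bexI[of _ "B' \<inter> (d \<union> {..u})"]) auto
      qed
    qed
  next
    case (up B v w)
    have kB: "k \<notin> B" and uB: "u \<notin> B" using up.prems by auto
    show ?case
    proof (cases "e \<in> B")
      case True
      then show ?thesis using up.IH[OF \<open>d \<in> D\<close> \<open>u \<in> d\<close> uB \<open>k \<in> d\<close> kB True \<open>e \<notin> d\<close> \<open>u < e\<close> \<open>e < k\<close>] by blast
    next
      case False
      hence e: "e \<in> v" "e < w" using up.prems by auto
      hence u: "u \<notin> v" using up.prems by auto
      have k: "k \<in> v" using DV[of d v] surroundsI[of u e k d v] u e up by blast
      hence "w < k" using up.prems up.hyps kB by (cases "w = k") auto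
      have wd: "w \<notin> d" using DV[of d v] surroundsI[of u e w d v] u e up by blast
      have "u < w" using e up.prems by simp
      show ?thesis
        using up.IH[OF \<open>d \<in> D\<close> \<open>u \<in> d\<close> uB \<open>k \<in> d\<close> kB \<open>w \<in> B\<close> wd \<open>u < w\<close> \<open>w < k\<close>] by blast
    qed
  qed
qed

text \<open>A pair \<open>(j, i)\<close> means that the line \<open>j\<close>, although larger, is
  crossed before \<open>i\<close>.\<close>

definition inverted :: "(nat \<times> nat) set" where
  "inverted = {(j, i). i < j \<and> (\<exists>B\<in>forced. j \<in> B \<and> i \<notin> B)}"

lemma inv_less: "(j, i) \<in> inverted\<^sup>+ \<Longrightarrow> i < j"
  by (induction rule: trancl_induct) (auto simp: inverted_def)

text \<open>For a single generating pair the witness \<open>B\<close> decides: if \<open>m\<close>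
  is in \<open>B\<close>, it comes before \<open>i\<close>; if not, \<open>k\<close> comes before
  it. Passing to the transitive closure preserves this.\<close>

lemma inv_cotrans: "(k, i) \<in> inverted\<^sup>+ \<Longrightarrow> i < m \<Longrightarrow> m < k \<Longrightarrow> (k, m) \<in> inverted\<^sup>+ \<or> (m, i) \<in> inverted\<^sup>+"
proof (induction arbitrary: m rule: trancl_induct)
  case (base i)
  then show ?case by (cases "\<exists>B\<in>forced. k \<in> B \<and> i \<notin> B \<and> m \<in> B") (auto simp: inverted_def intro!: r_into_trancl)
next
  case (step c i)
  consider "m < c" | "m = c" | "c < m" by linarith
  then show ?case
  proof cases
    case 1
    obtain B where "B \<in> forced" "c \<in> B" "i \<notin> B" using step.hyps by (auto simp: inverted_def)
    then have "(c, m) \<in> inverted \<or> (m, i) \<in> inverted" using 1 step.prems by (auto simp: inverted_def)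
    then show ?thesis using step.hyps(1) by (meson trancl.intros)
  next
    case 2 then show ?thesis using step.hyps by auto
  next
    case 3
    then have "(k, m) \<in> inverted\<^sup>+ \<or> (m, c) \<in> inverted\<^sup>+" using step by blast
    then show ?thesis using step.hyps(2) by (meson trancl_into_trancl)
  qed
qed

lemma inv_G: "g \<in> G \<Longrightarrow> i < j \<Longrightarrow> j \<in> g \<Longrightarrow> i \<notin> g \<Longrightarrow> (j, i) \<in> inverted\<^sup>+"
  by (rule r_into_trancl) (auto simp: inverted_def intro: forced.base)

lemma not_inv_F: "(j, i) \<in> inverted\<^sup>+ \<Longrightarrow> f \<in> F \<Longrightarrow> i \<in> f \<Longrightarrow> j \<in> f"
proof (induction rule: trancl_induct)
  case (base i)
  then show ?case using not_left_of_forced left_ofI[of i j f] unfolding inverted_def by blast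
next
  case (step c i)
  then have "c \<in> f" using not_left_of_forced left_ofI[of i c f] unfolding inverted_def by blast
  then show ?case using step by blast
qed

text \<open>With \<open>k\<close> before \<open>j\<close>, the only way for \<open>j\<close> not to
  be last among \<open>i < j < k\<close> is to come before \<open>i\<close>. The chain of inversions
  from \<open>k\<close> down to \<open>j\<close> is followed: as long as its next element is outside
  \<open>v\<close> it replaces \<open>k\<close>, and the first one inside \<open>v\<close>, at the
  latest \<open>j\<close>, is the element \<open>e\<close> that \<open>forced_fill\<close> asks
  for.\<close>

lemma inv_V:
  assumes "(k, j) \<in> inverted\<^sup>+" "v \<in> V" "j \<in> v" "i \<notin> v" "k \<notin> v" "i < j"
  shows "(j, i) \<in> inverted\<^sup>+"
  using assms
proof (induction rule: converse_trancl_induct)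
  case (base k)
  then obtain B where B: "B \<in> forced" "k \<in> B" "j \<notin> B" "j < k" unfolding inverted_def by blast
  obtain B' where "B' \<in> forced" "i \<notin> B'" "v \<inter> {i<..<k} \<subseteq> B'"
    using forced_fill[OF B(1) \<open>v \<in> V\<close> B(2) \<open>k \<notin> v\<close> \<open>i \<notin> v\<close>] base B by fastforce
  moreover have "j \<in> v \<inter> {i<..<k}" using base B by auto
  ultimately show ?case using base by (intro r_into_trancl) (auto simp: inverted_def)
next
  case (step k c)
  then obtain B where B: "B \<in> forced" "k \<in> B" "c \<notin> B" "c < k" unfolding inverted_def by blast
  have "j < c" using inv_less[OF step.hyps(2)] .
  show ?case
  proof (cases "c \<in> v")
    case False then show ?thesis using step by blast
  next
    case True
    obtain B' where "B' \<in> forced" "i \<notin> B'" "v \<inter> {i<..<k} \<subseteq> B'"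
      using forced_fill[OF B(1) \<open>v \<in> V\<close> B(2) \<open>k \<notin> v\<close> \<open>i \<notin> v\<close>] step.prems B True \<open>j < c\<close> by fastforce
    moreover have "j \<in> v \<inter> {i<..<k}" using step.prems B \<open>j < c\<close> by auto
    ultimately show ?thesis using step.prems by (intro r_into_trancl) (auto simp: inverted_def)
  qed
qed

text \<open>The dual of \<open>inv_V\<close>: \<open>d\<close> excludes that \<open>j\<close> comes
  first, and the chain is followed from its other end with \<open>forced_cut\<close>.\<close>

lemma inv_D:
  assumes "(j, i) \<in> inverted\<^sup>+" "d \<in> D" "i \<in> d" "j \<notin> d" "k \<in> d" "j < k"
  shows "(k, j) \<in> inverted\<^sup>+"
  using assms
proof (induction rule: trancl_induct)
  case (base i)
  then obtain B where B: "B \<in> forced" "j \<in> B" "i \<notin> B" "i < j" unfolding inverted_def by blast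
  obtain B' where "B' \<in> forced" "k \<in> B'" "B' \<inter> {i<..<k} \<subseteq> d"
    using forced_cut[OF B(1) \<open>d \<in> D\<close> \<open>i \<in> d\<close> B(3) \<open>k \<in> d\<close>] base B by fastforce
  moreover have "j \<in> {i<..<k}" using base B by auto
  ultimately show ?case using base by (intro r_into_trancl) (auto simp: inverted_def)
next
  case (step c i)
  then obtain B where B: "B \<in> forced" "c \<in> B" "i \<notin> B" "i < c" unfolding inverted_def by blast
  have "c < j" using inv_less[OF step.hyps(1)] .
  show ?case
  proof (cases "c \<in> d")
    case True then show ?thesis using step by blast
  next
    case False
    obtain B' where "B' \<in> forced" "k \<in> B'" "B' \<inter> {i<..<k} \<subseteq> d"
      using forced_cut[OF B(1) \<open>d \<in> D\<close> \<open>i \<in> d\<close> B(3) \<open>k \<in> d\<close>] step.prems B False \<open>c < j\<close> by fastforce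
    moreover have "j \<in> {i<..<k}" using step.prems B \<open>c < j\<close> by auto
    ultimately show ?thesis using step.prems by (intro r_into_trancl) (auto simp: inverted_def)
  qed
qed

end

subsection \<open>Orientations of triples and the separation theorem\<close>

text \<open>The four values have at most one change of sign. Applied to the triples of a packet in
  lexicographic order, this is the condition that defines B(n,2).\<close>

definition mono4 :: "bool \<Rightarrow> bool \<Rightarrow> bool \<Rightarrow> bool \<Rightarrow> bool" where
  "mono4 p q r s \<longleftrightarrow> (p = r \<longrightarrow> q = p) \<and> (q = s \<longrightarrow> r = q) \<and> (p = s \<longrightarrow> q = p \<and> r = p)"

definition consistent :: "nat \<Rightarrow> (nat \<Rightarrow> nat \<Rightarrow> nat \<Rightarrow> bool) \<Rightarrow> bool" where
  "consistent n e \<longleftrightarrow> (\<forall>a b c d. 0 < a \<and> a < b \<and> b < c \<and> c < d \<and> d \<le> n \<longrightarrow>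
     mono4 (e a b c) (e a b d) (e a c d) (e b c d))"

text \<open>Every in-out-in pattern of \<open>A\<close> must be a reversed triple. Reversing further
  triples preserves this, hence the name; \<open>lies_above\<close> is the dual condition on
  out-in-out patterns.\<close>

definition lies_below :: "nat \<Rightarrow> (nat \<Rightarrow> nat \<Rightarrow> nat \<Rightarrow> bool) \<Rightarrow> nat set \<Rightarrow> bool" where
  "lies_below n e A \<longleftrightarrow> (\<forall>a b c. 0 < a \<and> a < b \<and> b < c \<and> c \<le> n \<and> a \<in> A \<and> b \<notin> A \<and> c \<in> A \<longrightarrow> e a b c)"

definition lies_above :: "nat \<Rightarrow> (nat \<Rightarrow> nat \<Rightarrow> nat \<Rightarrow> bool) \<Rightarrow> nat set \<Rightarrow> bool" where
  "lies_above n e A \<longleftrightarrow> (\<forall>a b c. 0 < a \<and> a < b \<and> b < c \<and> c \<le> n \<and> a \<notin> A \<and> b \<in> A \<and> c \<notin> A \<longrightarrow> \<not> e a b c)"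

definition chordal :: "nat set set \<Rightarrow> bool" where
  "chordal F \<longleftrightarrow> (\<forall>A\<in>F. \<forall>B\<in>F. surrounds A B \<longrightarrow> \<not> surrounds B A)"

lemma lies_belowD: "lies_below n e A \<Longrightarrow> 0 < a \<Longrightarrow> a < b \<Longrightarrow> b < c \<Longrightarrow> c \<le> n \<Longrightarrow> a \<in> A \<Longrightarrow> b \<notin> A \<Longrightarrow> c \<in> A \<Longrightarrow> e a b c"
  unfolding lies_below_def by blast

lemma lies_aboveD: "lies_above n e A \<Longrightarrow> 0 < a \<Longrightarrow> a < b \<Longrightarrow> b < c \<Longrightarrow> c \<le> n \<Longrightarrow> a \<notin> A \<Longrightarrow> b \<in> A \<Longrightarrow> c \<notin> A \<Longrightarrow> \<not> e a b c"
  unfolding lies_above_def by blast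

lemma consistentD: "consistent n e \<Longrightarrow> 0 < a \<Longrightarrow> a < b \<Longrightarrow> b < c \<Longrightarrow> c < d \<Longrightarrow> d \<le> n \<Longrightarrow>
    mono4 (e a b c) (e a b d) (e a c d) (e b c d)"
  unfolding consistent_def by blast

lemma surrounds_remove: "surrounds (A - {z}) (B - {z}) \<Longrightarrow> surrounds A B"
  unfolding surrounds_def by blast

lemma chordal_remove:
  assumes "chordal W"
  shows "A \<in> W \<Longrightarrow> B \<in> W \<Longrightarrow> surrounds (A - {z}) (B - {z}) \<Longrightarrow> \<not> surrounds (B - {z}) (A - {z})"
  using assms surrounds_remove[of A z B] surrounds_remove[of B z A] unfolding chordal_def by blast

lemma chordal_image_remove: "chordal W \<Longrightarrow> chordal ((\<lambda>A. A - {z}) ` W)"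
  unfolding chordal_def by (auto dest!: surrounds_remove)

lemma chordal_Un:
  assumes "chordal W" "\<And>A Q. A \<in> W \<Longrightarrow> Q \<in> K \<Longrightarrow> \<not> surrounds A Q"
    and "\<And>Q Q'. Q \<in> K \<Longrightarrow> Q' \<in> K \<Longrightarrow> \<not> surrounds Q Q'"
  shows "chordal (W \<union> K)"
  using assms unfolding chordal_def by blast

lemma chordal_Un':
  assumes "chordal W" "\<And>A Q. A \<in> W \<Longrightarrow> Q \<in> K \<Longrightarrow> \<not> surrounds Q A"
    and "\<And>Q Q'. Q \<in> K \<Longrightarrow> Q' \<in> K \<Longrightarrow> \<not> surrounds Q Q'"
  shows "chordal (W \<union> K)"
  using assms unfolding chordal_def by blast

text \<open>If \<open>i < j < k\<close> were such a pattern, then \<open>j\<close>, \<open>k\<close>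
  and the last element would show that \<open>B\<close> surrounds \<open>A\<close> as well.\<close>

lemma not_surrounds_extended:
  assumes "chordal W" "A \<in> W" "B \<in> W" "B \<subseteq> {1..Suc n}" "A \<subseteq> {1..Suc n}" "Suc n \<notin> A" "Suc n \<in> B"
  shows "\<not> surrounds A (B - {Suc n})"
proof
  assume "surrounds A (B - {Suc n})"
  then obtain i j k where ijk: "i < j" "j < k" "i \<in> A" "k \<in> A" "j \<notin> A" "j \<in> B" "i \<notin> B" "k \<notin> B" "j \<noteq> Suc n"
    using assms(6) unfolding surrounds_def by blast
  have "k < Suc n" using assms ijk by (metis atLeastAtMost_iff le_neq_implies_less subsetD)
  hence "surrounds B A" using surroundsI[of j k "Suc n" B A] ijk assms by blast
  moreover have "surrounds A B" using surroundsI[of i j k A B] ijk by blast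
  ultimately show False using assms unfolding chordal_def by blast
qed

text \<open>The hypothesis \<open>FG\<close> involves only two elements because the last element,
  which is in the lower set and not in the upper one, is always available as the third element of a
  surrounding pattern.\<close>

lemma separation_data_split:
  assumes W: "W \<subseteq> Pow {1..Suc n}" and U: "U \<subseteq> Pow {1..Suc n}"
    and cW: "chordal W" and cU: "chordal U"
    and WU: "\<And>A B. A \<in> W \<Longrightarrow> B \<in> U \<Longrightarrow> \<not> surrounds A B"
  shows "separation_data ((\<lambda>A. A - {Suc n}) ` {A \<in> W. Suc n \<in> A}) {A \<in> W. Suc n \<notin> A}
    {B \<in> U. Suc n \<notin> B} ((\<lambda>A. A - {Suc n}) ` {B \<in> U. Suc n \<in> B})"
proof
  fix f g assume "f \<in> (\<lambda>A. A - {Suc n}) ` {A \<in> W. Suc n \<in> A}" and g: "g \<in> {B \<in> U. Suc n \<notin> B}"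
  then obtain A where A: "A \<in> W" "Suc n \<in> A" "f = A - {Suc n}" by auto
  show "\<not> left_of f g"
  proof
    assume "left_of f g"
    then obtain i j where ij: "i < j" "i \<in> A" "i \<notin> g" "j \<in> g" "j \<notin> A" unfolding left_of_def A using g by blast
    have "j \<in> {1..Suc n}" using U g ij by blast
    hence "j < Suc n" using g ij A by (cases "j = Suc n") auto
    thus False using WU[of A g] surroundsI[of i j "Suc n" A g] ij A g by blast
  qed
next
  fix f v assume "f \<in> (\<lambda>A. A - {Suc n}) ` {A \<in> W. Suc n \<in> A}" "v \<in> (\<lambda>A. A - {Suc n}) ` {B \<in> U. Suc n \<in> B}"
  then obtain A B where "A \<in> W" "f = A - {Suc n}" "B \<in> U" "v = B - {Suc n}" by auto
  then show "\<not> surrounds f v" using surrounds_remove[of A "Suc n" B] WU[of A B] by auto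
next
  fix d f assume d: "d \<in> {A \<in> W. Suc n \<notin> A}" and "f \<in> (\<lambda>A. A - {Suc n}) ` {A \<in> W. Suc n \<in> A}"
  then obtain A where A: "A \<in> W" "Suc n \<in> A" "f = A - {Suc n}" by auto
  have "d \<subseteq> {1..Suc n}" "A \<subseteq> {1..Suc n}" using W d A by auto
  then show "\<not> surrounds d f" using not_surrounds_extended[OF cW, of d A n] d A by simp
next
  fix d g assume "d \<in> {A \<in> W. Suc n \<notin> A}" "g \<in> {B \<in> U. Suc n \<notin> B}"
  then show "\<not> surrounds d g" using WU[of d g] by simp
next
  fix d v assume d: "d \<in> {A \<in> W. Suc n \<notin> A}" and "v \<in> (\<lambda>A. A - {Suc n}) ` {B \<in> U. Suc n \<in> B}"
  then obtain B where "B \<in> U" "v = B - {Suc n}" by auto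
  moreover have "d = d - {Suc n}" using d by auto
  ultimately show "\<not> surrounds d v" using surrounds_remove[of d "Suc n" B] WU[of d B] d by auto
next
  fix g v assume g: "g \<in> {B \<in> U. Suc n \<notin> B}" and "v \<in> (\<lambda>A. A - {Suc n}) ` {B \<in> U. Suc n \<in> B}"
  then obtain B where B: "B \<in> U" "Suc n \<in> B" "v = B - {Suc n}" by auto
  have "g \<subseteq> {1..Suc n}" "B \<subseteq> {1..Suc n}" using U g B by auto
  then show "\<not> surrounds g v" using not_surrounds_extended[OF cU, of g B n] g B by simp
next
  fix d d' assume "d \<in> {A \<in> W. Suc n \<notin> A}" "d' \<in> {A \<in> W. Suc n \<notin> A}" "surrounds d d'"
  then show "\<not> surrounds d' d" using cW unfolding chordal_def by simp
next
  fix v v' assume "v \<in> (\<lambda>A. A - {Suc n}) ` {B \<in> U. Suc n \<in> B}" "v' \<in> (\<lambda>A. A - {Suc n}) ` {B \<in> U. Suc n \<in> B}"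
    and s: "surrounds v v'"
  then obtain A B where "A \<in> U" "v = A - {Suc n}" "B \<in> U" "v' = B - {Suc n}" by auto
  then show "\<not> surrounds v' v" using chordal_remove[OF cU, of A B "Suc n"] s by simp
qed

section \<open>The crossing order of the last line and its initial segments\<close>

context separation_data
begin

text \<open>The natural order, changed only at the inversions that are forced. \<open>G\<close>,
  \<open>V\<close> and \<open>D\<close> are served by the forced inversions, \<open>F\<close> by the
  absence of others.\<close>

definition bef :: "nat \<Rightarrow> nat \<Rightarrow> bool" where
  "bef x y \<longleftrightarrow> x \<noteq> y \<and> (if x < y then (y, x) \<notin> inverted\<^sup>+ else (x, y) \<in> inverted\<^sup>+)"

lemma bef_total: "x \<noteq> y \<Longrightarrow> bef x y \<longleftrightarrow> \<not> bef y x"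
  unfolding bef_def by auto

lemma bef_less: "x < y \<Longrightarrow> bef x y \<longleftrightarrow> (y, x) \<notin> inverted\<^sup>+" "y < x \<Longrightarrow> bef x y \<longleftrightarrow> (x, y) \<in> inverted\<^sup>+"
  unfolding bef_def by auto

lemma bef_trans_ordered:
  assumes "a < b" "b < c"
  shows "bef a b \<Longrightarrow> bef b c \<Longrightarrow> bef a c" "bef c b \<Longrightarrow> bef b a \<Longrightarrow> bef c a"
proof -
  have "a < c" using assms by simp
  show "bef a b \<Longrightarrow> bef b c \<Longrightarrow> bef a c"
    using inv_cotrans[of c a b] assms \<open>a < c\<close> by (auto simp: bef_less)
  show "bef c b \<Longrightarrow> bef b a \<Longrightarrow> bef c a"
    using assms \<open>a < c\<close> by (auto simp: bef_less intro: trancl_trans)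
qed

text \<open>A failure would be a cycle of three elements. Rotated suitably it runs through them in
  increasing or in decreasing order, and \<open>bef_trans_ordered\<close> excludes both: the first
  by \<open>inv_cotrans\<close>, the second by the transitivity of the closure.\<close>

lemma bef_trans:
  assumes "bef x y" "bef y z" "x \<noteq> z"
  shows "bef x z"
proof (rule ccontr)
  assume "\<not> bef x z"
  hence zx: "bef z x" using bef_total[OF assms(3)] by simp
  have "x \<noteq> y" "y \<noteq> z" using assms unfolding bef_def by auto
  hence "\<not> bef y x" "\<not> bef z y" "\<not> bef x z"
    using assms zx bef_total[of x y] bef_total[of y z] bef_total[of x z] by auto
  then consider "x < y" "y < z" | "x < z" "z < y" | "y < x" "x < z" | "y < z" "z < x" | "z < x" "x < y" | "z < y" "y < x"
    using assms \<open>x \<noteq> y\<close> \<open>y \<noteq> z\<close> by linarith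
  then show False
  proof cases
    case 1 then show False using bef_trans_ordered(1)[of x y z] assms \<open>\<not> bef x z\<close> by blast
  next
    case 2 then show False using bef_trans_ordered(2)[of x z y] assms zx \<open>\<not> bef y x\<close> by blast
  next
    case 3 then show False using bef_trans_ordered(2)[of y x z] assms zx \<open>\<not> bef z y\<close> by blast
  next
    case 4 then show False using bef_trans_ordered(1)[of y z x] assms zx \<open>\<not> bef y x\<close> by blast
  next
    case 5 then show False using bef_trans_ordered(1)[of z x y] assms zx \<open>\<not> bef z y\<close> by blast
  next
    case 6 then show False using bef_trans_ordered(2)[of z y x] assms \<open>\<not> bef x z\<close> by blast
  qed
qed

definition segments :: "nat \<Rightarrow> nat set set" where
  "segments n = {Q. Q \<subseteq> {1..n} \<and> (\<forall>x\<in>Q. \<forall>y\<in>{1..n}. bef y x \<longrightarrow> y \<in> Q)}"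

lemma segments_not_surrounds:
  assumes "Q \<in> segments n" "Q' \<in> segments n"
  shows "\<not> surrounds Q Q'"
proof
  assume "surrounds Q Q'"
  then obtain i j where "i < j" "i \<in> Q" "i \<notin> Q'" "j \<in> Q'" "j \<notin> Q" unfolding surrounds_def by blast
  then show False using assms bef_total[of i j] unfolding segments_def by blast
qed

lemma F_not_surrounds_segments:
  assumes "f \<in> F" "f \<subseteq> {1..n}" "Q \<in> segments n"
  shows "\<not> surrounds f Q"
proof
  assume "surrounds f Q"
  then obtain i j where ij: "i < j" "i \<in> f" "i \<notin> Q" "j \<in> Q" "j \<notin> f" unfolding surrounds_def by blast
  hence "\<not> bef i j" using assms unfolding segments_def by blast
  hence "(j, i) \<in> inverted\<^sup>+" using ij by (simp add: bef_less)
  thus False using not_inv_F[of j i f] assms ij by blast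
qed

text \<open>A segment that contains \<open>j\<close> and omits \<open>i\<close> and \<open>k\<close>
  has \<open>j\<close> crossed first among the three, which \<open>inv_D\<close> rules out for such
  a \<open>d\<close>. In the same way \<open>inv_V\<close> handles segments around members of
  \<open>V\<close>, where \<open>j\<close> would be last.\<close>

lemma D_not_surrounds_segments:
  assumes "d \<in> D" "d \<subseteq> {1..n}" "Q \<in> segments n"
  shows "\<not> surrounds d Q"
proof
  assume "surrounds d Q"
  then obtain i j k where ij: "i < j" "j < k" "i \<in> d" "i \<notin> Q" "j \<in> Q" "j \<notin> d" "k \<in> d" "k \<notin> Q"
    unfolding surrounds_def by blast
  hence "\<not> bef i j" "\<not> bef k j" using assms unfolding segments_def by blast+
  hence "(j, i) \<in> inverted\<^sup>+" "(k, j) \<notin> inverted\<^sup>+" using ij by (simp_all add: bef_less)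
  thus False using inv_D[of j i d k] assms ij by blast
qed

lemma segments_not_surrounds_V:
  assumes "v \<in> V" "v \<subseteq> {1..n}" "Q \<in> segments n"
  shows "\<not> surrounds Q v"
proof
  assume "surrounds Q v"
  then obtain i j k where ij: "i < j" "j < k" "i \<notin> v" "i \<in> Q" "j \<notin> Q" "j \<in> v" "k \<notin> v" "k \<in> Q"
    unfolding surrounds_def by blast
  hence "\<not> bef j i" "\<not> bef j k" using assms unfolding segments_def by blast+
  hence "(j, i) \<notin> inverted\<^sup>+" "(k, j) \<in> inverted\<^sup>+" using ij by (simp_all add: bef_less)
  thus False using inv_V[of k j v i] assms ij by blast
qed

lemma segments_not_surrounds_G:
  assumes "g \<in> G" "g \<subseteq> {1..n}" "Q \<in> segments n"
  shows "\<not> surrounds Q g"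
proof
  assume "surrounds Q g"
  then obtain i j where ij: "i < j" "i \<in> Q" "i \<notin> g" "j \<in> g" "j \<notin> Q" unfolding surrounds_def by blast
  hence "\<not> bef j i" using assms unfolding segments_def by blast
  thus False using inv_G[of g i j] assms ij by (simp add: bef_less)
qed

lemma initial_segment_le: "b \<in> {1..n} \<Longrightarrow> {y \<in> {1..n}. y = b \<or> bef y b} \<in> segments n"
  unfolding segments_def by (auto dest: bef_trans)

lemma initial_segment_less:
  assumes "b \<in> {1..n}"
  shows "{y \<in> {1..n}. bef y b} \<in> segments n"
proof -
  have "bef y b" if "bef y x" "bef x b" for x y
    using that bef_trans[of y x b] bef_total[of x b] by (cases "y = b") (auto simp: bef_def)
  then show ?thesis unfolding segments_def by blast
qed

end

theorem separating_orientation: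
  assumes "W \<subseteq> Pow {1..n}" "U \<subseteq> Pow {1..n}" "chordal W" "chordal U"
    and "\<And>A B. A \<in> W \<Longrightarrow> B \<in> U \<Longrightarrow> \<not> surrounds A B"
  shows "\<exists>e. consistent n e \<and> (\<forall>A\<in>W. lies_below n e A) \<and> (\<forall>B\<in>U. lies_above n e B)"
  using assms
proof (induction n arbitrary: W U)
  case 0
  then show ?case unfolding consistent_def lies_below_def lies_above_def by auto
next
  case (Suc n)
  let ?z = "Suc n"
  let ?r = "\<lambda>A. A - {Suc n}"
  interpret separation_data "?r ` {A \<in> W. ?z \<in> A}" "{A \<in> W. ?z \<notin> A}" "{B \<in> U. ?z \<notin> B}" "?r ` {B \<in> U. ?z \<in> B}"
    using separation_data_split[OF Suc.prems] .
  have sub: "?r A \<subseteq> {1..n}" if "A \<in> W \<union> U" for A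
    using that Suc.prems(1,2) by (force simp: le_Suc_eq)
  \<comment> \<open>The segments go into both collections, so they will lie below and above the
    orientation of the smaller ground set. This ties that orientation to the crossing order.\<close>
  let ?K = "segments n"
  have WK: "\<not> surrounds (?r A) Q" if "A \<in> W" "Q \<in> ?K" for A Q
  proof (cases "?z \<in> A")
    case True
    then show ?thesis using F_not_surrounds_segments[of "?r A" n Q] that sub by blast
  next
    case False
    then show ?thesis using D_not_surrounds_segments[of A n Q] that sub[of A] by simp
  qed
  have KU: "\<not> surrounds Q (?r B)" if "B \<in> U" "Q \<in> ?K" for B Q
  proof (cases "?z \<in> B")
    case True
    then show ?thesis using segments_not_surrounds_V[of "?r B" n Q] that sub by blast
  next
    case False
    then show ?thesis using segments_not_surrounds_G[of B n Q] that sub[of B] by simp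
  qed
  have "\<exists>e. consistent n e \<and> (\<forall>A\<in>?r ` W \<union> ?K. lies_below n e A) \<and> (\<forall>B\<in>?r ` U \<union> ?K. lies_above n e B)"
  proof (rule Suc.IH)
    have "?K \<subseteq> Pow {1..n}" unfolding segments_def by blast
    then show "?r ` W \<union> ?K \<subseteq> Pow {1..n}" "?r ` U \<union> ?K \<subseteq> Pow {1..n}" using sub by auto
    show "chordal (?r ` W \<union> ?K)"
      by (rule chordal_Un[OF chordal_image_remove[OF \<open>chordal W\<close>]]) (use WK segments_not_surrounds in blast)+
    show "chordal (?r ` U \<union> ?K)"
      by (rule chordal_Un'[OF chordal_image_remove[OF \<open>chordal U\<close>]]) (use KU segments_not_surrounds in blast)+
    fix A B assume AB: "A \<in> ?r ` W \<union> ?K" "B \<in> ?r ` U \<union> ?K"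
    show "\<not> surrounds A B"
    proof (cases "A \<in> ?K")
      case True
      then show ?thesis using AB(2) KU segments_not_surrounds by blast
    next
      case False
      then obtain A' where A': "A' \<in> W" "A = ?r A'" using AB(1) by blast
      show ?thesis
      proof (cases "B \<in> ?K")
        case True
        then show ?thesis using A' WK by blast
      next
        case False
        then obtain B' where "B' \<in> U" "B = ?r B'" using AB(2) by blast
        then show ?thesis using A' Suc.prems(5) surrounds_remove by blast
      qed
    qed
  qed
  then obtain e where con: "consistent n e" and lb: "\<forall>A\<in>?r ` W \<union> ?K. lies_below n e A"
    and la: "\<forall>B\<in>?r ` U \<union> ?K. lies_above n e B" by (elim exE conjE)
  have e: "consistent n e" "\<And>A. A \<in> W \<Longrightarrow> lies_below n e (?r A)" "\<And>Q. Q \<in> ?K \<Longrightarrow> lies_below n e Q"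
    "\<And>B. B \<in> U \<Longrightarrow> lies_above n e (?r B)" "\<And>Q. Q \<in> ?K \<Longrightarrow> lies_above n e Q"
    using con lb la by simp_all
  let ?e = "\<lambda>a b c. if c = ?z then bef a b else e a b c"
  have c: "consistent ?z ?e" unfolding consistent_def
  proof (intro allI impI, elim conjE)
    fix a b c d assume abcd: "0 < a" "a < b" "b < c" "c < d" "d \<le> ?z"
    show "mono4 (?e a b c) (?e a b d) (?e a c d) (?e b c d)"
    proof (cases "d = ?z")
      case False
      then show ?thesis using abcd consistentD[OF e(1)] by auto
    next
      case True
      have in_n: "a \<in> {1..n}" "b \<in> {1..n}" "c \<in> {1..n}" "c \<le> n" using abcd True by auto
      have bc: "bef b c \<longleftrightarrow> \<not> bef c b" using bef_total[of b c] abcd by simp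
      \<comment> \<open>If \<open>b\<close> is crossed first, the segment ending with
        \<open>b\<close> has the pattern out-in-out; if it is crossed last, the segment ending just
        before \<open>b\<close> has the pattern in-out-in. In all other cases the values at the
        pairs agree and \<open>e a b c\<close> is free.\<close>
      have first: "\<not> e a b c" if "\<not> bef a b" "bef b c"
        using lies_aboveD[OF e(5)[OF initial_segment_le[OF in_n(2)]], of a b c] that abcd in_n bc by auto
      have last: "e a b c" if "bef a b" "\<not> bef b c"
        using lies_belowD[OF e(3)[OF initial_segment_less[OF in_n(2)]], of a b c] that abcd in_n bc bef_total[of b b] by (auto simp: bef_def)
      have "a < c" using abcd by simp
      have ab: "bef a b \<longleftrightarrow> \<not> bef b a" and ac: "bef a c \<longleftrightarrow> \<not> bef c a"
        using bef_total[of a b] bef_total[of a c] abcd \<open>a < c\<close> by simp_all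
      have c1: "bef a b \<longrightarrow> bef b c \<longrightarrow> bef a c" using bef_trans_ordered(1)[OF abcd(2,3)] by blast
      have c2: "\<not> bef a b \<longrightarrow> \<not> bef b c \<longrightarrow> \<not> bef a c"
        using bef_trans_ordered(2)[OF abcd(2,3)] ab ac bc by blast
      have "c \<noteq> Suc n" using in_n by simp
      have "mono4 (e a b c) (bef a b) (bef a c) (bef b c)"
        unfolding mono4_def using c1 c2 first last by blast
      then show ?thesis using True \<open>c \<noteq> Suc n\<close> by simp
    qed
  qed
  have b: "lies_below ?z ?e A" if A: "A \<in> W" for A unfolding lies_below_def
  proof (intro allI impI, elim conjE)
    fix a b c assume abc: "0 < a" "a < b" "b < c" "c \<le> ?z" "a \<in> A" "b \<notin> A" "c \<in> A"
    show "?e a b c"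
    proof (cases "c = ?z")
      case False
      then show ?thesis using abc lies_belowD[OF e(2)[OF A], of a b c] by auto
    next
      case True
      then show ?thesis using abc A not_inv_F[of b a "?r A"] by (auto simp: bef_less)
    qed
  qed
  have a: "lies_above ?z ?e B" if B: "B \<in> U" for B unfolding lies_above_def
  proof (intro allI impI, elim conjE)
    fix a b c assume abc: "0 < a" "a < b" "b < c" "c \<le> ?z" "a \<notin> B" "b \<in> B" "c \<notin> B"
    show "\<not> ?e a b c"
    proof (cases "c = ?z")
      case False
      then show ?thesis using abc lies_aboveD[OF e(4)[OF B], of a b c] by auto
    next
      case True
      then show ?thesis using abc B inv_G[of B a b] by (auto simp: bef_less)
    qed
  qed
  show ?case by (intro exI[of _ ?e] conjI ballI c b a)
qed

subsection \<open>The collection of an orientation\<close>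

definition separated :: "nat \<Rightarrow> (nat \<Rightarrow> nat \<Rightarrow> nat \<Rightarrow> bool) \<Rightarrow> nat set set" where
  "separated n e = {A. A \<subseteq> {1..n} \<and> lies_below n e A \<and> lies_above n e A}"

lemma finite_separated: "finite (separated n e)"
  by (rule finite_subset[of _ "Pow {1..n}"]) (auto simp: separated_def)

lemma separated_not_surrounds:
  assumes "lies_below n e A" "lies_above n e B" "A \<subseteq> {1..n}" "B \<subseteq> {1..n}"
  shows "\<not> surrounds A B"
proof
  assume "surrounds A B"
  then obtain i j k where "i < j" "j < k" "i \<in> A" "i \<notin> B" "j \<in> B" "j \<notin> A" "k \<in> A" "k \<notin> B"
    unfolding surrounds_def by blast
  moreover from this have "0 < i" "k \<le> n" using assms by auto
  ultimately show False using lies_belowD[OF assms(1), of i j k] lies_aboveD[OF assms(2), of i j k] by blast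
qed

lemma consistent_mono: "consistent n e \<Longrightarrow> m \<le> n \<Longrightarrow> consistent m e"
  unfolding consistent_def by (meson order_trans)

section \<open>The crossing order of a line, read off an orientation\<close>

definition precedes :: "(nat \<Rightarrow> nat \<Rightarrow> nat \<Rightarrow> bool) \<Rightarrow> nat \<Rightarrow> nat \<Rightarrow> nat \<Rightarrow> bool" where
  "precedes e z x y \<longleftrightarrow> x \<noteq> y \<and> (if x < y then e x y z else \<not> e y x z)"

lemma precedes_less: "x < y \<Longrightarrow> precedes e z x y \<longleftrightarrow> e x y z" "y < x \<Longrightarrow> precedes e z x y \<longleftrightarrow> \<not> e y x z"
  unfolding precedes_def by auto

lemma precedes_total: "x \<noteq> y \<Longrightarrow> precedes e z x y \<longleftrightarrow> \<not> precedes e z y x"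
  unfolding precedes_def by auto

lemma precedes_irrefl: "\<not> precedes e z x x"
  unfolding precedes_def by auto

lemma precedes_ordered:
  assumes "consistent (Suc n) e" "0 < a" "a < b" "b < c" "c \<le> n"
  shows "e a b (Suc n) \<Longrightarrow> e b c (Suc n) \<Longrightarrow> e a c (Suc n)"
    and "\<not> e a b (Suc n) \<Longrightarrow> \<not> e b c (Suc n) \<Longrightarrow> \<not> e a c (Suc n)"
  using consistentD[OF assms(1), of a b c "Suc n"] assms unfolding mono4_def by auto

lemma precedes_trans:
  assumes "consistent (Suc n) e" "precedes e (Suc n) x y" "precedes e (Suc n) y z" "x \<noteq> z"
    and "x \<in> {1..n}" "y \<in> {1..n}" "z \<in> {1..n}"
  shows "precedes e (Suc n) x z"
proof -
  note o = precedes_ordered[OF assms(1)]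
  have "x \<noteq> y" "y \<noteq> z" using assms(2,3) unfolding precedes_def by auto
  then consider "x < y" "y < z" | "x < z" "z < y" | "y < x" "x < z" | "y < z" "z < x" | "z < x" "x < y" | "z < y" "y < x"
    using assms(4) by linarith
  then show ?thesis
  proof cases
    case 1 then show ?thesis using o[of x y z] assms unfolding precedes_def by auto
  next
    case 2 then show ?thesis using o[of x z y] assms unfolding precedes_def by auto
  next
    case 3 then show ?thesis using o[of y x z] assms unfolding precedes_def by auto
  next
    case 4 then show ?thesis using o[of y z x] assms unfolding precedes_def by auto
  next
    case 5 then show ?thesis using o[of z x y] assms unfolding precedes_def by auto
  next
    case 6 then show ?thesis using o[of z y x] assms unfolding precedes_def by auto
  qed
qed

definition downsets :: "nat \<Rightarrow> (nat \<Rightarrow> nat \<Rightarrow> nat \<Rightarrow> bool) \<Rightarrow> nat set set" where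
  "downsets n e = {Q. Q \<subseteq> {1..n} \<and> (\<forall>x\<in>Q. \<forall>y\<in>{1..n}. precedes e (Suc n) y x \<longrightarrow> y \<in> Q)}"

text \<open>Where a segment has the pattern in-out-in, the middle line is crossed last; where it has
  out-in-out, the middle line is crossed first. In both cases monotonicity of the packet with
  \<open>Suc n\<close> determines the value at the triple.\<close>

lemma downsets_separated:
  assumes "consistent (Suc n) e"
  shows "downsets n e \<subseteq> separated n e"
proof
  fix Q assume Q: "Q \<in> downsets n e"
  have pr: "\<not> precedes e (Suc n) y x" if "x \<in> Q" "y \<notin> Q" "y \<in> {1..n}" for x y
    using Q that unfolding downsets_def by blast
  have "lies_below n e Q" unfolding lies_below_def
  proof (intro allI impI, elim conjE)
    fix a b c assume *: "0 < a" "a < b" "b < c" "c \<le> n" "a \<in> Q" "b \<notin> Q" "c \<in> Q"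
    then have "e a b (Suc n)" "\<not> e b c (Suc n)"
      using pr[of a b] pr[of c b] by (auto simp: precedes_less)
    then show "e a b c" using consistentD[OF assms, of a b c "Suc n"] * unfolding mono4_def by auto
  qed
  moreover have "lies_above n e Q" unfolding lies_above_def
  proof (intro allI impI, elim conjE)
    fix a b c assume *: "0 < a" "a < b" "b < c" "c \<le> n" "a \<notin> Q" "b \<in> Q" "c \<notin> Q"
    then have "\<not> e a b (Suc n)" "e b c (Suc n)"
      using pr[of b a] pr[of b c] by (auto simp: precedes_less)
    then show "\<not> e a b c" using consistentD[OF assms, of a b c "Suc n"] * unfolding mono4_def by auto
  qed
  ultimately show "Q \<in> separated n e" using Q by (simp add: separated_def downsets_def)
qed

lemma card_linear_downsets:
  assumes "finite S"
    and "\<And>x y. x \<in> S \<Longrightarrow> y \<in> S \<Longrightarrow> x \<noteq> y \<Longrightarrow> r x y \<or> r y x"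
    and "\<And>x y. x \<in> S \<Longrightarrow> y \<in> S \<Longrightarrow> r x y \<Longrightarrow> \<not> r y x"
    and "\<And>x y z. x \<in> S \<Longrightarrow> y \<in> S \<Longrightarrow> z \<in> S \<Longrightarrow> r x y \<Longrightarrow> r y z \<Longrightarrow> x \<noteq> z \<Longrightarrow> r x z"
  shows "card {Q. Q \<subseteq> S \<and> (\<forall>x\<in>Q. \<forall>y\<in>S. r y x \<longrightarrow> y \<in> Q)} = Suc (card S)"
  using assms
proof (induction "card S" arbitrary: S)
  case 0
  have "S = {}" using 0(1,2) by simp
  then have "{Q. Q \<subseteq> S \<and> (\<forall>x\<in>Q. \<forall>y\<in>S. r y x \<longrightarrow> y \<in> Q)} = {{}}" by auto
  then show ?case using \<open>S = {}\<close> by simp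
next
  case (Suc k)
  have "S \<noteq> {}" using Suc.hyps(2) by auto
  have as: "asymp_on S r" by (rule asymp_onI) (rule Suc.prems(3))
  have tr: "transp_on S r"
  proof (rule transp_onI)
    fix x y z assume "x \<in> S" "y \<in> S" "z \<in> S" "r x y" "r y z"
    then show "r x z" using Suc.prems(3)[of x y] Suc.prems(4)[of x y z] by (cases "x = z") simp_all
  qed
  obtain m where m: "m \<in> S" "\<forall>x\<in>S. x \<noteq> m \<longrightarrow> \<not> r m x"
    using Finite_Set.bex_max_element[OF Suc.prems(1) as tr \<open>S \<noteq> {}\<close>] by (elim bexE)
  let ?d = "\<lambda>S. {Q. Q \<subseteq> S \<and> (\<forall>x\<in>Q. \<forall>y\<in>S. r y x \<longrightarrow> y \<in> Q)}"
  have rm: "r x m" if "x \<in> S" "x \<noteq> m" for x using m that Suc.prems(2)[of x m] by simp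
  have "?d S = insert S (?d (S - {m}))" (is "?l = ?r")
  proof
    show "?l \<subseteq> ?r"
    proof
      fix Q assume Q: "Q \<in> ?l"
      show "Q \<in> ?r"
      proof (cases "m \<in> Q")
        case True
        then have "Q = S" using Q rm by blast
        then show ?thesis by simp
      next
        case False
        then show ?thesis using Q by blast
      qed
    qed
    show "?r \<subseteq> ?l" using m(2) by blast
  qed
  moreover have "card (?d (S - {m})) = Suc (card (S - {m}))"
  proof (rule Suc.hyps(1))
    show "k = card (S - {m})" using Suc.hyps(2) m(1) Suc.prems(1) by simp
    show "finite (S - {m})" using Suc.prems(1) by simp
    show "r x z" if "x \<in> S - {m}" "y \<in> S - {m}" "z \<in> S - {m}" "r x y" "r y z" "x \<noteq> z" for x y z
      using Suc.prems(4)[of x y z] that by simp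
  qed (use Suc.prems(2,3) in blast)+
  moreover have "S \<notin> ?d (S - {m})" using m(1) by blast
  moreover have "finite (?d (S - {m}))" using Suc.prems(1) by simp
  ultimately show ?case using m(1) Suc.prems(1) Suc.hyps(2) by simp
qed

lemma card_downsets:
  assumes "consistent (Suc n) e"
  shows "card (downsets n e) = Suc n"
proof -
  have "card (downsets n e) = Suc (card {1..n})"
    unfolding downsets_def
  proof (rule card_linear_downsets[where S = "{1..n}" and r = "precedes e (Suc n)"])
    fix x y z :: nat assume "x \<in> {1..n}" "y \<in> {1..n}" "z \<in> {1..n}"
      "precedes e (Suc n) x y" "precedes e (Suc n) y z" "x \<noteq> z"
    then show "precedes e (Suc n) x z" using precedes_trans[OF assms] by simp
  qed (simp_all add: precedes_def split: if_splits)
  then show ?thesis by simp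
qed

text \<open>The members of \<open>separated (Suc n) e\<close> without and with \<open>Suc n\<close>; the sets in both parts are the
  initial segments of the order in which the line \<open>Suc n\<close> crosses the others.\<close>

definition low_part :: "nat \<Rightarrow> (nat \<Rightarrow> nat \<Rightarrow> nat \<Rightarrow> bool) \<Rightarrow> nat set set" where
  "low_part n e = {A \<in> separated n e. \<forall>a b. 0 < a \<and> a < b \<and> b \<le> n \<and> e a b (Suc n) \<and> b \<in> A \<longrightarrow> a \<in> A}"

definition high_part :: "nat \<Rightarrow> (nat \<Rightarrow> nat \<Rightarrow> nat \<Rightarrow> bool) \<Rightarrow> nat set set" where
  "high_part n e = {A \<in> separated n e. \<forall>a b. 0 < a \<and> a < b \<and> b \<le> n \<and> \<not> e a b (Suc n) \<and> a \<in> A \<longrightarrow> b \<in> A}"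

lemma low_partD: "A \<in> low_part n e \<Longrightarrow> 0 < a \<Longrightarrow> a < b \<Longrightarrow> b \<le> n \<Longrightarrow> e a b (Suc n) \<Longrightarrow> b \<in> A \<Longrightarrow> a \<in> A"
  unfolding low_part_def by blast

lemma high_partD: "A \<in> high_part n e \<Longrightarrow> 0 < a \<Longrightarrow> a < b \<Longrightarrow> b \<le> n \<Longrightarrow> \<not> e a b (Suc n) \<Longrightarrow> a \<in> A \<Longrightarrow> b \<in> A"
  unfolding high_part_def by blast

text \<open>Only the triples that end in \<open>Suc n\<close> add a condition. A set without
  \<open>Suc n\<close> can have only the pattern out-in-out there, which gives the implication in
  \<open>low_part\<close>; a set with \<open>Suc n\<close> can have only in-out-in, which gives the
  one in \<open>high_part\<close>.\<close>

lemma low_part_iff: "A \<in> low_part n e \<longleftrightarrow> A \<in> separated (Suc n) e \<and> Suc n \<notin> A"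
proof
  assume A: "A \<in> low_part n e"
  have "Suc n \<notin> A" using A by (auto simp: low_part_def separated_def)
  moreover have "lies_below (Suc n) e A" unfolding lies_below_def
  proof (intro allI impI, elim conjE)
    fix a b c assume *: "0 < a" "a < b" "b < c" "c \<le> Suc n" "a \<in> A" "b \<notin> A" "c \<in> A"
    then have "c \<le> n" using \<open>Suc n \<notin> A\<close> by (metis le_SucE)
    then show "e a b c" using A * lies_belowD[of n e A a b c] by (auto simp: low_part_def separated_def)
  qed
  moreover have "lies_above (Suc n) e A" unfolding lies_above_def
  proof (intro allI impI, elim conjE)
    fix a b c assume *: "0 < a" "a < b" "b < c" "c \<le> Suc n" "a \<notin> A" "b \<in> A" "c \<notin> A"
    show "\<not> e a b c"
    proof (cases "c = Suc n")
      case True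
      then show ?thesis using A * by (auto simp: low_part_def less_Suc_eq_le)
    next
      case False
      then show ?thesis using A * lies_aboveD[of n e A a b c] by (auto simp: low_part_def separated_def)
    qed
  qed
  moreover have "A \<subseteq> {1..Suc n}" using A by (auto simp: low_part_def separated_def)
  ultimately show "A \<in> separated (Suc n) e \<and> Suc n \<notin> A" by (auto simp: separated_def)
next
  assume A: "A \<in> separated (Suc n) e \<and> Suc n \<notin> A"
  have "A \<subseteq> {1..n}" using A by (auto simp: separated_def le_Suc_eq)
  moreover have "lies_below n e A" "lies_above n e A"
    using A unfolding separated_def lies_below_def lies_above_def by auto
  moreover have "a \<in> A" if "0 < a" "a < b" "b \<le> n" "e a b (Suc n)" "b \<in> A" for a b
    using A that lies_aboveD[of "Suc n" e A a b "Suc n"] by (auto simp: separated_def)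
  ultimately show "A \<in> low_part n e" unfolding low_part_def separated_def by blast
qed

lemma high_part_iff: "A \<in> high_part n e \<longleftrightarrow> insert (Suc n) A \<in> separated (Suc n) e \<and> Suc n \<notin> A"
proof
  let ?B = "insert (Suc n) A"
  assume A: "A \<in> high_part n e"
  have "Suc n \<notin> A" using A by (auto simp: high_part_def separated_def)
  moreover have "lies_above (Suc n) e ?B" unfolding lies_above_def
  proof (intro allI impI, elim conjE)
    fix a b c assume *: "0 < a" "a < b" "b < c" "c \<le> Suc n" "a \<notin> ?B" "b \<in> ?B" "c \<notin> ?B"
    then have "c \<le> n" "b \<in> A" by auto
    then show "\<not> e a b c" using A * lies_aboveD[of n e A a b c] by (auto simp: high_part_def separated_def)
  qed
  moreover have "lies_below (Suc n) e ?B" unfolding lies_below_def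
  proof (intro allI impI, elim conjE)
    fix a b c assume *: "0 < a" "a < b" "b < c" "c \<le> Suc n" "a \<in> ?B" "b \<notin> ?B" "c \<in> ?B"
    then have "a \<in> A" "b \<notin> A" by auto
    show "e a b c"
    proof (cases "c = Suc n")
      case True
      then have "b \<le> n" using * by simp
      then show ?thesis using A * \<open>a \<in> A\<close> \<open>b \<notin> A\<close> True unfolding high_part_def by blast
    next
      case False
      then show ?thesis using A * \<open>a \<in> A\<close> lies_belowD[of n e A a b c] by (auto simp: high_part_def separated_def)
    qed
  qed
  moreover have "?B \<subseteq> {1..Suc n}" using A by (auto simp: high_part_def separated_def)
  ultimately show "?B \<in> separated (Suc n) e \<and> Suc n \<notin> A" by (auto simp: separated_def)
next
  let ?B = "insert (Suc n) A"
  assume A: "?B \<in> separated (Suc n) e \<and> Suc n \<notin> A"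
  have "A \<subseteq> {1..n}" using A by (auto simp: separated_def le_Suc_eq)
  moreover have "lies_below n e A" "lies_above n e A"
    using A unfolding separated_def lies_below_def lies_above_def by auto
  moreover have "b \<in> A" if "0 < a" "a < b" "b \<le> n" "\<not> e a b (Suc n)" "a \<in> A" for a b
    using A that lies_belowD[of "Suc n" e ?B a b "Suc n"] by (auto simp: separated_def)
  ultimately show "A \<in> high_part n e" unfolding high_part_def separated_def by blast
qed

lemma low_high_Int:
  assumes "consistent (Suc n) e"
  shows "low_part n e \<inter> high_part n e = downsets n e"
proof
  show "low_part n e \<inter> high_part n e \<subseteq> downsets n e"
  proof
    fix A assume A: "A \<in> low_part n e \<inter> high_part n e"
    have "y \<in> A" if "x \<in> A" "y \<in> {1..n}" "precedes e (Suc n) y x" for x y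
    proof -
      have "x \<in> {1..n}" using A that by (auto simp: low_part_def separated_def)
      show ?thesis
      proof (cases "x < y")
        case True
        then show ?thesis using A that \<open>x \<in> {1..n}\<close> high_partD[of A n e x y] by (simp add: precedes_less)
      next
        case False
        then have "y < x" using that(3) unfolding precedes_def by simp
        then show ?thesis using A that \<open>x \<in> {1..n}\<close> low_partD[of A n e y x] by (simp add: precedes_less)
      qed
    qed
    moreover have "A \<subseteq> {1..n}" using A by (simp add: low_part_def separated_def)
    ultimately show "A \<in> downsets n e" unfolding downsets_def by simp
  qed
  show "downsets n e \<subseteq> low_part n e \<inter> high_part n e"
  proof
    fix A assume A: "A \<in> downsets n e"
    then have cl: "\<And>x y. x \<in> A \<Longrightarrow> y \<in> {1..n} \<Longrightarrow> precedes e (Suc n) y x \<Longrightarrow> y \<in> A"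
      unfolding downsets_def by blast
    have "A \<in> separated n e" using downsets_separated[OF assms] A by blast
    moreover have "a \<in> A" if "0 < a" "a < b" "b \<le> n" "e a b (Suc n)" "b \<in> A" for a b
      using cl[of b a] that by (simp add: precedes_less)
    moreover have "b \<in> A" if "0 < a" "a < b" "b \<le> n" "\<not> e a b (Suc n)" "a \<in> A" for a b
      using cl[of a b] that by (simp add: precedes_less)
    ultimately show "A \<in> low_part n e \<inter> high_part n e" unfolding low_part_def high_part_def by blast
  qed
qed

text \<open>A set outside both parts has a violation \<open>x\<close> before \<open>y\<close> with
  \<open>x < y\<close> and a violation \<open>x'\<close> before \<open>y'\<close> with
  \<open>y' < x'\<close>, where \<open>y, y'\<close> are inside and \<open>x, x'\<close> outside.
  The packets with \<open>Suc n\<close> then force \<open>y'\<close> before \<open>x\<close> and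
  \<open>y\<close> before \<open>x'\<close>, so that \<open>x, y, x', y'\<close> form a
  cycle.\<close>

lemma low_high_Un:
  assumes con: "consistent (Suc n) e"
  shows "low_part n e \<union> high_part n e = separated n e"
proof
  show "low_part n e \<union> high_part n e \<subseteq> separated n e" unfolding low_part_def high_part_def by blast
  show "separated n e \<subseteq> low_part n e \<union> high_part n e"
  proof
    fix A assume A: "A \<in> separated n e"
    let ?p = "precedes e (Suc n)"
    \<comment> \<open>A member of \<open>A\<close> crossed after two nonmembers, one on each side of
      it, would give the packet the values false, true, any, false.\<close>
    have up_up: False if "x < y" "y < x'" "?p x y" "?p x' y" "x \<notin> A" "x' \<notin> A" "y \<in> A" "0 < x" "x' \<le> n" for x y x'
    proof -
      have "\<not> e x y x'" using A that lies_aboveD[of n e A x y x'] by (auto simp: separated_def)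
      then show False using consistentD[OF con, of x y x' "Suc n"] that unfolding mono4_def precedes_def by auto
    qed
    have lo_lo: False if "y' < x" "x < y" "?p x y" "?p x y'" "x \<notin> A" "y' \<in> A" "y \<in> A" "0 < y'" "y \<le> n" for x y y'
    proof -
      have "e y' x y" using A that lies_belowD[of n e A y' x y] by (auto simp: separated_def)
      then show False using consistentD[OF con, of y' x y "Suc n"] that unfolding mono4_def precedes_def by auto
    qed
    show "A \<in> low_part n e \<union> high_part n e"
    proof (rule ccontr)
      assume "A \<notin> low_part n e \<union> high_part n e"
      then obtain x y y' x' where *: "0 < x" "x < y" "y \<le> n" "e x y (Suc n)" "y \<in> A" "x \<notin> A"
        "0 < y'" "y' < x'" "x' \<le> n" "\<not> e y' x' (Suc n)" "y' \<in> A" "x' \<notin> A"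
        using A unfolding low_part_def high_part_def by blast
      then have p: "?p x y" "?p x' y'" by (auto simp: precedes_less)
      have "x \<noteq> y'" "x' \<noteq> y" using * by auto
      have 1: "?p y' x"
      proof (rule ccontr)
        assume "\<not> ?p y' x"
        then have "?p x y'" using precedes_total[OF \<open>x \<noteq> y'\<close>] by blast
        then show False using up_up[of x y' x'] lo_lo[of y' x y] p * \<open>x \<noteq> y'\<close> by (cases "x < y'") auto
      qed
      have 2: "?p y x'"
      proof (rule ccontr)
        assume "\<not> ?p y x'"
        then have "?p x' y" using precedes_total[OF \<open>x' \<noteq> y\<close>] by blast
        then show False using up_up[of x y x'] lo_lo[of y' x' y] p * \<open>x' \<noteq> y\<close> by (cases "x' < y") auto
      qed
      have ran: "x \<in> {1..n}" "y \<in> {1..n}" "x' \<in> {1..n}" "y' \<in> {1..n}" using * by auto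
      have "x \<noteq> x'" using p 2 precedes_total[of x y e "Suc n"] * by auto
      then have "?p x x'" using precedes_trans[OF con p(1) 2] ran by blast
      then have "?p x y'" using precedes_trans[OF con _ p(2) \<open>x \<noteq> y'\<close>] ran by blast
      then show False using 1 precedes_total[OF \<open>x \<noteq> y'\<close>] by blast
    qed
  qed
qed

lemma finite_parts: "finite (low_part n e)" "finite (high_part n e)"
  by (rule finite_subset[OF _ finite_separated[of n e]]; auto simp: low_part_def high_part_def)+

lemma separated_Suc: "separated (Suc n) e = low_part n e \<union> insert (Suc n) ` high_part n e"
proof -
  have "A \<in> insert (Suc n) ` high_part n e \<longleftrightarrow> A \<in> separated (Suc n) e \<and> Suc n \<in> A" for A
  proof
    assume "A \<in> separated (Suc n) e \<and> Suc n \<in> A"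
    moreover from this have "insert (Suc n) (A - {Suc n}) = A" by auto
    ultimately have "A - {Suc n} \<in> high_part n e" by (simp add: high_part_iff)
    then show "A \<in> insert (Suc n) ` high_part n e" using \<open>insert (Suc n) (A - {Suc n}) = A\<close> by (metis image_eqI)
  qed (auto simp: high_part_iff)
  note * = this
  show ?thesis
  proof (rule Set.set_eqI)
    show "A \<in> separated (Suc n) e \<longleftrightarrow> A \<in> low_part n e \<union> insert (Suc n) ` high_part n e" for A
      using *[of A] low_part_iff[of A n e] by blast
  qed
qed

text \<open>The sizes of the low and the high part add up to those of their union and intersection,
  that is, to all members for \<open>n\<close> and the \<open>n + 1\<close> initial segments. Hence
  the size is independent of \<open>e\<close>, and summation gives n(n+1)/2 + 1.\<close>

lemma card_separated_Suc:
  assumes "consistent (Suc n) e"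
  shows "card (separated (Suc n) e) = card (separated n e) + Suc n"
proof -
  have "inj_on (insert (Suc n)) (high_part n e)"
    by (rule inj_onI) (simp add: high_part_iff insert_ident)
  moreover have "low_part n e \<inter> insert (Suc n) ` high_part n e = {}" by (auto simp: low_part_iff)
  ultimately have "card (separated (Suc n) e) = card (low_part n e) + card (high_part n e)"
    unfolding separated_Suc using finite_parts by (simp add: card_Un_disjoint card_image)
  also have "\<dots> = card (separated n e) + card (downsets n e)"
    using card_Un_Int[OF finite_parts, of n e n e] low_high_Un[OF assms] low_high_Int[OF assms] by simp
  finally show ?thesis using card_downsets[OF assms] by simp
qed

lemma card_separated: "consistent n e \<Longrightarrow> card (separated n e) = Suc (\<Sum>{1..n})"
proof (induction n)
  case 0
  have "separated 0 e = {{}}" by (auto simp: separated_def lies_below_def lies_above_def)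
  then show ?case by simp
next
  case (Suc n)
  then show ?case using card_separated_Suc consistent_mono[of "Suc n" e n] by simp
qed

text \<open>By \<open>low_high_Un\<close> a member remains one at the next level, either unchanged
  or with the new element added.\<close>

lemma separated_extend:
  assumes "consistent n e" "m \<le> n" "A \<in> separated m e"
  shows "\<exists>B\<in>separated n e. B \<inter> {1..m} = A"
  using assms(2,1)
proof (induction rule: dec_induct)
  case base
  then show ?case using assms(3) by (intro bexI[of _ A]) (auto simp: separated_def)
next
  case (step n)
  then obtain B where B: "B \<in> separated n e" "B \<inter> {1..m} = A" using consistent_mono[of "Suc n" e n] by auto
  then consider "B \<in> separated (Suc n) e" | "insert (Suc n) B \<in> separated (Suc n) e"
    using low_high_Un[OF step.prems] low_part_iff high_part_iff by blast
  then show ?case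
  proof cases
    case 1
    then show ?thesis using B by blast
  next
    case 2
    then show ?thesis using B step.hyps by (intro bexI[of _ "insert (Suc n) B"]) auto
  qed
qed

text \<open>These witnesses make \<open>e\<close> recoverable from its collection. They come from
  the crossing order of the line \<open>c\<close>: the lines before \<open>b\<close> together with
  \<open>c\<close> in the first case, the lines before \<open>a\<close> in the second. They are then
  extended from level \<open>c\<close> to level \<open>n\<close>.\<close>

lemma separated_realizes:
  assumes con: "consistent n e" and abc: "0 < a" "a < b" "b < c" "c \<le> n"
  shows "e a b c \<Longrightarrow> \<exists>B\<in>separated n e. a \<in> B \<and> b \<notin> B \<and> c \<in> B"
    and "\<not> e a b c \<Longrightarrow> \<exists>B\<in>separated n e. a \<notin> B \<and> b \<in> B \<and> c \<notin> B"
proof -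
  obtain k where k: "c = Suc k" using abc by (metis not_less_zero not0_implies_Suc)
  have conk: "consistent (Suc k) e" using consistent_mono[OF con] abc k by simp
  have ran: "a \<in> {1..k}" "b \<in> {1..k}" using abc k by auto
  let ?Q = "\<lambda>x. {y \<in> {1..k}. precedes e (Suc k) y x}"
  have tr: "precedes e (Suc k) y b'" if "precedes e (Suc k) y x" "precedes e (Suc k) x b'"
    "x \<in> {1..k}" "y \<in> {1..k}" "b' \<in> {1..k}" for x y b'
  proof -
    have "y \<noteq> b'" using that precedes_total[of x y e "Suc k"] precedes_irrefl[of e "Suc k" x] by metis
    then show ?thesis using precedes_trans[OF conk that(1,2)] that by blast
  qed
  have Q: "?Q x \<in> low_part k e \<inter> high_part k e" if "x \<in> {1..k}" for x
    unfolding low_high_Int[OF conk] downsets_def using tr that by blast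
  have lift: "\<exists>B\<in>separated n e. \<forall>x\<in>{a, b, c}. x \<in> B \<longleftrightarrow> x \<in> R" if R: "R \<in> separated c e" for R
  proof -
    obtain B where B: "B \<in> separated n e" "B \<inter> {1..c} = R" using separated_extend[OF con abc(4) R] by blast
    moreover have "{a, b, c} \<subseteq> {1..c}" using abc by auto
    ultimately show ?thesis by (intro bexI[of _ B]) auto
  qed
  show "\<exists>B\<in>separated n e. a \<in> B \<and> b \<notin> B \<and> c \<in> B" if "e a b c"
  proof -
    have "insert c (?Q b) \<in> separated c e" using Q[OF ran(2)] high_part_iff[of "?Q b" k e] k by simp
    from lift[OF this] show ?thesis using that ran abc k by (auto simp: precedes_def)
  qed
  show "\<exists>B\<in>separated n e. a \<notin> B \<and> b \<in> B \<and> c \<notin> B" if "\<not> e a b c"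
  proof -
    have "?Q a \<in> separated c e" using Q[OF ran(1)] low_part_iff[of "?Q a" k e] k by simp
    from lift[OF this] show ?thesis using that ran abc k by (auto simp: precedes_def)
  qed
qed

subsection \<open>Comparability of a chord separated set with an orientation\<close>

lemma consistent_negate: "consistent n e \<Longrightarrow> consistent n (\<lambda>a b c. \<not> e a b c)"
  unfolding consistent_def mono4_def by simp

lemma surrounds_complement:
  "A \<subseteq> {1..n} \<Longrightarrow> B \<subseteq> {1..n} \<Longrightarrow> surrounds ({1..n} - A) ({1..n} - B) \<longleftrightarrow> surrounds B A"
  unfolding surrounds_def by blast

lemma lies_below_complement:
  "lies_below n (\<lambda>a b c. \<not> e a b c) ({1..n} - A) \<longleftrightarrow> lies_above n e A"
  unfolding lies_below_def lies_above_def by (auto; metis less_trans not_less order_le_less)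

lemma lies_above_complement:
  "lies_above n (\<lambda>a b c. \<not> e a b c) ({1..n} - A) \<longleftrightarrow> lies_below n e A"
  unfolding lies_below_def lies_above_def by (auto; metis less_trans not_less order_le_less)

lemma separated_complement:
  "B \<in> separated n (\<lambda>a b c. \<not> e a b c) \<Longrightarrow> {1..n} - B \<in> separated n e"
  unfolding separated_def using lies_below_complement[of n "\<lambda>a b c. \<not> e a b c" B]
    lies_above_complement[of n "\<lambda>a b c. \<not> e a b c" B] by simp

text \<open>The triple \<open>a, b, c\<close> shows that \<open>A\<close> does not lie below
  \<open>e\<close>, and the pair \<open>d, x\<close> that the last element destroys lying above.
  Chord separation from suitable members containing the last element makes these two failures
  incompatible.\<close>

lemma no_crossing_without_last:
  assumes con: "consistent (Suc n) e" and A: "A \<subseteq> {1..n}"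
    and ch: "\<And>B. B \<in> separated (Suc n) e \<Longrightarrow> surrounds A B \<Longrightarrow> \<not> surrounds B A"
    and la: "lies_above n e A"
    and abc: "0 < a" "a < b" "b < c" "a \<in> A" "b \<notin> A" "c \<in> A" "\<not> e a b c"
    and dx: "0 < d" "d < x" "d \<notin> A" "x \<in> A" "e d x (Suc n)"
  shows False
proof -
  let ?z = "Suc n" and ?p = "precedes e (Suc n)"
  have cn: "c \<le> n" "x \<le> n" using A abc dx by auto
  \<comment> \<open>If an outside \<open>j\<close> is crossed first among \<open>i < j < k\<close>,
    then \<open>A\<close> surrounds the segment ending with \<open>j\<close>; with the last element
    added, this segment also surrounds \<open>A\<close>.\<close>
  have first: False if ijk: "0 < i" "i < j" "j < k" "i \<in> A" "j \<notin> A" "k \<in> A" "\<not> e i j ?z" "e j k ?z" for i j k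
  proof -
    let ?Q = "{y \<in> {1..n}. y = j \<or> ?p y j}"
    have kn: "k \<le> n" using A ijk by auto
    have "?Q \<in> downsets n e"
    proof -
      have "y = j \<or> ?p y j" if "?p y u" "?p u j" "u \<in> {1..n}" "y \<in> {1..n}" for y u
        using precedes_trans[OF con that(1,2)] that kn ijk by auto
      then show ?thesis unfolding downsets_def by blast
    qed
    then have "?Q \<in> high_part n e" using low_high_Int[OF con] by blast
    then have Qz: "insert ?z ?Q \<in> separated ?z e" unfolding high_part_iff by simp
    have *: "i \<notin> insert ?z ?Q" "j \<in> insert ?z ?Q" "k \<notin> insert ?z ?Q" "?z \<notin> A"
      using ijk kn A by (auto simp: precedes_def)
    have "k < ?z" using kn by simp
    have "surrounds A (insert ?z ?Q)" by (rule surroundsI[of i j k]) (fact ijk *)+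
    moreover have "surrounds (insert ?z ?Q) A"
      by (rule surroundsI[of j k ?z]) (fact ijk * \<open>k < ?z\<close> insertI1)+
    ultimately show False using ch[OF Qz] by simp
  qed
  have m: "mono4 (e a b c) (e a b ?z) (e a c ?z) (e b c ?z)"
    using consistentD[OF con, of a b c ?z] abc cn by simp
  show False
  proof (cases "e b c ?z")
    case True
    have ab: "e a b ?z" using first[OF abc(1-6)] True by blast
    obtain Q where Q: "Q \<in> separated n e" "a \<notin> Q" "b \<in> Q" "c \<notin> Q"
      using separated_realizes(2)[OF consistent_mono[OF con] abc(1-3) cn(1)] abc(7) by auto
    \<comment> \<open>\<open>Q\<close> contains \<open>b\<close> but not \<open>a\<close>, which is
      crossed earlier. So it extends to a member with the last element, and this element makes it
      surround \<open>A\<close>.\<close>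
    have "Q \<notin> low_part n e" using low_partD[of Q n e a b] ab abc cn Q by auto
    then have "Q \<in> high_part n e" using low_high_Un[OF con] Q by blast
    then have Qz: "insert ?z Q \<in> separated ?z e" using high_part_iff by blast
    have "surrounds A (insert ?z Q)" by (rule surroundsI[of a b c]) (use Q abc cn in auto)
    moreover have "surrounds (insert ?z Q) A" by (rule surroundsI[of b c ?z]) (use Q abc cn A in auto)
    ultimately show False using ch[OF Qz] by blast
  next
    case False
    then have ab: "\<not> e a b ?z" using m abc(7) unfolding mono4_def by blast
    \<comment> \<open>The counterpart of \<open>first\<close>: an element of \<open>A\<close>
      between two outside elements cannot be crossed last, because \<open>A\<close> lies above
      \<open>e\<close> at level \<open>n\<close>.\<close>
    have down: False if "0 < y" "y < u" "u < w" "y \<notin> A" "u \<in> A" "w \<notin> A" "w \<le> n" "e y u ?z" "\<not> e u w ?z" for y u w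
    proof -
      have "\<not> e y u w" using lies_aboveD[OF la, of y u w] that by simp
      then show False using consistentD[OF con, of y u w ?z] that unfolding mono4_def by auto
    qed
    have ran: "a \<in> {1..n}" "b \<in> {1..n}" "d \<in> {1..n}" "x \<in> {1..n}" using abc dx cn by auto
    have "a \<noteq> d" "b \<noteq> x" using abc dx by auto
    have "?p a d"
    proof (rule ccontr)
      assume "\<not> ?p a d"
      then have da: "?p d a" using precedes_total[OF \<open>a \<noteq> d\<close>] by blast
      show False
      proof (cases "d < a")
        case True
        then show False using down[OF dx(1) True abc(2) dx(3) abc(4,5)] da ab abc cn by (simp add: precedes_less)
      next
        case False
        then have "a < d" using \<open>a \<noteq> d\<close> by simp
        then show False using first[OF abc(1) _ dx(2) abc(4) dx(3,4) _ dx(5)] da by (simp add: precedes_less)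
      qed
    qed
    moreover have "?p b a" using ab abc by (simp add: precedes_less)
    moreover have "?p d x" using dx by (simp add: precedes_less)
    moreover have "b \<noteq> d"
      using calculation precedes_total[of a d e ?z] \<open>a \<noteq> d\<close> by blast
    \<comment> \<open>The crossing order contains the chain \<open>b, a, d, x\<close>. If
      \<open>x < b\<close>, then \<open>down\<close> applies to \<open>d, x, b\<close>; if
      \<open>b < x\<close>, then \<open>first\<close> applies to \<open>a, b, x\<close>.\<close>
    ultimately have bx: "?p b x"
      using precedes_trans[OF con, of b a d] precedes_trans[OF con, of b d x] \<open>b \<noteq> x\<close> ran by blast
    show False
    proof (cases "x < b")
      case True
      then show False using down[OF dx(1,2) True dx(3,4) abc(5)] bx dx abc cn by (simp add: precedes_less)
    next
      case False
      then have "b < x" using \<open>b \<noteq> x\<close> by simp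
      then show False using first[OF abc(1,2) _ abc(4,5) dx(4) ab] bx by (simp add: precedes_less)
    qed
  qed
qed

text \<open>For a set without the last element, a failure to lie below is visible after deleting
  that element. By induction the set then lies above at the smaller level, so a failure to lie above
  must involve the last element, and \<open>no_crossing_without_last\<close> applies.\<close>

theorem lies_below_or_above:
  assumes "consistent n e" "A \<subseteq> {1..n}" "\<And>B. B \<in> separated n e \<Longrightarrow> surrounds A B \<Longrightarrow> \<not> surrounds B A"
  shows "lies_below n e A \<or> lies_above n e A"
  using assms
proof (induction n arbitrary: e A)
  case 0
  then show ?case unfolding lies_below_def by simp
next
  case (Suc n)
  let ?z = "Suc n"
  have without: "lies_below ?z e A \<or> lies_above ?z e A"
    if con: "consistent ?z e" and A: "A \<subseteq> {1..?z}" and ch: "\<And>B. B \<in> separated ?z e \<Longrightarrow> surrounds A B \<Longrightarrow> \<not> surrounds B A"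
      and zA: "?z \<notin> A" for e A
  proof (rule ccontr)
    assume neg: "\<not> (lies_below ?z e A \<or> lies_above ?z e A)"
    have An: "A \<subseteq> {1..n}" using A zA by (auto simp: le_Suc_eq)
    have "lies_below n e A \<or> lies_above n e A"
    proof (rule Suc.IH)
      show "consistent n e" using consistent_mono[OF con] by simp
      show "A \<subseteq> {1..n}" by (rule An)
      fix B assume B: "B \<in> separated n e" "surrounds A B"
      have zB: "?z \<notin> B" using B(1) unfolding separated_def by auto
      show "\<not> surrounds B A"
      proof (cases "B \<in> low_part n e")
        case True
        then show ?thesis using ch[of B] B low_part_iff by blast
      next
        case False
        then have "insert ?z B \<in> separated ?z e" using low_high_Un[OF con] B high_part_iff by blast
        moreover have eq: "insert ?z B - {?z} = B" "A - {?z} = A" using zA zB by auto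
        ultimately show ?thesis
          using ch[of "insert ?z B"] B surrounds_remove[of A ?z "insert ?z B"] surrounds_remove[of "insert ?z B" ?z A]
          by auto
      qed
    qed
    moreover obtain a b c where abc: "0 < a" "a < b" "b < c" "c \<le> ?z" "a \<in> A" "b \<notin> A" "c \<in> A" "\<not> e a b c"
      using neg unfolding lies_below_def by blast
    moreover have "c \<le> n" using abc An by auto
    moreover have "\<not> lies_below n e A" using abc \<open>c \<le> n\<close> unfolding lies_below_def by blast
    ultimately have la: "lies_above n e A" by blast
    obtain d x y where dxy: "0 < d" "d < x" "x < y" "y \<le> ?z" "d \<notin> A" "x \<in> A" "y \<notin> A" "e d x y"
      using neg unfolding lies_above_def by blast
    have "y = ?z" using lies_aboveD[OF la, of d x y] dxy by (cases "y \<le> n") auto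
    then show False
      using no_crossing_without_last[OF con An ch la abc(1-3,5-8) dxy(1,2,5,6)] dxy(8) by blast
  qed
  show ?case
  proof (cases "?z \<in> A")
    case False
    then show ?thesis using without[OF Suc.prems(1,2)] Suc.prems(3) by blast
  next
    case True
    \<comment> \<open>Complementing the sets and negating the orientation exchanges lying below with
      lying above and reverses surrounding, so a set with the last element reduces to one without
      it.\<close>
    let ?e = "\<lambda>a b c. \<not> e a b c" and ?A = "{1..?z} - A"
    have "lies_below ?z ?e ?A \<or> lies_above ?z ?e ?A"
    proof (rule without)
      show "consistent ?z ?e" by (rule consistent_negate[OF Suc.prems(1)])
      show "?A \<subseteq> {1..?z}" by blast
      show "?z \<notin> ?A" using True by blast
      fix B assume B: "B \<in> separated ?z ?e" "surrounds ?A B"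
      then have sub: "B \<subseteq> {1..?z}" and B': "{1..?z} - B \<in> separated ?z e"
        using separated_complement by (auto simp: separated_def)
      have "{1..?z} - ({1..?z} - B) = B" using sub by blast
      then have "surrounds ({1..?z} - B) A" "surrounds B ?A \<longleftrightarrow> surrounds A ({1..?z} - B)"
        using B(2) surrounds_complement[OF Suc.prems(2), of "{1..?z} - B"]
          surrounds_complement[OF _ Suc.prems(2), of "{1..?z} - B"] by auto
      then show "\<not> surrounds B ?A" using Suc.prems(3)[OF B'] by blast
    qed
    then show ?thesis unfolding lies_below_complement lies_above_complement by blast
  qed
qed

subsection \<open>The distributive lattice\<close>

abbreviation inclusion_order :: "('a \<Rightarrow> 'b set) \<Rightarrow> 'a set \<Rightarrow> 'a gorder" where
  "inclusion_order f M \<equiv> \<lparr>carrier = M, eq = (=), le = (\<lambda>x y. f x \<subseteq> f y)\<rparr>"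

text \<open>The image of \<open>f\<close> is a sublattice of a power set and inherits its
  distributive law.\<close>

lemma distributive_lattice_inclusion_order:
  assumes inj: "inj_on f M"
    and meet: "\<And>x y. x \<in> M \<Longrightarrow> y \<in> M \<Longrightarrow> \<exists>z\<in>M. f z = f x \<inter> f y"
    and join: "\<And>x y. x \<in> M \<Longrightarrow> y \<in> M \<Longrightarrow> \<exists>z\<in>M. f z = f x \<union> f y"
  shows "distributive_lattice (inclusion_order f M)"
proof -
  let ?L = "inclusion_order f M"
  have glb: "greatest ?L z (Lower ?L {x, y})" if "x \<in> M" "y \<in> M" "z \<in> M" "f z = f x \<inter> f y" for x y z
    using that unfolding greatest_def Lower_def by auto
  have lub: "least ?L z (Upper ?L {x, y})" if "x \<in> M" "y \<in> M" "z \<in> M" "f z = f x \<union> f y" for x y z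
    using that unfolding least_def Upper_def by auto
  interpret partial_order ?L
    by unfold_locales (use inj in \<open>auto simp: inj_on_def\<close>)
  interpret lattice ?L
  proof unfold_locales
    show "\<exists>s. least ?L s (Upper ?L {x, y})" if "x \<in> carrier ?L" "y \<in> carrier ?L" for x y
      using join[of x y] lub[of x y] that by auto
    show "\<exists>s. greatest ?L s (Lower ?L {x, y})" if "x \<in> carrier ?L" "y \<in> carrier ?L" for x y
      using meet[of x y] glb[of x y] that by auto
  qed
  have fmeet: "f (x \<sqinter>\<^bsub>?L\<^esub> y) = f x \<inter> f y" if "x \<in> M" "y \<in> M" for x y
  proof -
    obtain z where z: "z \<in> M" "f z = f x \<inter> f y" using meet[OF \<open>x \<in> M\<close> \<open>y \<in> M\<close>] by blast
    have "x \<sqinter>\<^bsub>?L\<^esub> y = z"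
      by (rule meetI) (use greatest_unique glb z that in auto)
    then show ?thesis using z by simp
  qed
  have fjoin: "f (x \<squnion>\<^bsub>?L\<^esub> y) = f x \<union> f y" if "x \<in> M" "y \<in> M" for x y
  proof -
    obtain z where z: "z \<in> M" "f z = f x \<union> f y" using join[OF \<open>x \<in> M\<close> \<open>y \<in> M\<close>] by blast
    have "x \<squnion>\<^bsub>?L\<^esub> y = z"
      by (rule joinI) (use least_unique lub z that in auto)
    then show ?thesis using z by simp
  qed
  show ?thesis
  proof unfold_locales
    fix x y z assume xyz: "x \<in> carrier ?L" "y \<in> carrier ?L" "z \<in> carrier ?L"
    have "f (x \<sqinter>\<^bsub>?L\<^esub> (y \<squnion>\<^bsub>?L\<^esub> z)) = f ((x \<sqinter>\<^bsub>?L\<^esub> y) \<squnion>\<^bsub>?L\<^esub> (x \<sqinter>\<^bsub>?L\<^esub> z))"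
      using xyz join_closed[of y z] meet_closed[of x y] meet_closed[of x z] by (simp add: fmeet fjoin Int_Un_distrib)
    then show "x \<sqinter>\<^bsub>?L\<^esub> (y \<squnion>\<^bsub>?L\<^esub> z) = (x \<sqinter>\<^bsub>?L\<^esub> y) \<squnion>\<^bsub>?L\<^esub> (x \<sqinter>\<^bsub>?L\<^esub> z)"
      using xyz join_closed meet_closed by (intro inj_onD[OF inj]) auto
  qed
qed

section \<open>Strong and chord separation in terms of surrounding\<close>

lemma strongly_separated_iff:
  assumes "A \<subseteq> {1..n}" "B \<subseteq> {1..n}"
  shows "strongly_separated A B \<longleftrightarrow> \<not> surrounds A B \<and> \<not> surrounds B A"
proof -
  let ?X = "A - B" and ?Y = "B - A"
  have fin: "finite ?X" "finite ?Y" using assms by (simp_all add: finite_subset[OF _ finite_atLeastAtMost])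
  have pos: "0 < x" if "x \<in> ?X \<union> ?Y" for x using that assms by auto
  show ?thesis
  proof (cases "?X = {} \<or> ?Y = {}")
    case True
    then have "\<not> surrounds A B \<and> \<not> surrounds B A" unfolding surrounds_def by blast
    moreover have "strongly_separated A B"
    proof (cases "?X = {} \<and> ?Y = {}")
      case True
      then show ?thesis unfolding strongly_separated_def by blast
    next
      case False
      then consider "?X = {}" "?Y \<noteq> {}" | "?X \<noteq> {}" "?Y = {}" using True by blast
      then show ?thesis
      proof cases
        case 1
        \<comment> \<open>The value 0 for the maximum of the empty set puts an empty difference
          before the other one, since all elements are positive.\<close>
        then have "0 < Min ?Y" using Min_in[OF fin(2)] pos by blast
        then show ?thesis using 1 by (simp add: strongly_separated_def set_before_def max0_def min0_def)
      next
        case 2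
        then have "0 < Min ?X" using Min_in[OF fin(1)] pos by blast
        then show ?thesis using 2 by (simp add: strongly_separated_def set_before_def max0_def min0_def)
      qed
    qed
    ultimately show ?thesis by blast
  next
    case False
    have before: "set_before P Q \<longleftrightarrow> (\<forall>p\<in>P. \<forall>q\<in>Q. p < q)" if "finite P" "finite Q" "P \<noteq> {}" "Q \<noteq> {}" for P Q
      using that by (auto simp: set_before_def max0_def min0_def)
    have "A \<noteq> B" using False by blast
    have eq: "strongly_separated A B \<longleftrightarrow> (\<forall>p\<in>?X. \<forall>q\<in>?Y. p < q) \<or> (\<forall>p\<in>?Y. \<forall>q\<in>?X. p < q)"
      unfolding strongly_separated_def using before[OF fin] before[OF fin(2,1)] False \<open>A \<noteq> B\<close> by simp
    show ?thesis
    proof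
      assume "strongly_separated A B"
      then show "\<not> surrounds A B \<and> \<not> surrounds B A" unfolding eq surrounds_def by (meson less_asym')
    next
      assume ns: "\<not> surrounds A B \<and> \<not> surrounds B A"
      show "strongly_separated A B"
      proof (rule ccontr)
        assume "\<not> strongly_separated A B"
        then obtain x y y' x' where *: "x \<in> ?X" "y \<in> ?Y" "\<not> x < y" "y' \<in> ?Y" "x' \<in> ?X" "\<not> y' < x'"
          unfolding eq by blast
        then have lt: "y < x" "x' < y'" by (metis DiffD1 DiffD2 linorder_neqE_nat)+
        \<comment> \<open>The two failures give \<open>y < x\<close> and \<open>x' < y'\<close>;
          comparing \<open>x'\<close> with \<open>y\<close> tells which set surrounds the
          other.\<close>
        have "x' \<noteq> y" using * by blast
        then consider "x' < y" | "y < x'" by linarith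
        then show False
        proof cases
          case 1
          then have "surrounds A B" using surroundsI[of x' y x A B] lt * by blast
          then show False using ns by blast
        next
          case 2
          then have "surrounds B A" using surroundsI[of y x' y' B A] lt * by blast
          then show False using ns by blast
        qed
      qed
    qed
  qed
qed

text \<open>Of two opposite surrounding patterns \<open>i < j < k\<close> and
  \<open>p < q < r\<close>, the smaller first element placed before the whole other pattern gives an
  alternation of four. Conversely, such an alternation contains both patterns.\<close>

lemma chord_separated_iff: "chord_separated A B \<longleftrightarrow> \<not> (surrounds A B \<and> surrounds B A)"
proof
  assume cs: "chord_separated A B"
  show "\<not> (surrounds A B \<and> surrounds B A)"
  proof (intro notI, elim conjE)
    assume "surrounds A B" "surrounds B A"
    then obtain i j k p q r where *: "i < j" "j < k" "i \<in> A - B" "j \<in> B - A" "k \<in> A - B"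
      "p < q" "q < r" "p \<in> B - A" "q \<in> A - B" "r \<in> B - A" unfolding surrounds_def by blast
    then have "i \<noteq> p" by blast
    then consider "p < i" | "i < p" by linarith
    then show False
    proof cases
      case 1
      then show False using cs * unfolding chord_separated_def by blast
    next
      case 2
      then show False using cs * unfolding chord_separated_def by blast
    qed
  qed
next
  assume ns: "\<not> (surrounds A B \<and> surrounds B A)"
  have two: "surrounds A B \<and> surrounds B A"
    if "i < j" "j < k" "k < l" "i \<in> A - B" "k \<in> A - B" "j \<in> B - A" "l \<in> B - A" for i j k l A B
    using that surroundsI[of i j k A B] surroundsI[of j k l B A] by blast
  show "chord_separated A B"
    unfolding chord_separated_def
  proof (intro notI, elim exE conjE disjE)
    fix i j k l assume "i < j" "j < k" "k < l" "{i, k} \<subseteq> A - B" "{j, l} \<subseteq> B - A"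
    then show False using two[of i j k l A B] ns by simp
  next
    fix i j k l assume "i < j" "j < k" "k < l" "{i, k} \<subseteq> B - A" "{j, l} \<subseteq> A - B"
    then show False using two[of i j k l B A] ns by simp
  qed
qed

lemma chord_separated_collection_iff:
  "chord_separated_collection n F \<longleftrightarrow> F \<subseteq> Pow {1..n} \<and> chordal F"
  unfolding chord_separated_collection_def chordal_def chord_separated_iff by blast

lemma strongly_separated_collection_iff:
  "strongly_separated_collection n F \<longleftrightarrow> F \<subseteq> Pow {1..n} \<and> (\<forall>A\<in>F. \<forall>B\<in>F. \<not> surrounds A B)"
proof (cases "F \<subseteq> Pow {1..n}")
  case True
  then have "strongly_separated A B \<longleftrightarrow> \<not> surrounds A B \<and> \<not> surrounds B A" if "A \<in> F" "B \<in> F" for A B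
    using that by (intro strongly_separated_iff) auto
  then have "(\<forall>A\<in>F. \<forall>B\<in>F. strongly_separated A B) \<longleftrightarrow> (\<forall>A\<in>F. \<forall>B\<in>F. \<not> surrounds A B \<and> \<not> surrounds B A)"
    by (simp cong: ball_cong)
  also have "\<dots> \<longleftrightarrow> (\<forall>A\<in>F. \<forall>B\<in>F. \<not> surrounds A B)" by blast
  finally show ?thesis using True unfolding strongly_separated_collection_def by simp
qed (simp add: strongly_separated_collection_def)

lemma strongly_separated_collection_separated: "strongly_separated_collection n (separated n e)"
  unfolding strongly_separated_collection_iff using separated_not_surrounds by (auto simp: separated_def)

lemma strongly_separated_subset_separated:
  assumes "strongly_separated_collection n S"
  shows "\<exists>e. consistent n e \<and> S \<subseteq> separated n e"
proof -
  have S: "S \<subseteq> Pow {1..n}" "\<And>A B. A \<in> S \<Longrightarrow> B \<in> S \<Longrightarrow> \<not> surrounds A B"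
    using assms unfolding strongly_separated_collection_iff by auto
  then have "chordal S" unfolding chordal_def by blast
  from separating_orientation[OF S(1) S(1) this this S(2)] show ?thesis
    using S(1) unfolding separated_def by blast
qed

lemma card_strongly_separated:
  assumes "strongly_separated_collection n S"
  shows "card S \<le> Suc (\<Sum>{1..n})"
proof -
  obtain e where e: "consistent n e" "S \<subseteq> separated n e"
    using strongly_separated_subset_separated[OF assms] by blast
  then show ?thesis using card_mono[OF finite_separated e(2)] card_separated[OF e(1)] by simp
qed

text \<open>Every strongly separated collection is contained in the collection of some orientation,
  and all of these have the same size.\<close>

lemma max_strongly_separated_iff:
  "S \<in> max_strongly_separated_in n C \<longleftrightarrow> S \<subseteq> C \<and> (\<exists>e. consistent n e \<and> S = separated n e)"
proof
  assume "S \<in> max_strongly_separated_in n C"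
  then have S: "S \<subseteq> C" "strongly_separated_collection n S"
    "\<And>T. strongly_separated_collection n T \<Longrightarrow> card T \<le> card S" unfolding max_strongly_separated_in_def by auto
  obtain e where e: "consistent n e" "S \<subseteq> separated n e"
    using strongly_separated_subset_separated[OF S(2)] by blast
  have "S = separated n e"
    by (rule card_seteq[OF finite_separated e(2) S(3)[OF strongly_separated_collection_separated]])
  then show "S \<subseteq> C \<and> (\<exists>e. consistent n e \<and> S = separated n e)" using S(1) e(1) by blast
next
  assume "S \<subseteq> C \<and> (\<exists>e. consistent n e \<and> S = separated n e)"
  then show "S \<in> max_strongly_separated_in n C"
    using card_strongly_separated card_separated strongly_separated_collection_separated
    unfolding max_strongly_separated_in_def by auto
qed

lemma max_strongly_separated_by_card:
  assumes "strongly_separated_collection n S" "S \<subseteq> C" "card S = Suc (\<Sum>{1..n})"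
  shows "S \<in> max_strongly_separated_in n C"
  using assms card_strongly_separated unfolding max_strongly_separated_in_def by auto

section \<open>Sets of reversed triples\<close>

definition inversions :: "nat set set \<Rightarrow> (nat \<times> nat \<times> nat) set" where
  "inversions S = {(a, b, c). a < b \<and> b < c \<and> (\<exists>A\<in>S. a \<in> A \<and> b \<notin> A \<and> c \<in> A)}"

text \<open>A canonical choice of orientation: on increasing triples of \<open>{1..n}\<close> it
  gives back \<open>e\<close> when applied to \<open>separated n e\<close> for a consistent
  \<open>e\<close>.\<close>

definition orientation :: "nat set set \<Rightarrow> nat \<Rightarrow> nat \<Rightarrow> nat \<Rightarrow> bool" where
  "orientation S a b c \<longleftrightarrow> (\<exists>A\<in>S. a \<in> A \<and> b \<notin> A \<and> c \<in> A)"

lemma orientation_separated: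
  assumes "consistent n e" "0 < a" "a < b" "b < c" "c \<le> n"
  shows "orientation (separated n e) a b c \<longleftrightarrow> e a b c"
  using separated_realizes(1)[OF assms] assms lies_belowD[of n e _ a b c]
  unfolding orientation_def separated_def by blast

lemma inversions_separated:
  assumes "consistent n e"
  shows "inversions (separated n e) = {(a, b, c). 0 < a \<and> a < b \<and> b < c \<and> c \<le> n \<and> e a b c}"
proof -
  have "(a, b, c) \<in> inversions (separated n e) \<longleftrightarrow> 0 < a \<and> a < b \<and> b < c \<and> c \<le> n \<and> e a b c" for a b c
  proof (cases "0 < a \<and> c \<le> n")
    case True
    then show ?thesis using orientation_separated[OF assms, of a b c]
      by (auto simp: inversions_def orientation_def)
  next
    case False
    then show ?thesis by (auto simp: inversions_def separated_def)
  qed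
  then show ?thesis by auto
qed

lemma mem_inversions:
  "(a, b, c) \<in> inversions S \<longleftrightarrow> a < b \<and> b < c \<and> orientation S a b c"
  by (simp add: inversions_def orientation_def)

lemma separated_cong:
  assumes "\<And>a b c. 0 < a \<Longrightarrow> a < b \<Longrightarrow> b < c \<Longrightarrow> c \<le> n \<Longrightarrow> e a b c \<longleftrightarrow> e' a b c"
  shows "separated n e = separated n e'"
proof -
  have "lies_below n e A \<longleftrightarrow> lies_below n e' A" "lies_above n e A \<longleftrightarrow> lies_above n e' A" for A
    unfolding lies_below_def lies_above_def using assms by auto
  then show ?thesis unfolding separated_def by simp
qed

lemma consistent_cong:
  assumes "consistent n e"
    and "\<And>a b c. 0 < a \<Longrightarrow> a < b \<Longrightarrow> b < c \<Longrightarrow> c \<le> n \<Longrightarrow> e' a b c \<longleftrightarrow> e a b c"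
  shows "consistent n e'"
  unfolding consistent_def
proof (intro allI impI, elim conjE)
  fix a b c d assume "0 < a" "a < b" "b < c" "c < d" "d \<le> n"
  then show "mono4 (e' a b c) (e' a b d) (e' a c d) (e' b c d)"
    using consistentD[OF assms(1), of a b c d] assms(2)[of a b c] assms(2)[of a b d] assms(2)[of a c d]
      assms(2)[of b c d] by simp
qed

lemma max_strongly_separated_orientation:
  assumes "S \<in> max_strongly_separated_in n C"
  shows "S \<subseteq> C" "consistent n (orientation S)" "S = separated n (orientation S)"
proof -
  obtain e where e: "S \<subseteq> C" "consistent n e" "S = separated n e"
    using assms unfolding max_strongly_separated_iff by blast
  have "orientation S a b c \<longleftrightarrow> e a b c" if "0 < a" "a < b" "b < c" "c \<le> n" for a b c
    using orientation_separated[OF e(2) that] e(3) by simp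
  then show "S \<subseteq> C" "consistent n (orientation S)" "S = separated n (orientation S)"
    using e consistent_cong[of n e "orientation S"] separated_cong[of n "orientation S" e] by simp_all
qed

lemma inj_on_inversions: "inj_on inversions (max_strongly_separated_in n C)"
proof (rule inj_onI)
  fix S T assume S: "S \<in> max_strongly_separated_in n C" and T: "T \<in> max_strongly_separated_in n C"
    and eq: "inversions S = inversions T"
  have "orientation S a b c \<longleftrightarrow> orientation T a b c" if "0 < a" "a < b" "b < c" "c \<le> n" for a b c
    using mem_inversions[of a b c S] mem_inversions[of a b c T] eq that by simp
  then show "S = T"
    using max_strongly_separated_orientation(3)[OF S] max_strongly_separated_orientation(3)[OF T]
      separated_cong[of n "orientation S" "orientation T"] by simp
qed

lemma maximal_chord_separatedD:
  assumes "maximal_chord_separated_collection n C"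
  shows "C \<subseteq> Pow {1..n}" "chordal C"
    and "\<And>Z. Z \<subseteq> {1..n} \<Longrightarrow> (\<And>A. A \<in> C \<Longrightarrow> surrounds A Z \<Longrightarrow> \<not> surrounds Z A) \<Longrightarrow> Z \<in> C"
proof -
  show C: "C \<subseteq> Pow {1..n}" "chordal C"
    using assms unfolding maximal_chord_separated_collection_def chord_separated_collection_iff by auto
  fix Z assume Z: "Z \<subseteq> {1..n}" "\<And>A. A \<in> C \<Longrightarrow> surrounds A Z \<Longrightarrow> \<not> surrounds Z A"
  have "\<not> surrounds Z Z" unfolding surrounds_def by blast
  then have "chordal (insert Z C)" using C(2) Z(2) unfolding chordal_def by blast
  then have "chord_separated_collection n (insert Z C)"
    using C(1) Z(1) unfolding chord_separated_collection_iff by blast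
  then have "insert Z C = C" using assms unfolding maximal_chord_separated_collection_def by blast
  then show "Z \<in> C" by blast
qed

lemma max_strongly_separated_comparable:
  assumes "C \<subseteq> Pow {1..n}" "chordal C" "S \<in> max_strongly_separated_in n C" "A \<in> C"
  shows "lies_below n (orientation S) A \<or> lies_above n (orientation S) A"
proof (rule lies_below_or_above)
  show "consistent n (orientation S)" by (rule max_strongly_separated_orientation(2)[OF assms(3)])
  show "A \<subseteq> {1..n}" using assms by blast
  fix B assume "B \<in> separated n (orientation S)" "surrounds A B"
  moreover have "separated n (orientation S) \<subseteq> C" using max_strongly_separated_orientation[OF assms(3)] by simp
  ultimately show "\<not> surrounds B A" using assms(2,4) unfolding chordal_def by blast
qed

lemma max_strongly_separated_memD:
  assumes "S \<in> max_strongly_separated_in n C" "A \<in> S"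
  shows "lies_below n (orientation S) A" "lies_above n (orientation S) A" "A \<subseteq> {1..n}" "A \<in> C"
  using assms max_strongly_separated_orientation[OF assms(1)] by (auto simp: separated_def)

lemma orientation_realizes_not:
  assumes "S \<in> max_strongly_separated_in n C" "0 < a" "a < b" "b < c" "c \<le> n" "\<not> orientation S a b c"
  shows "\<exists>B\<in>S. a \<notin> B \<and> b \<in> B \<and> c \<notin> B"
  using separated_realizes(2)[OF max_strongly_separated_orientation(2)[OF assms(1)] assms(2-)]
    max_strongly_separated_orientation(3)[OF assms(1)] by simp

lemma inversions_range:
  assumes "S \<in> max_strongly_separated_in n C" "(a, b, c) \<in> inversions S"
  shows "0 < a" "a < b" "b < c" "c \<le> n"
  using assms(2) max_strongly_separated_memD(3)[OF assms(1)] unfolding inversions_def by fastforce+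

lemma finite_max_strongly_separated: "S \<in> max_strongly_separated_in n C \<Longrightarrow> finite S"
  unfolding max_strongly_separated_iff using finite_separated by blast

lemma card_max_strongly_separated: "S \<in> max_strongly_separated_in n C \<Longrightarrow> card S = Suc (\<Sum>{1..n})"
  unfolding max_strongly_separated_iff using card_separated by blast

lemma exists_meet_and_join:
  assumes C: "C \<subseteq> Pow {1..n}" "chordal C"
    and S: "S \<in> max_strongly_separated_in n C" and T: "T \<in> max_strongly_separated_in n C"
  shows "\<exists>D\<in>max_strongly_separated_in n C. inversions D = inversions S \<inter> inversions T"
    and "\<exists>U\<in>max_strongly_separated_in n C. inversions U = inversions S \<union> inversions T"
proof -
  let ?M = "max_strongly_separated_in n C" and ?s = "orientation S" and ?t = "orientation T"
  define D where "D = {A \<in> S \<union> T. lies_below n ?s A \<and> lies_below n ?t A}"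
  define U where "U = {A \<in> S \<union> T. lies_above n ?s A \<and> lies_above n ?t A}"
  note mS = max_strongly_separated_memD[OF S] and mT = max_strongly_separated_memD[OF T]
  have sub: "A \<subseteq> {1..n}" if "A \<in> S \<union> T" for A using that mS(3) mT(3) by blast
  have un: "D \<union> U = S \<union> T"
  proof
    show "D \<union> U \<subseteq> S \<union> T" unfolding D_def U_def by blast
    show "S \<union> T \<subseteq> D \<union> U"
    proof
      fix A assume A: "A \<in> S \<union> T"
      then have "A \<in> C" using mS(4) mT(4) by blast
      then have "lies_below n ?s A \<or> lies_above n ?s A" "lies_below n ?t A \<or> lies_above n ?t A"
        using max_strongly_separated_comparable[OF C S] max_strongly_separated_comparable[OF C T] by blast+
      then show "A \<in> D \<union> U" using A mS(1,2) mT(1,2) unfolding D_def U_def by auto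
    qed
  qed
  have int: "S \<inter> T \<subseteq> D \<inter> U" using mS(1,2) mT(1,2) unfolding D_def U_def by blast
  have ssD: "strongly_separated_collection n D"
    unfolding strongly_separated_collection_iff
  proof (intro conjI ballI)
    show "D \<subseteq> Pow {1..n}" using sub unfolding D_def by blast
    fix A B assume "A \<in> D" "B \<in> D"
    \<comment> \<open>\<open>B\<close> comes from \<open>S\<close> or from \<open>T\<close> and lies
      above the orientation of that collection, while \<open>A\<close> lies below both.\<close>
    then show "\<not> surrounds A B"
      using separated_not_surrounds[of n ?s A B] separated_not_surrounds[of n ?t A B] mS(2) mT(2) sub
      unfolding D_def by blast
  qed
  have ssU: "strongly_separated_collection n U"
    unfolding strongly_separated_collection_iff
  proof (intro conjI ballI)
    show "U \<subseteq> Pow {1..n}" using sub unfolding U_def by blast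
    fix A B assume "A \<in> U" "B \<in> U"
    then show "\<not> surrounds A B"
      using separated_not_surrounds[of n ?s A B] separated_not_surrounds[of n ?t A B] mS(1) mT(1) sub
      unfolding U_def by blast
  qed
  have fin: "finite S" "finite T" "finite D" "finite U"
  proof -
    show ST: "finite S" "finite T"
      using finite_max_strongly_separated[OF S] finite_max_strongly_separated[OF T] .
    show "finite D" "finite U" using finite_subset[OF _ finite_UnI[OF ST]] un by blast+
  qed
  have card: "card S = Suc (\<Sum>{1..n})" "card T = Suc (\<Sum>{1..n})"
    using card_max_strongly_separated[OF S] card_max_strongly_separated[OF T] .
  \<comment> \<open>\<open>D\<close> and \<open>U\<close> together cover \<open>S\<close> and
    \<open>T\<close>, and every common member of \<open>S\<close> and \<open>T\<close> is counted
    twice. So their sizes add up to at least twice the maximum, which neither exceeds.\<close>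
  have "card S + card T = card (S \<union> T) + card (S \<inter> T)" by (rule card_Un_Int[OF fin(1,2)])
  also have "\<dots> \<le> card (D \<union> U) + card (D \<inter> U)"
    unfolding un using card_mono[OF _ int] fin by simp
  also have "\<dots> = card D + card U" by (rule card_Un_Int[OF fin(3,4), symmetric])
  finally have "card D = Suc (\<Sum>{1..n})" "card U = Suc (\<Sum>{1..n})"
    using card card_strongly_separated[OF ssD] card_strongly_separated[OF ssU] by linarith+
  moreover have "D \<subseteq> C" "U \<subseteq> C" using mS(4) mT(4) unfolding D_def U_def by blast+
  ultimately have D: "D \<in> ?M" and U: "U \<in> ?M"
    using max_strongly_separated_by_card ssD ssU by blast+
  have "inversions D = inversions S \<inter> inversions T"
  proof (intro equalityI subrelI subsetI)
    fix t assume t: "t \<in> inversions D"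
    obtain a b c where abc: "t = (a, b, c)" by (cases t) auto
    then obtain A where A: "A \<in> D" "a \<in> A" "b \<notin> A" "c \<in> A" using t unfolding inversions_def by blast
    have r: "0 < a" "a < b" "b < c" "c \<le> n" using inversions_range[OF D] t abc by auto
    have "?s a b c" "?t a b c"
      using A lies_belowD[of n ?s A, OF _ r] lies_belowD[of n ?t A, OF _ r] unfolding D_def by blast+
    then show "t \<in> inversions S \<inter> inversions T" using r abc by (simp add: mem_inversions)
  next
    fix t assume t: "t \<in> inversions S \<inter> inversions T"
    obtain a b c where abc: "t = (a, b, c)" by (cases t) auto
    have r: "0 < a" "a < b" "b < c" "c \<le> n" using inversions_range[OF S] t abc by auto
    have st: "?s a b c" "?t a b c" using t abc by (auto simp: mem_inversions)
    have "orientation D a b c"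
    proof (rule ccontr)
      assume "\<not> orientation D a b c"
      \<comment> \<open>\<open>B\<close> is a member of \<open>S\<close> or of \<open>T\<close>, and
        there its pattern out-in-out contradicts the reversal of the triple.\<close>
      then obtain B where "B \<in> D" "a \<notin> B" "b \<in> B" "c \<notin> B" using orientation_realizes_not[OF D r] by blast
      then show False using mS(2)[of B] mT(2)[of B] st lies_aboveD[of n ?s B, OF _ r] lies_aboveD[of n ?t B, OF _ r]
        unfolding D_def by blast
    qed
    then show "t \<in> inversions D" using r abc by (simp add: mem_inversions)
  qed
  then show "\<exists>D\<in>?M. inversions D = inversions S \<inter> inversions T" using D by blast
  have "inversions U = inversions S \<union> inversions T"
  proof (intro equalityI subsetI)
    fix t assume t: "t \<in> inversions U"
    then show "t \<in> inversions S \<union> inversions T" unfolding inversions_def U_def by blast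
  next
    fix t assume t: "t \<in> inversions S \<union> inversions T"
    obtain a b c where abc: "t = (a, b, c)" by (cases t) auto
    have r: "0 < a" "a < b" "b < c" "c \<le> n" using inversions_range[OF S] inversions_range[OF T] t abc by auto
    have st: "?s a b c \<or> ?t a b c" using t abc by (auto simp: mem_inversions)
    have "orientation U a b c"
    proof (rule ccontr)
      assume "\<not> orientation U a b c"
      then obtain B where "B \<in> U" "a \<notin> B" "b \<in> B" "c \<notin> B" using orientation_realizes_not[OF U r] by blast
      then show False using st lies_aboveD[of n ?s B, OF _ r] lies_aboveD[of n ?t B, OF _ r]
        unfolding U_def by blast
    qed
    then show "t \<in> inversions U" using r abc by (simp add: mem_inversions)
  qed
  then show "\<exists>U\<in>?M. inversions U = inversions S \<union> inversions T" using U by blast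
qed

section \<open>The two constant orientations: intervals and co-intervals\<close>

lemma intervals_eq_separated: "intervals n = separated n (\<lambda>_ _ _. False)"
proof (intro equalityI subsetI)
  fix A assume "A \<in> intervals n"
  then show "A \<in> separated n (\<lambda>_ _ _. False)"
    by (auto simp: intervals_def separated_def lies_below_def lies_above_def)
next
  fix A assume A: "A \<in> separated n (\<lambda>_ _ _. False)"
  then have sub: "A \<subseteq> {1..n}" and lb: "lies_below n (\<lambda>_ _ _. False) A" by (simp_all add: separated_def)
  have conv: "b \<in> A" if "a \<in> A" "c \<in> A" "a < b" "b < c" for a b c
  proof -
    have "0 < a" "c \<le> n" using sub that by auto
    then show ?thesis using lies_belowD[OF lb, of a b c] that by blast
  qed
  show "A \<in> intervals n"
  proof (cases "A = {}")
    case False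
    have fin: "finite A" using sub by (rule finite_subset) simp
    have "A = {Min A..Max A}"
    proof
      show "A \<subseteq> {Min A..Max A}" using fin by auto
      show "{Min A..Max A} \<subseteq> A"
      proof
        fix x assume "x \<in> {Min A..Max A}"
        then show "x \<in> A" using conv[OF Min_in[OF fin False] Max_in[OF fin False], of x] Min_in[OF fin False] Max_in[OF fin False]
          by (cases "x = Min A \<or> x = Max A") auto
      qed
    qed
    moreover have "1 \<le> Min A" "Min A \<le> Max A" "Max A \<le> n"
      using sub Min_in[OF fin False] Max_in[OF fin False] Min_le[OF fin] by auto
    ultimately show ?thesis unfolding intervals_def by blast
  qed (simp add: intervals_def)
qed

lemma co_intervals_eq_separated: "co_intervals n = separated n (\<lambda>_ _ _. True)"
proof (intro equalityI subsetI)
  fix A assume "A \<in> co_intervals n"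
  then obtain I where I: "I \<in> intervals n" "A = {1..n} - I" unfolding co_intervals_def by blast
  then show "A \<in> separated n (\<lambda>_ _ _. True)"
    using separated_complement[of I n "\<lambda>_ _ _. True"] by (simp add: intervals_eq_separated)
next
  fix A assume A: "A \<in> separated n (\<lambda>_ _ _. True)"
  then have "{1..n} - A \<in> intervals n"
    using separated_complement[of A n "\<lambda>_ _ _. False"] by (simp add: intervals_eq_separated)
  moreover have "A = {1..n} - ({1..n} - A)" using A by (auto simp: separated_def)
  ultimately show "A \<in> co_intervals n" unfolding co_intervals_def by blast
qed

text \<open>An interval surrounds no set, so it is chord separated from every set and a maximal
  \<open>C\<close> must contain it. Dually, a co-interval is surrounded by no set.\<close>

lemma intervals_max_strongly_separated:
  assumes "maximal_chord_separated_collection n C"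
  shows "intervals n \<in> max_strongly_separated_in n C"
proof -
  have "Z \<in> C" if Z: "Z \<in> intervals n" for Z
  proof (rule maximal_chord_separatedD(3)[OF assms])
    show "Z \<subseteq> {1..n}" using Z by (auto simp: intervals_eq_separated separated_def)
    fix A assume "A \<in> C"
    then have "A \<subseteq> {1..n}" using maximal_chord_separatedD(1)[OF assms] by blast
    moreover have "lies_above n (\<lambda>_ _ _. False) A" by (simp add: lies_above_def)
    ultimately show "\<not> surrounds Z A"
      using Z separated_not_surrounds[of n "\<lambda>_ _ _. False" Z A] by (simp add: intervals_eq_separated separated_def)
  qed
  moreover have "consistent n (\<lambda>_ _ _. False)" by (simp add: consistent_def mono4_def)
  ultimately show ?thesis unfolding max_strongly_separated_iff intervals_eq_separated by blast
qed

lemma co_intervals_max_strongly_separated: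
  assumes "maximal_chord_separated_collection n C"
  shows "co_intervals n \<in> max_strongly_separated_in n C"
proof -
  have "Z \<in> C" if Z: "Z \<in> co_intervals n" for Z
  proof (rule maximal_chord_separatedD(3)[OF assms])
    show Zn: "Z \<subseteq> {1..n}" using Z by (auto simp: co_intervals_eq_separated separated_def)
    fix A assume "A \<in> C" and s: "surrounds A Z"
    then have "A \<subseteq> {1..n}" using maximal_chord_separatedD(1)[OF assms] by blast
    moreover have "lies_below n (\<lambda>_ _ _. True) A" by (simp add: lies_below_def)
    ultimately have "\<not> surrounds A Z"
      using Z Zn separated_not_surrounds[of n "\<lambda>_ _ _. True" A Z] by (simp add: co_intervals_eq_separated separated_def)
    then show "\<not> surrounds Z A" using s by blast
  qed
  moreover have "consistent n (\<lambda>_ _ _. True)" by (simp add: consistent_def mono4_def)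
  ultimately show ?thesis unfolding max_strongly_separated_iff co_intervals_eq_separated by blast
qed

lemma inversions_intervals: "inversions (intervals n) = {}"
  using inversions_separated[of n "\<lambda>_ _ _. False"] by (simp add: intervals_eq_separated consistent_def mono4_def)

lemma inversions_co_intervals: "inversions (co_intervals n) = {(a, b, c). 0 < a \<and> a < b \<and> b < c \<and> c \<le> n}"
  using inversions_separated[of n "\<lambda>_ _ _. True"] by (simp add: co_intervals_eq_separated consistent_def mono4_def)

subsection \<open>Existence of flips between two orientations\<close>

definition raised :: "(nat \<Rightarrow> nat \<Rightarrow> nat \<Rightarrow> bool) \<Rightarrow> nat \<Rightarrow> nat \<Rightarrow> nat \<Rightarrow> nat \<Rightarrow> nat \<Rightarrow> nat \<Rightarrow> bool" where
  "raised e i j k = (\<lambda>a b c. e a b c \<or> (a = i \<and> b = j \<and> c = k))"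

definition dominated :: "nat \<Rightarrow> (nat \<Rightarrow> nat \<Rightarrow> nat \<Rightarrow> bool) \<Rightarrow> (nat \<Rightarrow> nat \<Rightarrow> nat \<Rightarrow> bool) \<Rightarrow> bool" where
  "dominated n e e' \<longleftrightarrow> (\<forall>a b c. 0 < a \<and> a < b \<and> b < c \<and> c \<le> n \<and> e a b c \<longrightarrow> e' a b c)"

lemma dominatedD: "dominated n e e' \<Longrightarrow> 0 < a \<Longrightarrow> a < b \<Longrightarrow> b < c \<Longrightarrow> c \<le> n \<Longrightarrow> e a b c \<Longrightarrow> e' a b c"
  unfolding dominated_def by blast

lemma dominatedI:
  "(\<And>a b c. 0 < a \<Longrightarrow> a < b \<Longrightarrow> b < c \<Longrightarrow> c \<le> n \<Longrightarrow> e a b c \<Longrightarrow> e' a b c) \<Longrightarrow> dominated n e e'"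
  unfolding dominated_def by blast

lemma dominated_refl: "dominated n e e"
  unfolding dominated_def by blast

lemma dominated_trans: "dominated n e e' \<Longrightarrow> dominated n e' e'' \<Longrightarrow> dominated n e e''"
  unfolding dominated_def by blast

lemma lies_below_dominated: "dominated n e e' \<Longrightarrow> lies_below n e A \<Longrightarrow> lies_below n e' A"
  unfolding dominated_def lies_below_def by blast

lemma lies_above_dominated: "dominated n e e' \<Longrightarrow> lies_above n e' A \<Longrightarrow> lies_above n e A"
  unfolding dominated_def lies_above_def by blast

lemma separated_dominated_antisym:
  assumes "dominated n e e'" "dominated n e' e"
  shows "separated n e = separated n e'"
  by (rule separated_cong) (use dominatedD[OF assms(1)] dominatedD[OF assms(2)] in blast)

text \<open>Otherwise the separation theorem would produce a collection containing \<open>A\<close> and \<open>B\<close>, strictly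
  between the two given ones.\<close>

lemma adjacent_surrounds:
  assumes con: "consistent n e" "consistent n e'" and dom: "dominated n e e'"
    and adj: "\<And>e''. consistent n e'' \<Longrightarrow> dominated n e e'' \<Longrightarrow> dominated n e'' e' \<Longrightarrow> dominated n e'' e \<or> dominated n e' e''"
    and A: "A \<in> separated n e'" "A \<notin> separated n e" and B: "B \<in> separated n e" "B \<notin> separated n e'"
  shows "surrounds A B"
proof (rule ccontr)
  assume AB: "\<not> surrounds A B"
  let ?W = "separated n e \<union> {A}" and ?U = "separated n e' \<union> {B}"
  have below: "lies_below n e X" "lies_below n e' X" "lies_above n e X" "X \<subseteq> {1..n}" if "X \<in> separated n e" for X
    using that lies_below_dominated[OF dom] by (auto simp: separated_def)
  have above: "lies_above n e' X" "lies_above n e X" "lies_below n e' X" "X \<subseteq> {1..n}" if "X \<in> separated n e'" for X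
    using that lies_above_dominated[OF dom] by (auto simp: separated_def)
  have cross: "\<not> surrounds X Y" if "X \<in> separated n e" "Y \<in> separated n e \<union> separated n e'" for X Y
    using that separated_not_surrounds[of n e X Y] below above by blast
  have cross': "\<not> surrounds X Y" if "X \<in> separated n e \<union> separated n e'" "Y \<in> separated n e'" for X Y
    using that separated_not_surrounds[of n e' X Y] below above by blast
  have "\<exists>e''. consistent n e'' \<and> (\<forall>X\<in>?W. lies_below n e'' X) \<and> (\<forall>Y\<in>?U. lies_above n e'' Y)"
  proof (rule separating_orientation)
    show "?W \<subseteq> Pow {1..n}" "?U \<subseteq> Pow {1..n}" using A B by (auto simp: separated_def)
    have self: "\<not> surrounds X X" for X unfolding surrounds_def by blast
    show "chordal ?W" unfolding chordal_def using cross[of _ A] cross A self by blast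
    show "chordal ?U" unfolding chordal_def using cross' B self by blast
    show "\<not> surrounds X Y" if "X \<in> ?W" "Y \<in> ?U" for X Y
      using that cross cross' AB A B by blast
  qed
  then obtain f where f: "consistent n f" "\<forall>X\<in>?W. lies_below n f X" "\<forall>Y\<in>?U. lies_above n f Y" by (elim exE conjE)
  have "dominated n e f"
  proof (rule dominatedI)
    fix a b c assume r: "0 < a" "a < b" "b < c" "c \<le> n" and "e a b c"
    then obtain X where "X \<in> separated n e" "a \<in> X" "b \<notin> X" "c \<in> X"
      using separated_realizes(1)[OF con(1) r] by blast
    then show "f a b c" using lies_belowD[OF _ r, of f X] f(2) by blast
  qed
  moreover have "dominated n f e'"
  proof (rule dominatedI)
    fix a b c assume r: "0 < a" "a < b" "b < c" "c \<le> n" and "f a b c"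
    show "e' a b c"
    proof (rule ccontr)
      assume "\<not> e' a b c"
      then obtain Y where "Y \<in> separated n e'" "a \<notin> Y" "b \<in> Y" "c \<notin> Y"
        using separated_realizes(2)[OF con(2) r] by blast
      then show False using lies_aboveD[OF _ r, of f Y] f(3) \<open>f a b c\<close> by blast
    qed
  qed
  ultimately have "dominated n f e \<or> dominated n e' f" "dominated n e f" "dominated n f e'" using adj f(1) by blast+
  then have "separated n f = separated n e \<or> separated n f = separated n e'"
    using separated_dominated_antisym by blast
  moreover have "A \<in> separated n f" using f A by (simp add: separated_def)
  moreover have "B \<in> separated n f" using f B by (simp add: separated_def)
  ultimately show False using A B by blast
qed

text \<open>Otherwise \<open>n\<close> would be a third element, after \<open>j\<close> and
  \<open>k\<close>, by which \<open>B\<close> surrounds \<open>A\<close> in return.\<close>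

lemma surrounds_last:
  assumes "surrounds A B" "\<not> surrounds B A" "A \<subseteq> {1..n}" "n \<in> B"
  shows "n \<in> A"
proof (rule ccontr)
  assume nA: "n \<notin> A"
  obtain i j k where *: "i < j" "j < k" "i \<in> A" "i \<notin> B" "j \<in> B" "j \<notin> A" "k \<in> A" "k \<notin> B"
    using assms(1) unfolding surrounds_def by blast
  have "k \<le> n" "k \<noteq> n" using * assms(3) nA by auto
  then have "surrounds B A" using surroundsI[of j k n B A] * assms(4) nA by simp
  then show False using assms(2) by blast
qed

lemma mono4_iff:
  "mono4 p q r s \<longleftrightarrow> (p \<and> r \<longrightarrow> q) \<and> (\<not> p \<and> \<not> r \<longrightarrow> \<not> q) \<and> (q \<and> s \<longrightarrow> r) \<and> (\<not> q \<and> \<not> s \<longrightarrow> \<not> r) \<and>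
    (p \<and> s \<longrightarrow> q \<and> r) \<and> (\<not> p \<and> \<not> s \<longrightarrow> \<not> q \<and> \<not> r)"
  unfolding mono4_def by blast

text \<open>The hypothesis \<open>m\<close> treats the packet of \<open>i, j, k\<close> and the new
  element, the only packet with the new element in which a value changes.\<close>

lemma consistent_Suc_raised:
  assumes con: "consistent (Suc n) e" and rc: "consistent n (raised e i j k)"
    and k: "i < j" "j < k" "k \<le> n" and m: "mono4 True (e i j (Suc n)) (e i k (Suc n)) (e j k (Suc n))"
  shows "consistent (Suc n) (raised e i j k)"
  unfolding consistent_def
proof (intro allI impI, elim conjE)
  fix a b c d assume *: "0 < a" "a < b" "b < c" "c < d" "d \<le> Suc n"
  show "mono4 (raised e i j k a b c) (raised e i j k a b d) (raised e i j k a c d) (raised e i j k b c d)"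
  proof (cases "d \<le> n")
    case True
    then show ?thesis using consistentD[OF rc, of a b c d] * by simp
  next
    case False
    then have d: "d = Suc n" "d \<noteq> k" using * k by auto
    show ?thesis
    proof (cases "a = i \<and> b = j \<and> c = k")
      case True
      then show ?thesis using m d by (simp add: raised_def)
    next
      case False
      then have "raised e i j k a b c \<longleftrightarrow> e a b c" by (auto simp: raised_def)
      moreover have "raised e i j k x y d \<longleftrightarrow> e x y d" for x y using d by (simp add: raised_def)
      ultimately show ?thesis using consistentD[OF con, of a b c d] * by simp
    qed
  qed
qed

lemma initial_segment_downsets:
  assumes "consistent (Suc n) e" "j \<in> {1..n}"
  shows "{y \<in> {1..n}. precedes e (Suc n) y j} \<in> downsets n e"
    and "{y \<in> {1..n}. y = j \<or> precedes e (Suc n) y j} \<in> downsets n e"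
proof -
  have tr: "precedes e (Suc n) y j" if "precedes e (Suc n) y x" "precedes e (Suc n) x j" "x \<in> {1..n}" "y \<in> {1..n}" for x y
  proof -
    have "y \<noteq> j" using that precedes_total[of x y e "Suc n"] by (auto simp: precedes_def split: if_splits)
    then show ?thesis using precedes_trans[OF assms(1) that(1,2)] that assms(2) by blast
  qed
  show "{y \<in> {1..n}. precedes e (Suc n) y j} \<in> downsets n e"
    unfolding downsets_def using tr by blast
  show "{y \<in> {1..n}. y = j \<or> precedes e (Suc n) y j} \<in> downsets n e"
    unfolding downsets_def using tr by blast
qed

definition raise_exists :: "nat \<Rightarrow> bool" where
  "raise_exists n \<longleftrightarrow> (\<forall>e e'. consistent n e \<and> consistent n e' \<and> dominated n e e' \<and> \<not> dominated n e' e \<longrightarrow>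
     (\<exists>i j k. 0 < i \<and> i < j \<and> j < k \<and> k \<le> n \<and> \<not> e i j k \<and> e' i j k \<and> consistent n (raised e i j k)))"

lemma raise_existsD:
  assumes "raise_exists n" "consistent n e" "consistent n e'" "dominated n e e'" "\<not> dominated n e' e"
  obtains i j k where "0 < i" "i < j" "j < k" "k \<le> n" "\<not> e i j k" "e' i j k" "consistent n (raised e i j k)"
  using assms unfolding raise_exists_def by blast

lemma dominated_mono: "dominated n e e' \<Longrightarrow> m \<le> n \<Longrightarrow> dominated m e e'"
  unfolding dominated_def by (meson order_trans)

text \<open>By \<open>adjacent_surrounds\<close> and \<open>surrounds_last\<close>, either no set that is lost contains the last element, or all sets
  that are gained do. In the first case a raise found after deleting the last element can only be
  blocked by an initial segment with the last element added, which would be lost; in the second case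
  the complementary argument applies to \<open>e'\<close>.\<close>

lemma raise_adjacent_without_last:
  assumes IH: "raise_exists n"
    and con: "consistent (Suc n) e" "consistent (Suc n) e'" and dom: "dominated (Suc n) e e'"
    and adj: "\<And>e''. consistent (Suc n) e'' \<Longrightarrow> dominated (Suc n) e e'' \<Longrightarrow> dominated (Suc n) e'' e' \<Longrightarrow>
      dominated (Suc n) e'' e \<or> dominated (Suc n) e' e''"
    and diff: "\<not> dominated n e' e"
  shows "\<exists>i j k. 0 < i \<and> i < j \<and> j < k \<and> k \<le> Suc n \<and> \<not> e i j k \<and> e' i j k \<and> consistent (Suc n) (raised e i j k)"
proof -
  let ?z = "Suc n"
  have conn: "consistent n e" "consistent n e'" "dominated n e e'"
    using consistent_mono[OF con(1)] consistent_mono[OF con(2)] dominated_mono[OF dom] by auto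
  have sur: "\<not> surrounds B A" if "A \<in> separated ?z e'" "B \<in> separated ?z e" for A B
    using separated_not_surrounds[of ?z e' B A] lies_below_dominated[OF dom] that by (auto simp: separated_def)
  have imp: "?z \<in> A" if "A \<in> separated ?z e'" "A \<notin> separated ?z e" "B \<in> separated ?z e" "B \<notin> separated ?z e'" "?z \<in> B" for A B
    using surrounds_last[OF adjacent_surrounds[OF con dom adj that(1-4)] sur[OF that(1,3)] _ that(5)] that(1)
    by (auto simp: separated_def)
  then consider (low) "\<And>B. B \<in> separated ?z e \<Longrightarrow> B \<notin> separated ?z e' \<Longrightarrow> ?z \<notin> B"
    | (high) "\<And>A. A \<in> separated ?z e' \<Longrightarrow> A \<notin> separated ?z e \<Longrightarrow> ?z \<in> A" by blast
  then show ?thesis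
  proof cases
    case low
    obtain i j k where t: "0 < i" "i < j" "j < k" "k \<le> n" "\<not> e i j k" "e' i j k" "consistent n (raised e i j k)"
      using raise_existsD[OF IH conn diff] by blast
    have "mono4 True (e i j ?z) (e i k ?z) (e j k ?z)"
    proof (rule ccontr)
      assume bad: "\<not> mono4 True (e i j ?z) (e i k ?z) (e j k ?z)"
      have "mono4 False (e i j ?z) (e i k ?z) (e j k ?z)" using consistentD[OF con(1), of i j k ?z] t by simp
      \<comment> \<open>A monotone sequence that starts with false and breaks when this entry
        becomes true has false in the second and true in the last place. So \<open>j\<close> is
        crossed before \<open>i\<close> and \<open>k\<close>, and the segment ending with
        \<open>j\<close> is the blocking set.\<close>
      then have first: "\<not> e i j ?z" "e j k ?z" using bad unfolding mono4_iff by blast+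
      let ?Q = "{y \<in> {1..n}. y = j \<or> precedes e ?z y j}"
      have "?Q \<in> high_part n e" using initial_segment_downsets(2)[OF con(1), of j] low_high_Int[OF con(1)] t by auto
      then have "insert ?z ?Q \<in> separated ?z e" unfolding high_part_iff by simp
      moreover have "insert ?z ?Q \<notin> separated ?z e'"
      proof
        assume "insert ?z ?Q \<in> separated ?z e'"
        then show False using lies_aboveD[of ?z e' "insert ?z ?Q" i j k] first t
          by (auto simp: separated_def precedes_def)
      qed
      ultimately show False using low by blast
    qed
    then have "consistent ?z (raised e i j k)" by (intro consistent_Suc_raised con t)
    then show ?thesis using t by (intro exI[of _ i] exI[of _ j] exI[of _ k]) simp
  next
    case high
    let ?e = "\<lambda>a b c. \<not> e a b c" and ?e' = "\<lambda>a b c. \<not> e' a b c"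
    have d: "dominated n ?e' ?e" "\<not> dominated n ?e ?e'" using conn(3) diff unfolding dominated_def by blast+
    \<comment> \<open>A raise of the negation of \<open>e'\<close> towards the negation of
      \<open>e\<close> amounts to lowering \<open>e'\<close> towards \<open>e\<close>.\<close>
    obtain i j k where "0 < i" "i < j" "j < k" "k \<le> n" "\<not> ?e' i j k" "?e i j k" "consistent n (raised ?e' i j k)"
      by (rule raise_existsD[OF IH consistent_negate[OF conn(2)] consistent_negate[OF conn(1)] d])
    then have t: "0 < i" "i < j" "j < k" "k \<le> n" "e' i j k" "\<not> e i j k" "consistent n (raised ?e' i j k)" by simp_all
    have "mono4 True (?e' i j ?z) (?e' i k ?z) (?e' j k ?z)"
    proof (rule ccontr)
      assume bad: "\<not> mono4 True (?e' i j ?z) (?e' i k ?z) (?e' j k ?z)"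
      have "mono4 True (e' i j ?z) (e' i k ?z) (e' j k ?z)" using consistentD[OF con(2), of i j k ?z] t by simp
      then have last: "e' i j ?z" "\<not> e' j k ?z" using bad unfolding mono4_iff by blast+
      let ?Q = "{y \<in> {1..n}. precedes e' ?z y j}"
      have "?Q \<in> low_part n e'" using initial_segment_downsets(1)[OF con(2), of j] low_high_Int[OF con(2)] t by auto
      then have Q: "?Q \<in> separated ?z e'" "?z \<notin> ?Q" unfolding low_part_iff by simp_all
      moreover have "?Q \<notin> separated ?z e"
      proof
        assume "?Q \<in> separated ?z e"
        then show False using lies_belowD[of ?z e ?Q i j k] last t
          by (auto simp: separated_def precedes_def)
      qed
      ultimately show False using high by blast
    qed
    then have "consistent ?z (raised ?e' i j k)" by (intro consistent_Suc_raised consistent_negate con t)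
    then have cl: "consistent ?z (\<lambda>a b c. \<not> raised ?e' i j k a b c)" by (rule consistent_negate)
    have "dominated ?z e (\<lambda>a b c. \<not> raised ?e' i j k a b c)"
      using dominatedD[OF dom] t unfolding dominated_def raised_def by blast
    moreover have "dominated ?z (\<lambda>a b c. \<not> raised ?e' i j k a b c) e'"
      unfolding dominated_def raised_def by blast
    moreover have "\<not> dominated ?z e' (\<lambda>a b c. \<not> raised ?e' i j k a b c)"
      using dominatedD[of ?z e' "\<lambda>a b c. \<not> raised ?e' i j k a b c" i j k] t by (auto simp: raised_def)
    ultimately have "dominated ?z (\<lambda>a b c. \<not> raised ?e' i j k a b c) e" using adj[OF cl] by blast
    \<comment> \<open>The lowered \<open>e'\<close> lies between \<open>e\<close> and
      \<open>e'\<close> and differs from \<open>e'\<close>. Since nothing is strictly between, it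
      agrees with \<open>e\<close>, so raising \<open>e\<close> at the same triple gives
      \<open>e'\<close>.\<close>
    then have eq: "raised e i j k a b c \<longleftrightarrow> e' a b c" if "0 < a" "a < b" "b < c" "c \<le> ?z" for a b c
      using that dominatedD[OF dom that] t unfolding dominated_def raised_def by blast
    have "consistent ?z (raised e i j k)" by (rule consistent_cong[OF con(2) eq])
    then show ?thesis using t by (intro exI[of _ i] exI[of _ j] exI[of _ k]) simp
  qed
qed

text \<open>The relabelling of \<open>x\<close> as \<open>n + 1 - x\<close> turns deletion of the
  first element into deletion of the last. It reverses the sequence of values in each packet, which
  keeps it monotone.\<close>

definition mirrored :: "nat \<Rightarrow> (nat \<Rightarrow> nat \<Rightarrow> nat \<Rightarrow> bool) \<Rightarrow> nat \<Rightarrow> nat \<Rightarrow> nat \<Rightarrow> bool" where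
  "mirrored n e a b c = e (Suc n - c) (Suc n - b) (Suc n - a)"

lemma mirrored_mirrored: "c \<le> n \<Longrightarrow> a \<le> n \<Longrightarrow> b \<le> n \<Longrightarrow> mirrored n (mirrored n e) a b c = e a b c"
  unfolding mirrored_def by simp

lemma consistent_mirrored:
  assumes "consistent n e"
  shows "consistent n (mirrored n e)"
  unfolding consistent_def
proof (intro allI impI, elim conjE)
  fix a b c d assume "0 < a" "a < b" "b < c" "c < d" "d \<le> n"
  then have "mono4 (e (Suc n - d) (Suc n - c) (Suc n - b)) (e (Suc n - d) (Suc n - c) (Suc n - a))
      (e (Suc n - d) (Suc n - b) (Suc n - a)) (e (Suc n - c) (Suc n - b) (Suc n - a))"
    by (intro consistentD[OF assms]) auto
  then show "mono4 (mirrored n e a b c) (mirrored n e a b d) (mirrored n e a c d) (mirrored n e b c d)"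
    unfolding mirrored_def mono4_def by blast
qed

lemma dominated_mirrored:
  assumes "dominated n e (mirrored n e')"
  shows "dominated n (mirrored n e) e'"
proof (rule dominatedI)
  fix a b c assume *: "0 < a" "a < b" "b < c" "c \<le> n" "mirrored n e a b c"
  then have "mirrored n e' (Suc n - c) (Suc n - b) (Suc n - a)"
    by (intro dominatedD[OF assms]) (auto simp: mirrored_def)
  then show "e' a b c" using * by (simp add: mirrored_def)
qed

lemma dominated_mirrored':
  assumes "dominated n (mirrored n e) e'"
  shows "dominated n e (mirrored n e')"
proof (rule dominatedI)
  fix a b c assume *: "0 < a" "a < b" "b < c" "c \<le> n" "e a b c"
  then have "mirrored n e (Suc n - c) (Suc n - b) (Suc n - a)" by (simp add: mirrored_def)
  then have "e' (Suc n - c) (Suc n - b) (Suc n - a)"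
    using * by (intro dominatedD[OF assms]) auto
  then show "mirrored n e' a b c" by (simp add: mirrored_def)
qed

lemma dominated_mirrored_iff: "dominated n (mirrored n e) e' \<longleftrightarrow> dominated n e (mirrored n e')"
  using dominated_mirrored dominated_mirrored' by blast

lemma dominated_mirrored_mirrored: "dominated n (mirrored n e) (mirrored n e') \<longleftrightarrow> dominated n e e'"
proof -
  have "dominated n e (mirrored n (mirrored n e')) \<longleftrightarrow> dominated n e e'"
    unfolding dominated_def using mirrored_mirrored by auto
  then show ?thesis using dominated_mirrored_iff by simp
qed

text \<open>All triples to be raised are \<open>(1, x, n)\<close>; one takes the first such \<open>x\<close> in the order in which the
  line 1 crosses the others.\<close>

lemma raise_extreme:
  assumes con: "consistent n e" "consistent n e'" and dom: "dominated n e e'"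
    and ex: "\<And>a b c. 0 < a \<Longrightarrow> a < b \<Longrightarrow> b < c \<Longrightarrow> c \<le> n \<Longrightarrow> e' a b c \<Longrightarrow> \<not> e a b c \<Longrightarrow> a = 1 \<and> c = n"
    and diff: "\<not> dominated n e' e"
  shows "\<exists>i j k. 0 < i \<and> i < j \<and> j < k \<and> k \<le> n \<and> \<not> e i j k \<and> e' i j k \<and> consistent n (raised e i j k)"
proof -
  let ?X = "{x. 1 < x \<and> x < n \<and> e' 1 x n \<and> \<not> e 1 x n}"
  let ?r = "\<lambda>p x. p \<noteq> x \<and> (if p < x then e 1 p x else \<not> e 1 x p)"
  have fin: "finite ?X" by simp
  obtain a b c where "0 < a" "a < b" "b < c" "c \<le> n" "e' a b c" "\<not> e a b c"
    using diff unfolding dominated_def by blast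
  then have ne: "?X \<noteq> {}" using ex[of a b c] by auto
  have as: "asymp_on ?X ?r" by (rule asymp_onI) (auto split: if_splits)
  have tr3: "e 1 x y \<Longrightarrow> e 1 y z \<Longrightarrow> e 1 x z" "\<not> e 1 x y \<Longrightarrow> \<not> e 1 y z \<Longrightarrow> \<not> e 1 x z"
    if "1 < x" "x < y" "y < z" "z < n" for x y z
    using consistentD[OF con(1), of 1 x y z] that unfolding mono4_def by auto
  have tr: "transp_on ?X ?r"
  proof (rule transp_onI)
    fix x y z assume X: "x \<in> ?X" "y \<in> ?X" "z \<in> ?X" and r: "?r x y" "?r y z"
    have "x \<noteq> z" using r by (auto split: if_splits)
    then consider "x < y" "y < z" | "x < z" "z < y" | "y < x" "x < z" | "y < z" "z < x" | "z < x" "x < y" | "z < y" "y < x"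
      using r by linarith
    then show "?r x z"
    proof cases
      case 1 then show ?thesis using tr3[of x y z] X r by simp
    next
      case 2 then show ?thesis using tr3[of x z y] X r by auto
    next
      case 3 then show ?thesis using tr3[of y x z] X r by auto
    next
      case 4 then show ?thesis using tr3[of y z x] X r by auto
    next
      case 5 then show ?thesis using tr3[of z x y] X r by auto
    next
      case 6 then show ?thesis using tr3[of z y x] X r by auto
    qed
  qed
  obtain x where x: "x \<in> ?X" and min: "\<forall>p\<in>?X. p \<noteq> x \<longrightarrow> \<not> ?r p x"
    using Finite_Set.bex_min_element[OF fin as tr ne] by (elim bexE)
  have "consistent n (raised e 1 x n)"
    unfolding consistent_def
  proof (intro allI impI, elim conjE)
    fix a b c d assume *: "0 < a" "a < b" "b < c" "c < d" "d \<le> n"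
    have m: "mono4 (e a b c) (e a b d) (e a c d) (e b c d)" using consistentD[OF con(1)] * by blast
    have m': "mono4 (e' a b c) (e' a b d) (e' a c d) (e' b c d)" using consistentD[OF con(2)] * by blast
    have r1: "raised e 1 x n a b c \<longleftrightarrow> e a b c" "raised e 1 x n b c d \<longleftrightarrow> e b c d"
      using * by (auto simp: raised_def)
    \<comment> \<open>These two triples do not contain both 1 and \<open>n\<close>, so
      \<open>e\<close> and \<open>e'\<close> agree on them.\<close>
    have same: "e' a b c \<longleftrightarrow> e a b c" "e' b c d \<longleftrightarrow> e b c d"
      using ex[of a b c] ex[of b c d] dominatedD[OF dom, of a b c] dominatedD[OF dom, of b c d] * by auto
    show "mono4 (raised e 1 x n a b c) (raised e 1 x n a b d) (raised e 1 x n a c d) (raised e 1 x n b c d)"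
    proof (cases "a = 1 \<and> d = n \<and> (x = b \<or> x = c)")
      case False
      then have "raised e 1 x n a b d \<longleftrightarrow> e a b d" "raised e 1 x n a c d \<longleftrightarrow> e a c d" by (auto simp: raised_def)
      then show ?thesis using m r1 by simp
    next
      case True
      then have ad: "a = 1" "d = n" by auto
      from True consider "x = b" | "x = c" by blast
      then show ?thesis
      proof cases
        case 1
        have rr: "raised e 1 x n a b d" "raised e 1 x n a c d \<longleftrightarrow> e a c d" using 1 ad * by (auto simp: raised_def)
        have e: "\<not> e a b d" "e' a b d" using x 1 ad by auto
        show ?thesis
        \<comment> \<open>If the other middle element also needs raising, its place after
          \<open>x\<close> in the crossing order fixes the value at the inner triple. If it does
          not, the raised packet coincides with that of \<open>e'\<close>.\<close>
        proof (cases "c \<in> ?X")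
          case c: True
          then have "e a b c" using bspec[OF min c] 1 ad * by auto
          moreover have "\<not> e a c d" "e' a c d" using c ad by auto
          ultimately show ?thesis using m m' e same rr unfolding r1 mono4_iff by blast
        next
          case False
          then have "e' a c d \<longleftrightarrow> e a c d" using ad * dominatedD[OF dom, of a c d] by auto
          then show ?thesis using m' e same rr unfolding r1 mono4_iff by blast
        qed
      next
        case 2
        have rr: "raised e 1 x n a c d" "raised e 1 x n a b d \<longleftrightarrow> e a b d" using 2 ad * by (auto simp: raised_def)
        have e: "\<not> e a c d" "e' a c d" using x 2 ad by auto
        show ?thesis
        proof (cases "b \<in> ?X")
          case b: True
          then have "\<not> e a b c" using bspec[OF min b] 2 ad * by auto
          moreover have "\<not> e a b d" "e' a b d" using b ad by auto
          ultimately show ?thesis using m m' e same rr unfolding r1 mono4_iff by blast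
        next
          case False
          then have "e' a b d \<longleftrightarrow> e a b d" using ad * dominatedD[OF dom, of a b d] by auto
          then show ?thesis using m' e same rr unfolding r1 mono4_iff by blast
        qed
      qed
    qed
  qed
  then show ?thesis using x by (intro exI[of _ 1] exI[of _ x] exI[of _ n]) simp
qed

text \<open>If some triple to be raised avoids the last element, deletion of that element works; if
  some triple avoids 1, the mirror image does. Otherwise every such triple contains both, which is
  the situation of \<open>raise_extreme\<close>.\<close>

lemma raise_adjacent:
  assumes IH: "raise_exists n"
    and con: "consistent (Suc n) e" "consistent (Suc n) e'" and dom: "dominated (Suc n) e e'"
    and adj: "\<And>e''. consistent (Suc n) e'' \<Longrightarrow> dominated (Suc n) e e'' \<Longrightarrow> dominated (Suc n) e'' e' \<Longrightarrow>
      dominated (Suc n) e'' e \<or> dominated (Suc n) e' e''"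
    and diff: "\<not> dominated (Suc n) e' e"
  shows "\<exists>i j k. 0 < i \<and> i < j \<and> j < k \<and> k \<le> Suc n \<and> \<not> e i j k \<and> e' i j k \<and> consistent (Suc n) (raised e i j k)"
proof (cases "dominated n e' e")
  case False
  show ?thesis by (rule raise_adjacent_without_last[OF IH con dom adj False])
next
  case True
  let ?z = "Suc n" and ?m = "mirrored (Suc n)"
  show ?thesis
  proof (cases "dominated n (?m e') (?m e)")
    case False
    have "\<exists>i j k. 0 < i \<and> i < j \<and> j < k \<and> k \<le> ?z \<and> \<not> ?m e i j k \<and> ?m e' i j k \<and> consistent ?z (raised (?m e) i j k)"
    proof (rule raise_adjacent_without_last[OF IH consistent_mirrored[OF con(1)] consistent_mirrored[OF con(2)] _ _ False])
      show "dominated ?z (?m e) (?m e')" using dom by (simp add: dominated_mirrored_mirrored)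
      fix f assume f: "consistent ?z f" "dominated ?z (?m e) f" "dominated ?z f (?m e')"
      have "dominated ?z (?m f) e \<or> dominated ?z e' (?m f)"
        using adj[OF consistent_mirrored[OF f(1)]] f(2,3) by (simp add: dominated_mirrored_iff)
      then show "dominated ?z f (?m e) \<or> dominated ?z (?m e') f" by (simp add: dominated_mirrored_iff)
    qed
    then obtain i j k where t: "0 < i" "i < j" "j < k" "k \<le> ?z" "\<not> ?m e i j k" "?m e' i j k"
      "consistent ?z (raised (?m e) i j k)" by (elim exE conjE)
    let ?i = "Suc ?z - k" and ?j = "Suc ?z - j" and ?k = "Suc ?z - i"
    have "consistent ?z (raised e ?i ?j ?k)"
    proof (rule consistent_cong[OF consistent_mirrored[OF t(7)]])
      fix a b c assume "0 < a" "a < b" "b < c" "c \<le> ?z"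
      moreover from this have "?m e (Suc ?z - c) (Suc ?z - b) (Suc ?z - a) \<longleftrightarrow> e a b c" by (simp add: mirrored_def)
      moreover have "Suc ?z - c = i \<longleftrightarrow> c = ?k" "Suc ?z - b = j \<longleftrightarrow> b = ?j" "Suc ?z - a = k \<longleftrightarrow> a = ?i"
        using t calculation by auto
      ultimately show "raised e ?i ?j ?k a b c \<longleftrightarrow> ?m (raised (?m e) i j k) a b c"
        unfolding raised_def by (subst mirrored_def[of _ "\<lambda>a b c. ?m e a b c \<or> (a = i \<and> b = j \<and> c = k)"]) blast
    qed
    moreover have "\<not> e ?i ?j ?k" "e' ?i ?j ?k" using t(5,6) by (simp_all add: mirrored_def)
    moreover have "0 < ?i" "?i < ?j" "?j < ?k" "?k \<le> ?z" using t by auto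
    ultimately show ?thesis by (intro exI[of _ ?i] exI[of _ ?j] exI[of _ ?k]) simp
  next
    case m: True
    show ?thesis
    proof (rule raise_extreme[OF con dom _ diff])
      fix a b c assume *: "0 < a" "a < b" "b < c" "c \<le> ?z" "e' a b c" "\<not> e a b c"
      have "c = ?z" using dominatedD[OF True, of a b c] * by (cases "c \<le> n") auto
      moreover have "a = 1"
      proof (rule ccontr)
        assume "a \<noteq> 1"
        then have "?m e (Suc ?z - c) (Suc ?z - b) (Suc ?z - a)"
          using * by (intro dominatedD[OF m]) (auto simp: mirrored_def)
        then show False using * by (simp add: mirrored_def)
      qed
      ultimately show "a = 1 \<and> c = ?z" by blast
    qed
  qed
qed

lemma raise_exists_always: "raise_exists n"
proof (induction n)
  case 0
  show ?case unfolding raise_exists_def dominated_def by auto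
next
  case (Suc n)
  show ?case unfolding raise_exists_def
  proof (intro allI impI, elim conjE)
    fix e e' assume con: "consistent (Suc n) e" "consistent (Suc n) e'" and dom: "dominated (Suc n) e e'"
      and diff: "\<not> dominated (Suc n) e' e"
    let ?N = "Suc n"
    let ?I = "\<lambda>f. {(a, b, c). 0 < a \<and> a < b \<and> b < c \<and> c \<le> ?N \<and> f a b c}"
    let ?P = "\<lambda>f. consistent ?N f \<and> dominated ?N e f \<and> dominated ?N f e' \<and> \<not> dominated ?N f e"
    have fin: "finite (?I f)" for f
      by (rule finite_subset[of _ "{1..?N} \<times> {1..?N} \<times> {1..?N}"]) auto
    have "?P e'" using con dom diff dominated_refl by blast
    \<comment> \<open>An \<open>f\<close> with fewest reversed triples among those strictly above
      \<open>e\<close> and below \<open>e'\<close> has nothing strictly between it and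
      \<open>e\<close>. A raise towards \<open>f\<close> is also one towards
      \<open>e'\<close>.\<close>
    then obtain f where f: "?P f" and min: "\<And>g. ?P g \<Longrightarrow> card (?I f) \<le> card (?I g)"
      using ex_has_least_nat[of ?P e' "\<lambda>f. card (?I f)"] by blast
    have "\<exists>i j k. 0 < i \<and> i < j \<and> j < k \<and> k \<le> ?N \<and> \<not> e i j k \<and> f i j k \<and> consistent ?N (raised e i j k)"
    proof (rule raise_adjacent[OF Suc.IH con(1)])
      show "consistent ?N f" "dominated ?N e f" "\<not> dominated ?N f e" using f by auto
      fix g assume g: "consistent ?N g" "dominated ?N e g" "dominated ?N g f"
      show "dominated ?N g e \<or> dominated ?N f g"
      proof (rule ccontr)
        assume neg: "\<not> (dominated ?N g e \<or> dominated ?N f g)"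
        have "dominated ?N g e'" using dominated_trans[OF g(3)] f by blast
        then have "card (?I f) \<le> card (?I g)" using min g neg by blast
        moreover have "?I g \<subset> ?I f"
        proof
          show "?I g \<subseteq> ?I f" using dominatedD[OF g(3)] by auto
          obtain a b c where "0 < a" "a < b" "b < c" "c \<le> ?N" "f a b c" "\<not> g a b c"
            using neg unfolding dominated_def by blast
          then have "(a, b, c) \<in> ?I f" "(a, b, c) \<notin> ?I g" by simp_all
          then show "?I g \<noteq> ?I f" by metis
        qed
        then have "card (?I g) < card (?I f)" by (rule psubset_card_mono[OF fin])
        ultimately show False by simp
      qed
    qed
    then obtain i j k where t: "0 < i" "i < j" "j < k" "k \<le> ?N" "\<not> e i j k" "f i j k" "consistent ?N (raised e i j k)"
      by (elim exE conjE)
    have "dominated ?N f e'" using f by (elim conjE)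
    then have "e' i j k" by (rule dominatedD) (fact t)+
    then show "\<exists>i j k. 0 < i \<and> i < j \<and> j < k \<and> k \<le> ?N \<and> \<not> e i j k \<and> e' i j k \<and> consistent ?N (raised e i j k)"
      using t by (intro exI[of _ i] exI[of _ j] exI[of _ k]) simp
  qed
qed

subsection \<open>Covers and raising flips\<close>

text \<open>If both \<open>e\<close> and its raise at \<open>i < j < k\<close> are consistent, then in every packet
  \<open>{i, j, k, p}\<close> the three triples through \<open>p\<close> are determined by one bit; it says whether \<open>p\<close>
  belongs to the base \<open>X\<close> of the flip.\<close>

definition in_base :: "(nat \<Rightarrow> nat \<Rightarrow> nat \<Rightarrow> bool) \<Rightarrow> nat \<Rightarrow> nat \<Rightarrow> nat \<Rightarrow> nat \<Rightarrow> bool" where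
  "in_base e i j k p \<longleftrightarrow>
     (if p < i then e p i j else if p < j then \<not> e i p j else if p < k then e i j p else e j k p)"

locale raisable_triple =
  fixes n :: nat and e :: "nat \<Rightarrow> nat \<Rightarrow> nat \<Rightarrow> bool" and i j k :: nat
  assumes con: "consistent n e" and conr: "consistent n (raised e i j k)"
    and ord: "0 < i" "i < j" "j < k" "k \<le> n" and low: "\<not> e i j k"
begin

abbreviation "f \<equiv> raised e i j k"

lemma raised_other: "\<not> (a = i \<and> b = j \<and> c = k) \<Longrightarrow> f a b c \<longleftrightarrow> e a b c"
  unfolding raised_def by blast

lemma raised_same: "f i j k"
  unfolding raised_def by blast

text \<open>The packet is monotone with either value at \<open>(i, j, k)\<close>. Hence its entries
  on one side of that place are equal, and entries on different sides are opposite. The next three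
  lemmas apply this for the other positions of \<open>p\<close>.\<close>

lemma packet_before:
  assumes "0 < p" "p < i"
  shows "e p i j = in_base e i j k p" "e p i k = in_base e i j k p" "e p j k = in_base e i j k p"
proof -
  have "mono4 (e p i j) (e p i k) (e p j k) False" using consistentD[OF con, of p i j k] assms ord low by simp
  moreover have "mono4 (e p i j) (e p i k) (e p j k) True"
    using consistentD[OF conr, of p i j k] assms ord raised_other raised_same by simp
  moreover have "in_base e i j k p \<longleftrightarrow> e p i j" using assms ord by (simp add: in_base_def)
  ultimately show "e p i j = in_base e i j k p" "e p i k = in_base e i j k p" "e p j k = in_base e i j k p"
    unfolding mono4_iff by blast+
qed

lemma packet_between_left:
  assumes "i < p" "p < j"
  shows "e i p j = (\<not> in_base e i j k p)" "e i p k = (\<not> in_base e i j k p)" "e p j k = in_base e i j k p"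
proof -
  have "mono4 (e i p j) (e i p k) False (e p j k)" using consistentD[OF con, of i p j k] assms ord low by simp
  moreover have "mono4 (e i p j) (e i p k) True (e p j k)"
    using consistentD[OF conr, of i p j k] assms ord raised_other raised_same by simp
  moreover have "in_base e i j k p \<longleftrightarrow> \<not> e i p j" using assms ord by (simp add: in_base_def)
  ultimately show "e i p j = (\<not> in_base e i j k p)" "e i p k = (\<not> in_base e i j k p)" "e p j k = in_base e i j k p"
    unfolding mono4_iff by blast+
qed

lemma packet_between_right:
  assumes "j < p" "p < k"
  shows "e i j p = in_base e i j k p" "e i p k = (\<not> in_base e i j k p)" "e j p k = (\<not> in_base e i j k p)"
proof -
  have "mono4 (e i j p) False (e i p k) (e j p k)" using consistentD[OF con, of i j p k] assms ord low by simp
  moreover have "mono4 (e i j p) True (e i p k) (e j p k)"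
    using consistentD[OF conr, of i j p k] assms ord raised_other raised_same by simp
  moreover have "in_base e i j k p \<longleftrightarrow> e i j p" using assms ord by (simp add: in_base_def)
  ultimately show "e i j p = in_base e i j k p" "e i p k = (\<not> in_base e i j k p)" "e j p k = (\<not> in_base e i j k p)"
    unfolding mono4_iff by blast+
qed

lemma packet_after:
  assumes "k < p" "p \<le> n"
  shows "e i j p = in_base e i j k p" "e i k p = in_base e i j k p" "e j k p = in_base e i j k p"
proof -
  have "mono4 False (e i j p) (e i k p) (e j k p)" using consistentD[OF con, of i j k p] assms ord low by simp
  moreover have "mono4 True (e i j p) (e i k p) (e j k p)"
    using consistentD[OF conr, of i j k p] assms ord raised_other raised_same by simp
  moreover have "in_base e i j k p \<longleftrightarrow> e j k p" using assms ord by (simp add: in_base_def)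
  ultimately show "e i j p = in_base e i j k p" "e i k p = in_base e i j k p" "e j k p = in_base e i j k p"
    unfolding mono4_iff by blast+
qed

lemma packet_value:
  assumes "x \<in> {i, j, k}" "y \<in> {i, j, k}" "x < y" "p \<notin> {i, j, k}" "0 < p" "p \<le> n"
  shows "p < x \<Longrightarrow> e p x y = in_base e i j k p"
    and "x < p \<Longrightarrow> p < y \<Longrightarrow> e x p y = (\<not> in_base e i j k p)"
    and "y < p \<Longrightarrow> e x y p = in_base e i j k p"
proof -
  have xy: "x = i \<and> y = j \<or> x = i \<and> y = k \<or> x = j \<and> y = k" using assms ord by auto
  consider "p < i" | "i < p" "p < j" | "j < p" "p < k" | "k < p" using assms(4) by (metis insertCI linorder_neqE_nat)
  note pos = this
  show "p < x \<Longrightarrow> e p x y = in_base e i j k p"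
    using pos by cases (use xy ord assms packet_before[of p] packet_between_left[of p] in auto)
  show "x < p \<Longrightarrow> p < y \<Longrightarrow> e x p y = (\<not> in_base e i j k p)"
    using pos by cases (use xy ord assms packet_between_right[of p] packet_between_left[of p] in auto)
  show "y < p \<Longrightarrow> e x y p = in_base e i j k p"
    using pos by cases (use xy ord assms packet_between_right[of p] packet_after[of p] in auto)
qed

text \<open>If membership of \<open>p\<close> disagreed with the bit, \<open>B\<close> would have a
  forbidden pattern on \<open>p\<close> and two of \<open>i, j, k\<close>.\<close>

lemma base_of_lower:
  assumes "B \<in> separated n e" "i \<notin> B" "j \<in> B" "k \<notin> B" and p: "p \<in> {1..n} - {i, j, k}"
  shows "p \<in> B \<longleftrightarrow> in_base e i j k p"
proof -
  have lb: "\<And>a b c. 0 < a \<Longrightarrow> a < b \<Longrightarrow> b < c \<Longrightarrow> c \<le> n \<Longrightarrow> a \<in> B \<Longrightarrow> b \<notin> B \<Longrightarrow> c \<in> B \<Longrightarrow> e a b c"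
    and la: "\<And>a b c. 0 < a \<Longrightarrow> a < b \<Longrightarrow> b < c \<Longrightarrow> c \<le> n \<Longrightarrow> a \<notin> B \<Longrightarrow> b \<in> B \<Longrightarrow> c \<notin> B \<Longrightarrow> \<not> e a b c"
    using assms(1) lies_belowD lies_aboveD unfolding separated_def by blast+
  consider "p < i" | "i < p" "p < j" | "j < p" "p < k" | "k < p" using p by (metis DiffD2 insertCI linorder_neqE_nat)
  then show ?thesis
  proof cases
    case 1
    then show ?thesis using lb[of p i j] la[of p j k] packet_before[of p] assms ord by auto
  next
    case 2
    then show ?thesis using la[of i p k] la[of p j k] packet_between_left[of p] assms ord by auto
  next
    case 3
    then show ?thesis using la[of i p k] la[of i j p] packet_between_right[of p] assms ord by auto
  next
    case 4
    then show ?thesis using lb[of j k p] la[of i j p] packet_after[of p] assms ord by auto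
  qed
qed

lemma base_of_upper:
  assumes "B \<in> separated n f" "i \<in> B" "j \<notin> B" "k \<in> B" and p: "p \<in> {1..n} - {i, j, k}"
  shows "p \<in> B \<longleftrightarrow> in_base e i j k p"
proof -
  have lb: "0 < a \<Longrightarrow> a < b \<Longrightarrow> b < c \<Longrightarrow> c \<le> n \<Longrightarrow> a \<in> B \<Longrightarrow> b \<notin> B \<Longrightarrow> c \<in> B \<Longrightarrow> p \<in> {a, b, c} \<Longrightarrow> e a b c"
    and la: "0 < a \<Longrightarrow> a < b \<Longrightarrow> b < c \<Longrightarrow> c \<le> n \<Longrightarrow> a \<notin> B \<Longrightarrow> b \<in> B \<Longrightarrow> c \<notin> B \<Longrightarrow> p \<in> {a, b, c} \<Longrightarrow> \<not> e a b c" for a b c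
  proof -
    have ne: "\<not> (a = i \<and> b = j \<and> c = k)" if "p \<in> {a, b, c}" using that p by blast
    show "0 < a \<Longrightarrow> a < b \<Longrightarrow> b < c \<Longrightarrow> c \<le> n \<Longrightarrow> a \<in> B \<Longrightarrow> b \<notin> B \<Longrightarrow> c \<in> B \<Longrightarrow> p \<in> {a, b, c} \<Longrightarrow> e a b c"
      using assms(1) lies_belowD[of n f B a b c] raised_other[OF ne] unfolding separated_def by blast
    show "0 < a \<Longrightarrow> a < b \<Longrightarrow> b < c \<Longrightarrow> c \<le> n \<Longrightarrow> a \<notin> B \<Longrightarrow> b \<in> B \<Longrightarrow> c \<notin> B \<Longrightarrow> p \<in> {a, b, c} \<Longrightarrow> \<not> e a b c"
      using assms(1) lies_aboveD[of n f B a b c] raised_other[OF ne] unfolding separated_def by blast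
  qed
  consider "p < i" | "i < p" "p < j" | "j < p" "p < k" | "k < p" using p by (metis DiffD2 insertCI linorder_neqE_nat)
  then show ?thesis
  proof cases
    case 1
    then show ?thesis using lb[of p j k] la[of p i j] packet_before[of p] assms ord by auto
  next
    case 2
    then show ?thesis using lb[of p j k] lb[of i p k] packet_between_left[of p] assms ord by auto
  next
    case 3
    then show ?thesis using lb[of i j p] lb[of i p k] packet_between_right[of p] assms ord by auto
  next
    case 4
    then show ?thesis using lb[of i j p] la[of j k p] packet_after[of p] assms ord by auto
  qed
qed

definition base :: "nat set" where
  "base = {p \<in> {1..n} - {i, j, k}. in_base e i j k p}"

lemma lower_unique: "B \<in> separated n e \<Longrightarrow> i \<notin> B \<Longrightarrow> j \<in> B \<Longrightarrow> k \<notin> B \<Longrightarrow> B = base \<union> {j}"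
  using base_of_lower[of B] unfolding base_def separated_def by blast

lemma upper_unique: "B \<in> separated n f \<Longrightarrow> i \<in> B \<Longrightarrow> j \<notin> B \<Longrightarrow> k \<in> B \<Longrightarrow> B = base \<union> {i, k}"
  using base_of_upper[of B] unfolding base_def separated_def by blast

lemma lower_mem: "base \<union> {j} \<in> separated n e"
  using separated_realizes(2)[OF con ord low] lower_unique by metis

lemma upper_mem: "base \<union> {i, k} \<in> separated n f"
  using separated_realizes(1)[OF conr ord raised_same] upper_unique by metis

text \<open>On most triples \<open>Z\<close> looks like one of the known members \<open>base\<close>
  with \<open>j\<close> or \<open>base\<close> with \<open>i, k\<close>, and then their patterns
  decide. Otherwise the triple has exactly two elements in \<open>{i, j, k}\<close>, and the packet
  bit of the third decides.\<close>

lemma triple_value: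
  assumes Z: "\<And>p. p \<in> {1..n} - {i, j, k} \<Longrightarrow> p \<in> Z \<longleftrightarrow> p \<in> base"
    and abc: "0 < a" "a < b" "b < c" "c \<le> n" "\<not> (a = i \<and> b = j \<and> c = k)"
  shows "a \<in> Z \<Longrightarrow> b \<notin> Z \<Longrightarrow> c \<in> Z \<Longrightarrow> e a b c"
    and "a \<notin> Z \<Longrightarrow> b \<in> Z \<Longrightarrow> c \<notin> Z \<Longrightarrow> \<not> e a b c"
proof -
  let ?T = "{i, j, k}"
  have out: "p \<in> Z \<longleftrightarrow> in_base e i j k p" if "p \<notin> ?T" "0 < p" "p \<le> n" for p
    using Z[of p] that unfolding base_def by auto
  have lo: "lies_below n e (base \<union> {j})" "lies_above n e (base \<union> {j})"
    "lies_below n f (base \<union> {i, k})" "lies_above n f (base \<union> {i, k})"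
    using lower_mem upper_mem unfolding separated_def by blast+
  have fe: "f a b c \<longleftrightarrow> e a b c" by (rule raised_other[OF abc(5)])
  have *: "(a \<in> Z \<longrightarrow> b \<notin> Z \<longrightarrow> c \<in> Z \<longrightarrow> e a b c) \<and> (a \<notin> Z \<longrightarrow> b \<in> Z \<longrightarrow> c \<notin> Z \<longrightarrow> \<not> e a b c)"
  proof (cases "\<exists>Y\<in>{base \<union> {j}, base \<union> {i, k}}. \<forall>x\<in>{a, b, c}. x \<in> Z \<longleftrightarrow> x \<in> Y")
    case True
    then consider "\<forall>x\<in>{a, b, c}. x \<in> Z \<longleftrightarrow> x \<in> base \<union> {j}" | "\<forall>x\<in>{a, b, c}. x \<in> Z \<longleftrightarrow> x \<in> base \<union> {i, k}" by blast
    then show ?thesis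
    proof cases
      case 1
      then show ?thesis using lies_belowD[OF lo(1) abc(1-4)] lies_aboveD[OF lo(2) abc(1-4)] by simp
    next
      case 2
      then show ?thesis using lies_belowD[OF lo(3) abc(1-4)] lies_aboveD[OF lo(4) abc(1-4)] fe by simp
    qed
  next
    case False
    have nb: "i \<notin> base" "j \<notin> base" "k \<notin> base" unfolding base_def by auto
    have ran: "a \<in> {1..n}" "b \<in> {1..n}" "c \<in> {1..n}" using abc by auto
    have agree: "x \<in> ?T \<and> y \<in> ?T" if "x \<in> {a, b, c}" "x \<in> Z \<longleftrightarrow> x \<notin> base \<union> {j}" "y \<in> {a, b, c}" "y \<in> Z \<longleftrightarrow> y \<notin> base \<union> {i, k}" for x y
      using that Z ran by auto
    obtain x where x: "x \<in> {a, b, c}" "x \<in> Z \<longleftrightarrow> x \<notin> base \<union> {j}" using False by blast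
    obtain y where y: "y \<in> {a, b, c}" "y \<in> Z \<longleftrightarrow> y \<notin> base \<union> {i, k}" using False by blast
    have xy: "x \<in> ?T" "y \<in> ?T" using agree[OF x y] by auto
    \<comment> \<open>Each of \<open>i, j, k\<close> belongs to exactly one of the two known
      members, so no single element can disagree with both.\<close>
    have "x \<noteq> y" using x y xy nb ord by auto
    have "\<not> (a \<in> ?T \<and> b \<in> ?T \<and> c \<in> ?T)" using abc ord by auto
    then consider "a \<notin> ?T" "b \<in> ?T" "c \<in> ?T" | "a \<in> ?T" "b \<notin> ?T" "c \<in> ?T" | "a \<in> ?T" "b \<in> ?T" "c \<notin> ?T"
      using x(1) y(1) xy \<open>x \<noteq> y\<close> by blast
    then show ?thesis
    proof cases
      case 1
      then show ?thesis using packet_value(1)[OF 1(2,3) abc(3) 1(1)] out[of a] abc by auto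
    next
      case 2
      have "a < c" using abc by simp
      show ?thesis using packet_value(2)[OF 2(1,3) \<open>a < c\<close> 2(2)] out[of b] 2 abc by auto
    next
      case 3
      then show ?thesis using packet_value(3)[OF 3(1,2) abc(2) 3(3)] out[of c] abc by auto
    qed
  qed
  show "a \<in> Z \<Longrightarrow> b \<notin> Z \<Longrightarrow> c \<in> Z \<Longrightarrow> e a b c" using * by blast
  show "a \<notin> Z \<Longrightarrow> b \<in> Z \<Longrightarrow> c \<notin> Z \<Longrightarrow> \<not> e a b c" using * by blast
qed

lemma hexagon_mem:
  assumes "I \<subseteq> {i, j, k}" "I \<noteq> {i, k}"
  shows "base \<union> I \<in> separated n e"
proof -
  let ?Z = "base \<union> I"
  have Z: "p \<in> ?Z \<longleftrightarrow> p \<in> base" if "p \<in> {1..n} - {i, j, k}" for p using that assms(1) by blast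
  have nb: "i \<notin> base" "j \<notin> base" "k \<notin> base" unfolding base_def by auto
  have ne: "\<not> (i \<in> ?Z \<and> j \<notin> ?Z \<and> k \<in> ?Z)" using assms nb by blast
  have "lies_below n e ?Z" unfolding lies_below_def
  proof (intro allI impI, elim conjE)
    fix a b c assume *: "0 < a" "a < b" "b < c" "c \<le> n" "a \<in> ?Z" "b \<notin> ?Z" "c \<in> ?Z"
    then have "\<not> (a = i \<and> b = j \<and> c = k)" using ne by blast
    then show "e a b c" using triple_value(1)[OF Z, of a b c] * by blast
  qed
  moreover have "lies_above n e ?Z" unfolding lies_above_def
  proof (intro allI impI, elim conjE)
    fix a b c assume *: "0 < a" "a < b" "b < c" "c \<le> n" "a \<notin> ?Z" "b \<in> ?Z" "c \<notin> ?Z"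
    show "\<not> e a b c"
    proof (cases "a = i \<and> b = j \<and> c = k")
      case True
      then show ?thesis using low by simp
    next
      case False
      then show ?thesis using triple_value(2)[OF Z, of a b c] * by blast
    qed
  qed
  moreover have "?Z \<subseteq> {1..n}" using assms(1) ord unfolding base_def by auto
  ultimately show ?thesis unfolding separated_def by simp
qed

text \<open>Only a set with pattern in-out-in or out-in-out on \<open>i, j, k\<close> is affected by
  the raise, and there is a unique set of each kind.\<close>

lemma separated_raised: "separated n f = (separated n e - {base \<union> {j}}) \<union> {base \<union> {i, k}}"
proof -
  have nb: "i \<notin> base" "j \<notin> base" "k \<notin> base" unfolding base_def by auto
  have ef: "Z \<in> separated n e \<longleftrightarrow> Z \<in> separated n f"
    if "\<not> (i \<in> Z \<and> j \<notin> Z \<and> k \<in> Z)" "\<not> (i \<notin> Z \<and> j \<in> Z \<and> k \<notin> Z)" for Z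
  proof -
    have "lies_below n e Z \<longleftrightarrow> lies_below n f Z" "lies_above n e Z \<longleftrightarrow> lies_above n f Z"
      unfolding lies_below_def lies_above_def raised_def using that by blast+
    then show ?thesis unfolding separated_def by simp
  qed
  have up: "Z \<notin> separated n e" if "i \<in> Z" "j \<notin> Z" "k \<in> Z" for Z
    using that low lies_belowD[of n e Z i j k] ord unfolding separated_def by blast
  have lo: "Z \<notin> separated n f" if "i \<notin> Z" "j \<in> Z" "k \<notin> Z" for Z
    using that raised_same lies_aboveD[of n f Z i j k] ord unfolding separated_def by blast
  have "Z \<in> separated n f \<longleftrightarrow> Z \<in> (separated n e - {base \<union> {j}}) \<union> {base \<union> {i, k}}" for Z
  proof -
    consider "i \<in> Z" "j \<notin> Z" "k \<in> Z" | "i \<notin> Z" "j \<in> Z" "k \<notin> Z"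
      | "\<not> (i \<in> Z \<and> j \<notin> Z \<and> k \<in> Z)" "\<not> (i \<notin> Z \<and> j \<in> Z \<and> k \<notin> Z)" by blast
    then show ?thesis
    proof cases
      case 1
      then show ?thesis using up[OF 1] upper_unique[OF _ 1] upper_mem by blast
    next
      case 2
      then show ?thesis using lo[OF 2] lower_unique[OF _ 2] by blast
    next
      case 3
      then have "Z \<noteq> base \<union> {j}" "Z \<noteq> base \<union> {i, k}" using nb ord by auto
      then show ?thesis using ef[OF 3] by blast
    qed
  qed
  then show ?thesis by blast
qed

theorem raising_flip_separated: "raising_flip n (separated n e) (separated n f)"
  unfolding raising_flip_def
proof (intro exI conjI)
  show "i \<in> {1..n}" "j \<in> {1..n}" "k \<in> {1..n}" "i < j" "j < k" using ord by auto
  show "base \<subseteq> {1..n} - {i, j, k}" unfolding base_def by blast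
  have "base \<union> {} \<in> separated n e" "base \<union> {i} \<in> separated n e" "base \<union> {j} \<in> separated n e" "base \<union> {k} \<in> separated n e"
    "base \<union> {i, j} \<in> separated n e" "base \<union> {j, k} \<in> separated n e" "base \<union> {i, j, k} \<in> separated n e"
    by (rule hexagon_mem; use ord in auto)+
  then show "{base, base \<union> {i}, base \<union> {j}, base \<union> {k}, base \<union> {i, j}, base \<union> {j, k}, base \<union> {i, j, k}} \<subseteq> separated n e"
    by simp
  show "separated n f = separated n e - {base \<union> {j}} \<union> {base \<union> {i, k}}" by (rule separated_raised)
qed

end

text \<open>If some members omit the last element, one that is innermost among these is innermost
  altogether: by \<open>surrounds_last\<close> it cannot surround a member that contains the last
  element. If all contain it, deleting it changes nothing.\<close>

lemma exists_innermost:
  assumes "chordal F" "F \<subseteq> Pow {1..n}" "F \<noteq> {}"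
  shows "\<exists>A\<in>F. \<forall>B\<in>F. \<not> surrounds A B"
  using assms
proof (induction n arbitrary: F)
  case 0
  then show ?case unfolding surrounds_def by auto
next
  case (Suc n)
  let ?z = "Suc n"
  let ?F = "{A \<in> F. ?z \<notin> A}"
  show ?case
  proof (cases "?F = {}")
    case False
    have "chordal ?F" using Suc.prems(1) unfolding chordal_def by blast
    moreover have "?F \<subseteq> Pow {1..n}"
    proof
      fix A assume "A \<in> ?F"
      then have "A \<subseteq> {1..?z}" "?z \<notin> A" using Suc.prems(2) by auto
      then show "A \<in> Pow {1..n}" by (auto simp: le_Suc_eq)
    qed
    ultimately obtain A where A: "A \<in> ?F" "\<forall>B\<in>?F. \<not> surrounds A B" using Suc.IH[OF _ _ False] by blast
    have "\<not> surrounds A B" if B: "B \<in> F" for B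
    proof
      assume s: "surrounds A B"
      then have zB: "?z \<in> B" using A B by blast
      have sub: "A \<subseteq> {1..?z}" using A(1) Suc.prems(2) by blast
      have "\<not> surrounds B A" using Suc.prems(1) A(1) B s unfolding chordal_def by blast
      then show False using surrounds_last[OF s _ sub zB] A(1) by blast
    qed
    then show ?thesis using A(1) by blast
  next
    case True
    let ?G = "(\<lambda>A. A - {?z}) ` F"
    have "?G \<subseteq> Pow {1..n}"
    proof
      fix A assume "A \<in> ?G"
      then obtain B where "A = B - {?z}" "B \<subseteq> {1..?z}" using Suc.prems(2) by blast
      then show "A \<in> Pow {1..n}" by (auto simp: le_Suc_eq)
    qed
    then have "\<exists>A\<in>?G. \<forall>B\<in>?G. \<not> surrounds A B"
      using Suc.prems(3) by (intro Suc.IH chordal_image_remove[OF Suc.prems(1)]) simp_all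
    then obtain A where A: "A \<in> F" "\<forall>B\<in>F. \<not> surrounds (A - {?z}) (B - {?z})" by auto
    have "\<not> surrounds A B" if B: "B \<in> F" for B
    proof
      have z: "?z \<in> A" "?z \<in> B" using True A(1) B by auto
      assume "surrounds A B"
      then have "surrounds (A - {?z}) (B - {?z})" unfolding surrounds_def using z by blast
      then show False using A(2) B by blast
    qed
    then show ?thesis using A(1) by blast
  qed
qed

text \<open>A member of \<open>C\<close> that surrounds some \<open>Z\<close> of the collection
  cannot lie below \<open>f\<close>, so it lies above, and \<open>Z\<close> does not surround it.
  Thus \<open>Z\<close> is chord separated from all of \<open>C\<close>, and maximality gives
  membership.\<close>

lemma separated_max_strongly_separated:
  assumes "maximal_chord_separated_collection n C" "consistent n f"
    and "\<And>X. X \<in> C \<Longrightarrow> lies_below n f X \<or> lies_above n f X"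
  shows "separated n f \<in> max_strongly_separated_in n C"
proof -
  have "Z \<in> C" if Z: "Z \<in> separated n f" for Z
  proof (rule maximal_chord_separatedD(3)[OF assms(1)])
    have Zf: "lies_below n f Z" "lies_above n f Z" "Z \<subseteq> {1..n}" using Z by (auto simp: separated_def)
    then show "Z \<subseteq> {1..n}" by blast
    fix A assume A: "A \<in> C" and s: "surrounds A Z"
    have An: "A \<subseteq> {1..n}" using maximal_chord_separatedD(1)[OF assms(1)] A by blast
    then have "lies_above n f A" using assms(3)[OF A] separated_not_surrounds[OF _ Zf(2) An Zf(3)] s by blast
    then show "\<not> surrounds Z A" by (rule separated_not_surrounds[OF Zf(1) _ Zf(3) An])
  qed
  then show ?thesis using assms(2) unfolding max_strongly_separated_iff by blast
qed

lemma dominated_orientation: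
  assumes "inversions S \<subseteq> inversions T"
  shows "dominated n (orientation S) (orientation T)"
proof (rule dominatedI)
  fix a b c assume "a < b" "b < c" "orientation S a b c"
  then show "orientation T a b c" using assms mem_inversions[of a b c S] mem_inversions[of a b c T] by blast
qed

lemma inversions_subset_separated:
  assumes S: "S \<in> max_strongly_separated_in n C" and f: "consistent n f" "dominated n (orientation S) f"
  shows "inversions S \<subseteq> inversions (separated n f)"
proof
  fix t assume t: "t \<in> inversions S"
  obtain a b c where abc: "t = (a, b, c)" by (cases t) auto
  have r: "0 < a" "a < b" "b < c" "c \<le> n" using inversions_range[OF S] t abc by auto
  moreover have "orientation S a b c" using t abc by (simp add: mem_inversions)
  ultimately show "t \<in> inversions (separated n f)"
    using dominatedD[OF f(2)] abc by (simp add: inversions_separated[OF f(1)])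
qed

lemma separated_subset_inversions:
  assumes f: "consistent n f" "dominated n f (orientation S)"
  shows "inversions (separated n f) \<subseteq> inversions S"
  using dominatedD[OF f(2)] by (auto simp: inversions_separated[OF f(1)] mem_inversions)

lemma adjacent_comparable:
  assumes C: "maximal_chord_separated_collection n C"
    and S: "S \<in> max_strongly_separated_in n C" and S': "S' \<in> max_strongly_separated_in n C"
    and sub: "inversions S \<subseteq> inversions S'"
    and adj: "\<And>T. T \<in> max_strongly_separated_in n C \<Longrightarrow> inversions S \<subseteq> inversions T \<Longrightarrow>
      inversions T \<subseteq> inversions S' \<Longrightarrow> T = S \<or> T = S'"
    and X: "X \<in> C"
  shows "lies_below n (orientation S) X \<or> lies_above n (orientation S') X"
proof (rule ccontr)
  let ?e = "orientation S" and ?e' = "orientation S'"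
  let ?mid = "{A \<in> C. \<not> lies_below n ?e A \<and> \<not> lies_above n ?e' A}"
  note Cs = maximal_chord_separatedD(1,2)[OF C]
  have dom: "dominated n ?e ?e'" by (rule dominated_orientation[OF sub])
  assume "\<not> (lies_below n ?e X \<or> lies_above n ?e' X)"
  then have "?mid \<noteq> {}" using X by blast
  moreover have "chordal ?mid" using Cs(2) unfolding chordal_def by blast
  moreover have "?mid \<subseteq> Pow {1..n}" using Cs(1) by blast
  ultimately obtain A where A: "A \<in> ?mid" "\<And>B. B \<in> ?mid \<Longrightarrow> \<not> surrounds A B"
    using exists_innermost[of ?mid n] by blast
  \<comment> \<open>Every member of \<open>C\<close> is in one of the two collections, so the
    resulting orientation is comparable with all of \<open>C\<close>. The set \<open>A\<close> is in
    both and therefore belongs to the collection of that orientation. Since \<open>A\<close>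
    surrounds no middle member, all of these may go to the upper side.\<close>
  let ?W = "{X \<in> C. lies_below n ?e X} \<union> {A}" and ?U = "{X \<in> C. lies_above n ?e' X} \<union> ?mid"
  have cn: "X \<subseteq> {1..n}" if "X \<in> C" for X using Cs(1) that by blast
  have mid: "lies_above n ?e B" "lies_below n ?e' B" if "B \<in> ?mid" for B
    using max_strongly_separated_comparable[OF Cs S, of B] max_strongly_separated_comparable[OF Cs S', of B] that by blast+
  have "\<exists>f. consistent n f \<and> (\<forall>X\<in>?W. lies_below n f X) \<and> (\<forall>Y\<in>?U. lies_above n f Y)"
  proof (rule separating_orientation)
    show "?W \<subseteq> Pow {1..n}" "?U \<subseteq> Pow {1..n}" using Cs(1) A(1) by blast+
    show "chordal ?W" "chordal ?U" using Cs(2) A(1) unfolding chordal_def by blast+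
    fix X Y assume X: "X \<in> ?W" and Y: "Y \<in> ?U"
    have XY: "X \<subseteq> {1..n}" "Y \<subseteq> {1..n}" using X Y A(1) cn by blast+
    show "\<not> surrounds X Y"
    proof (cases "X = A \<and> Y \<in> ?mid")
      case True
      then show ?thesis using A(2) by blast
    next
      case False
      then consider "lies_below n ?e X" "lies_above n ?e Y" | "lies_below n ?e' X" "lies_above n ?e' Y"
        using X Y mid A(1) lies_below_dominated[OF dom] by blast
      then show ?thesis using separated_not_surrounds[OF _ _ XY] by cases blast+
    qed
  qed
  then obtain f where f: "consistent n f" "\<forall>X\<in>?W. lies_below n f X" "\<forall>Y\<in>?U. lies_above n f Y" by (elim exE conjE)
  let ?T = "separated n f"
  have T: "?T \<in> max_strongly_separated_in n C"
  proof (rule separated_max_strongly_separated[OF C f(1)])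
    fix X assume "X \<in> C"
    then have "X \<in> ?W \<or> X \<in> ?U" by blast
    then show "lies_below n f X \<or> lies_above n f X" using f(2,3) by blast
  qed
  have "dominated n ?e f"
  proof (rule dominatedI)
    fix a b c assume r: "0 < a" "a < b" "b < c" "c \<le> n" and "?e a b c"
    then obtain Z where Z: "Z \<in> S" "a \<in> Z" "b \<notin> Z" "c \<in> Z" unfolding orientation_def by blast
    then have "lies_below n f Z" using f(2) max_strongly_separated_memD[OF S] by simp
    then show "f a b c" using lies_belowD[OF _ r] Z by blast
  qed
  moreover have "dominated n f ?e'"
  proof (rule dominatedI)
    fix a b c assume r: "0 < a" "a < b" "b < c" "c \<le> n" and fabc: "f a b c"
    show "?e' a b c"
    proof (rule ccontr)
      assume "\<not> ?e' a b c"
      then obtain Y where Y: "Y \<in> S'" "a \<notin> Y" "b \<in> Y" "c \<notin> Y" using orientation_realizes_not[OF S' r] by blast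
      then have "lies_above n f Y" using f(3) max_strongly_separated_memD[OF S'] by simp
      then show False using lies_aboveD[OF _ r] Y fabc by blast
    qed
  qed
  ultimately have "?T = S \<or> ?T = S'"
    using adj[OF T] inversions_subset_separated[OF S f(1)] separated_subset_inversions[OF f(1)] by blast
  moreover have "A \<in> ?T" using f(2,3) A(1) cn unfolding separated_def by blast
  ultimately have "lies_below n ?e A \<or> lies_above n ?e' A"
    using max_strongly_separated_memD(1)[OF S] max_strongly_separated_memD(2)[OF S'] by blast
  then show False using A(1) by blast
qed

lemma raising_flip_if_adjacent:
  assumes C: "maximal_chord_separated_collection n C"
    and S: "S \<in> max_strongly_separated_in n C" and S': "S' \<in> max_strongly_separated_in n C"
    and sub: "inversions S \<subseteq> inversions S'" and ne: "S \<noteq> S'"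
    and adj: "\<And>T. T \<in> max_strongly_separated_in n C \<Longrightarrow> inversions S \<subseteq> inversions T \<Longrightarrow>
      inversions T \<subseteq> inversions S' \<Longrightarrow> T = S \<or> T = S'"
  shows "raising_flip n S S'"
proof -
  let ?e = "orientation S" and ?e' = "orientation S'"
  have dom: "dominated n ?e ?e'" by (rule dominated_orientation[OF sub])
  have "\<not> dominated n ?e' ?e"
    using separated_dominated_antisym[OF dom] ne
      max_strongly_separated_orientation(3)[OF S] max_strongly_separated_orientation(3)[OF S'] by metis
  then obtain i j k where t: "0 < i" "i < j" "j < k" "k \<le> n" "\<not> ?e i j k" "?e' i j k" "consistent n (raised ?e i j k)"
    by (rule raise_existsD[OF raise_exists_always max_strongly_separated_orientation(2)[OF S]
          max_strongly_separated_orientation(2)[OF S'] dom])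
  let ?f = "raised ?e i j k"
  have ef: "dominated n ?e ?f" unfolding dominated_def raised_def by blast
  have fe: "dominated n ?f ?e'" using dominatedD[OF dom] t(6) unfolding dominated_def raised_def by blast
  have T: "separated n ?f \<in> max_strongly_separated_in n C"
  proof (rule separated_max_strongly_separated[OF C t(7)])
    fix X assume "X \<in> C"
    then show "lies_below n ?f X \<or> lies_above n ?f X"
      using adjacent_comparable[OF C S S' sub adj] lies_below_dominated[OF ef] lies_above_dominated[OF fe] by blast
  qed
  have "(i, j, k) \<in> inversions (separated n ?f)"
    using t(1-4) unfolding inversions_separated[OF t(7)] by (simp add: raised_def)
  moreover have "(i, j, k) \<notin> inversions S" using t(5) by (simp add: mem_inversions)
  ultimately have "separated n ?f \<noteq> S" by metis
  then have "separated n ?f = S'"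
    using adj[OF T inversions_subset_separated[OF S t(7) ef] separated_subset_inversions[OF t(7) fe]] by blast
  moreover have "raisable_triple n ?e i j k"
    by unfold_locales (use t max_strongly_separated_orientation(2)[OF S] in simp_all)
  from raisable_triple.raising_flip_separated[OF this]
  have "raising_flip n (separated n ?e) (separated n ?f)" .
  ultimately show ?thesis using max_strongly_separated_orientation(3)[OF S] by simp
qed

text \<open>A triple whose value changes has an in-out-in witness in one collection and an
  out-in-out witness in the other, and neither is common to both. So the witnesses are the two
  exchanged sets, whose differences leave only the triple \<open>(i, j, k)\<close>.\<close>

lemma inversions_raising_flip:
  assumes S: "S \<in> max_strongly_separated_in n C" and S': "S' \<in> max_strongly_separated_in n C"
    and flip: "raising_flip n S S'"
  shows "\<exists>t. t \<notin> inversions S \<and> inversions S' = insert t (inversions S)"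
proof -
  obtain i j k X where ord: "i < j" "j < k" and ran: "i \<in> {1..n}" "j \<in> {1..n}" "k \<in> {1..n}"
    and X: "X \<subseteq> {1..n} - {i, j, k}" and XS: "X \<union> {j} \<in> S" and S'eq: "S' = (S - {X \<union> {j}}) \<union> {X \<union> {i, k}}"
    using flip unfolding raising_flip_def by blast
  let ?e = "orientation S" and ?e' = "orientation S'"
  have r: "0 < i" "k \<le> n" using ran by auto
  have nX: "i \<notin> X" "j \<notin> X" "k \<notin> X" using X by auto
  have low: "\<not> ?e i j k"
    using lies_aboveD[OF max_strongly_separated_memD(2)[OF S XS] r(1) ord r(2)] nX ord by auto
  have high: "?e' i j k" unfolding orientation_def S'eq
    by (rule bexI[of _ "X \<union> {i, k}"]) (use nX ord in auto)
  have same: "?e a b c \<longleftrightarrow> ?e' a b c" if abc: "0 < a" "a < b" "b < c" "c \<le> n" "\<not> (a = i \<and> b = j \<and> c = k)" for a b c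
  proof
    assume "?e a b c"
    then obtain A where A: "A \<in> S" "a \<in> A" "b \<notin> A" "c \<in> A" unfolding orientation_def by blast
    show "?e' a b c"
    proof (rule ccontr)
      assume ne: "\<not> ?e' a b c"
      then obtain B where B: "B \<in> S'" "a \<notin> B" "b \<in> B" "c \<notin> B" using orientation_realizes_not[OF S' abc(1-4)] by blast
      have "A \<notin> S'" using ne A unfolding orientation_def by blast
      then have "A = X \<union> {j}" using A(1) S'eq by blast
      moreover have "B \<notin> S"
        using lies_aboveD[OF max_strongly_separated_memD(2)[OF S] abc(1-4)] B \<open>?e a b c\<close> by blast
      then have "B = X \<union> {i, k}" using B(1) S'eq by blast
      \<comment> \<open>Here \<open>A - B\<close> would be the singleton of \<open>j\<close>, yet it
        contains both \<open>a\<close> and \<open>c\<close>.\<close>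
      ultimately show False using A B abc by auto
    qed
  next
    assume "?e' a b c"
    then obtain A where A: "A \<in> S'" "a \<in> A" "b \<notin> A" "c \<in> A" unfolding orientation_def by blast
    show "?e a b c"
    proof (rule ccontr)
      assume ne: "\<not> ?e a b c"
      then obtain B where B: "B \<in> S" "a \<notin> B" "b \<in> B" "c \<notin> B" using orientation_realizes_not[OF S abc(1-4)] by blast
      have "A \<notin> S" using ne A unfolding orientation_def by blast
      then have "A = X \<union> {i, k}" using A(1) S'eq by blast
      moreover have "B \<notin> S'"
        using lies_aboveD[OF max_strongly_separated_memD(2)[OF S'] abc(1-4)] B \<open>?e' a b c\<close> by blast
      then have "B = X \<union> {j}" using B(1) S'eq by blast
      ultimately show False using A B abc ord by auto
    qed
  qed
  have "(a, b, c) \<in> inversions S' \<longleftrightarrow> (a, b, c) = (i, j, k) \<or> (a, b, c) \<in> inversions S" for a b c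
  proof (cases "0 < a \<and> a < b \<and> b < c \<and> c \<le> n")
    case True
    then show ?thesis using same[of a b c] high low by (auto simp: mem_inversions)
  next
    case False
    then show ?thesis using inversions_range[OF S, of a b c] inversions_range[OF S', of a b c] r ord by auto
  qed
  then have "inversions S' = insert (i, j, k) (inversions S)" by auto
  moreover have "(i, j, k) \<notin> inversions S" using low by (simp add: mem_inversions)
  ultimately show ?thesis by blast
qed

theorem corollary4p4:
  fixes n :: nat and C :: "nat set set"
  assumes "maximal_chord_separated_collection n C"
  shows "\<exists>L :: nat set set gorder.
           carrier L = max_strongly_separated_in n C \<and>
           distributive_lattice L \<and>
           least L (intervals n) (carrier L) \<and>
           greatest L (co_intervals n) (carrier L) \<and>
           (\<forall>S \<in> carrier L. \<forall>S' \<in> carrier L.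
              immediately_precedes L S S' \<longleftrightarrow> raising_flip n S S')"
proof -
  let ?M = "max_strongly_separated_in n C"
  let ?L = "inclusion_order inversions ?M"
  note Cs = maximal_chord_separatedD(1,2)[OF assms]
  have inj: "inversions S = inversions T \<longleftrightarrow> S = T" if "S \<in> ?M" "T \<in> ?M" for S T
    using inj_on_eq_iff[OF inj_on_inversions that] .
  have lattice: "distributive_lattice ?L"
    by (rule distributive_lattice_inclusion_order[OF inj_on_inversions exists_meet_and_join[OF Cs]])
  have least: "least ?L (intervals n) ?M"
    using intervals_max_strongly_separated[OF assms] by (simp add: least_def inversions_intervals)
  have "inversions S \<subseteq> inversions (co_intervals n)" if "S \<in> ?M" for S
    using inversions_range[OF that] unfolding inversions_co_intervals by auto
  then have greatest: "greatest ?L (co_intervals n) ?M"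
    using co_intervals_max_strongly_separated[OF assms] by (simp add: greatest_def)
  have cover: "immediately_precedes ?L S S' \<longleftrightarrow> raising_flip n S S'" if S: "S \<in> ?M" and S': "S' \<in> ?M" for S S'
  proof
    assume "immediately_precedes ?L S S'"
    then have *: "inversions S \<subseteq> inversions S'" "S \<noteq> S'"
      "\<And>T. T \<in> ?M \<Longrightarrow> inversions S \<subseteq> inversions T \<Longrightarrow> S \<noteq> T \<Longrightarrow> inversions T \<subseteq> inversions S' \<Longrightarrow> T = S'"
      unfolding immediately_precedes_def lless_def by auto
    show "raising_flip n S S'"
    proof (rule raising_flip_if_adjacent[OF assms S S' *(1,2)])
      fix T assume "T \<in> ?M" "inversions S \<subseteq> inversions T" "inversions T \<subseteq> inversions S'"
      then show "T = S \<or> T = S'" using *(3)[of T] by (cases "S = T") simp_all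
    qed
  next
    assume "raising_flip n S S'"
    then obtain t where t: "t \<notin> inversions S" "inversions S' = insert t (inversions S)"
      using inversions_raising_flip[OF S S'] by blast
    have "S \<noteq> S'" using t by blast
    moreover have "T = S \<or> T = S'" if "T \<in> ?M" "inversions S \<subseteq> inversions T" "inversions T \<subseteq> inversions S'" for T
    proof -
      have "inversions T = inversions S \<or> inversions T = inversions S'"
        using that(2,3) unfolding t(2) by (cases "t \<in> inversions T") auto
      then show ?thesis using inj that(1) S S' by blast
    qed
    ultimately show "immediately_precedes ?L S S'"
      using S S' t unfolding immediately_precedes_def lless_def by auto
  qed
  show ?thesis
    by (rule exI[of _ ?L]) (use lattice least greatest cover in simp)
qed

end
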